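(* Let $X$ be a simply connected CW-complex of finite type which is elliptic and coformal, and let $e=e_0(X)$. Then either $\dim H^*_k(X,\mathbb{Q})\geq 2$ for every $k=1,\ldots,e-1$, or $H^*(X,\mathbb{Q})$ is a truncated polynomial algebra on a single generator.
   Context: All vector spaces and algebras are over $\mathbb{Q}$. Let $X$ be a simply connected CW-complex of finite type with minimal Sullivan model $(\Lambda V,d)$; here $V=\bigoplus_{i\ge 2}V^i$, $V^i\cong \mathrm{Hom}_{\mathbb{Z}}(\pi_i(X),\mathbb{Q})$, $H^*(\Lambda V,d)\cong H^*(X,\mathbb{Q})$, and $\Lambda^k V$ denotes the span of products of exactly $k$ elements of $V$ (word length $k$). Elliptic: $\pi_*(X)\otimes\mathbb{Q}$ and $H_*(X,\mathbb{Q})$ are both finite dimensional (equivalently $\dim V<\infty$ and $\dim H(\Lambda V,d)<\infty$). Coformal: the differential of the minimal Sullivan model is purely quadratic, $d(V)\subseteq\Lambda^2V$. Lower grading: when $X$ is coformal, $d$ maps $\Lambda^kV$ to $\Lambda^{k+1}V$; $H^*_k(X,\mathbb{Q})=H^*_k(\Lambda V,d)$ is the subspace of classes represented by cocycles in $\Lambda^kV$, and $H^*(X,\mathbb{Q})=\bigoplus_{k\ge0}H^*_k(X,\mathbb{Q})$. $\dim H^*_k$ is the total dimension over all degrees. Rational Toomer invariant: for elliptic $X$, $H^*(X,\mathbb{Q})$ satisfies Poincaré duality; let $\omega$ be a generator of its one-dimensional top-degree part (fundamental class). Then $e_0(X)=\sup\{k \mid \omega \text{ can be represented by a cocycle in }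 \Lambda^{\geq k}V\}$. (For elliptic coformal spaces it is known that $e_0(X)=\dim V^{odd}$.) *)

theory Defs
  imports
    "HOL-Homology.Homology"
    "HOL-Library.Poly_Mapping"
    "HOL-Library.Function_Algebras"
    "HOL-Library.Multiset"
    "HOL-Library.Extended_Nat"
    "HOL-Computational_Algebra.Polynomial"
begin

section \<open>Differential graded algebras over the rationals and their cohomology\<close>

text \<open>
  The additive structure is that of the ambient type; the algebra itself consists of the finite
  sums of homogeneous elements (\<open>dga_carrier\<close> below), and the operations are
  only meaningful there.
\<close>

record 'a dg_algebra =
  hom_part :: "nat \<Rightarrow> 'a set"
  scal :: "rat \<Rightarrow> 'a \<Rightarrow> 'a"
  unit_el :: 'a
  mult_el :: "'a \<Rightarrow> 'a \<Rightarrow> 'a"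
  diff :: "'a \<Rightarrow> 'a"

definition dga_carrier :: "('a::ab_group_add) dg_algebra \<Rightarrow> 'a set" where
  "dga_carrier A = {\<Sum>i\<le>n. f i | f n. \<forall>i\<le>n. f i \<in> hom_part A i}"

definition cocycles :: "('a::ab_group_add) dg_algebra \<Rightarrow> 'a set" where
  "cocycles A = {z \<in> dga_carrier A. diff A z = 0}"

definition coboundaries :: "('a::ab_group_add) dg_algebra \<Rightarrow> 'a set" where
  "coboundaries A = diff A ` dga_carrier A"

definition pow_el :: "'a dg_algebra \<Rightarrow> 'a \<Rightarrow> nat \<Rightarrow> 'a" where
  "pow_el A x n = (mult_el A x ^^ n) (unit_el A)"

text \<open>
  The dimension of the subspace of cohomology consisting of the classes represented by the cocycles
  in \<open>U\<close>: the supremum of the sizes of finite subsets of \<open>U\<close> that are linearly independent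
  modulo coboundaries.
\<close>

definition indep_mod_coboundaries :: "('a::ab_group_add) dg_algebra \<Rightarrow> 'a set \<Rightarrow> bool" where
  "indep_mod_coboundaries A S \<longleftrightarrow>
     (\<forall>c. (\<Sum>s\<in>S. scal A (c s) s) \<in> coboundaries A \<longrightarrow> (\<forall>s\<in>S. c s = 0))"

definition cohomology_dim :: "('a::ab_group_add) dg_algebra \<Rightarrow> 'a set \<Rightarrow> enat" where
  "cohomology_dim A U =
     (SUP S \<in> {S. finite S \<and> S \<subseteq> U \<inter> cocycles A \<and> indep_mod_coboundaries A S}. enat (card S))"

definition dga_derivation :: "('a::ab_group_add) dg_algebra \<Rightarrow> bool" where
  "dga_derivation A \<longleftrightarrow>
     (\<forall>p. \<forall>x \<in> hom_part A p. diff A x \<in> hom_part A (p + 1)) \<and>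
     (\<forall>x \<in> dga_carrier A. \<forall>y \<in> dga_carrier A. diff A (x + y) = diff A x + diff A y) \<and>
     (\<forall>c. \<forall>x \<in> dga_carrier A. diff A (scal A c x) = scal A c (diff A x)) \<and>
     (\<forall>p. \<forall>x \<in> hom_part A p. \<forall>y \<in> dga_carrier A.
        diff A (mult_el A x y) =
          mult_el A (diff A x) y + scal A ((-1) ^ p) (mult_el A x (diff A y))) \<and>
     (\<forall>x \<in> dga_carrier A. diff A (diff A x) = 0)"

definition dga_quasi_iso ::
    "('a::ab_group_add) dg_algebra \<Rightarrow> ('b::ab_group_add) dg_algebra \<Rightarrow> ('a \<Rightarrow> 'b) \<Rightarrow> bool" where
  "dga_quasi_iso A B \<phi> \<longleftrightarrow>
     (\<forall>p. \<forall>x \<in> hom_part A p. \<phi> x \<in> hom_part B p) \<and>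
     (\<forall>x \<in> dga_carrier A. \<forall>y \<in> dga_carrier A. \<phi> (x + y) = \<phi> x + \<phi> y) \<and>
     (\<forall>c. \<forall>x \<in> dga_carrier A. \<phi> (scal A c x) = scal B c (\<phi> x)) \<and>
     (\<forall>x \<in> dga_carrier A. \<forall>y \<in> dga_carrier A. \<phi> (mult_el A x y) = mult_el B (\<phi> x) (\<phi> y)) \<and>
     \<phi> (unit_el A) = unit_el B \<and>
     (\<forall>x \<in> dga_carrier A. \<phi> (diff A x) = diff B (\<phi> x)) \<and>
     (\<forall>z \<in> cocycles A. \<phi> z \<in> coboundaries B \<longrightarrow> z \<in> coboundaries A) \<and>
     (\<forall>w \<in> cocycles B. \<exists>z \<in> cocycles A. w - \<phi> z \<in> coboundaries B)"

text \<open>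
  The cohomology algebra is isomorphic to \<open>\<rat>[t]/(t\<^bsup>n+1\<^esup>)\<close> with \<open>n \<ge> 1\<close>: for a homogeneous class
  \<open>[x]\<close> of positive degree, evaluation of polynomials at \<open>[x]\<close> is onto the
  cohomology algebra and has kernel \<open>(t\<^bsup>n+1\<^esup>)\<close>.
\<close>

definition poly_at :: "('a::ab_group_add) dg_algebra \<Rightarrow> rat poly \<Rightarrow> 'a \<Rightarrow> 'a" where
  "poly_at A q x = (\<Sum>i\<le>degree q. scal A (coeff q i) (pow_el A x i))"

definition truncated_polynomial_cohomology :: "('a::ab_group_add) dg_algebra \<Rightarrow> bool" where
  "truncated_polynomial_cohomology A \<longleftrightarrow>
     (\<exists>p \<ge> 1. \<exists>n \<ge> 1. \<exists>x \<in> hom_part A p. diff A x = 0 \<and>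
        (\<forall>z \<in> cocycles A. \<exists>q. z - poly_at A q x \<in> coboundaries A) \<and>
        (\<forall>q. poly_at A q x \<in> coboundaries A \<longleftrightarrow> [:0, 1:] ^ (n + 1) dvd q))"


section \<open>Free graded commutative algebras\<close>

text \<open>
  \<open>V\<close> is given by a homogeneous basis \<open>G\<close>, linearly ordered by its type, with degrees \<open>dg\<close>.
  A multiset over \<open>G\<close> in which no generator of odd degree is repeated stands for the product
  of its elements in increasing order; these monomials form a basis of \<open>\<Lambda>V\<close>.
\<close>

type_synonym 'v gpoly = "'v multiset \<Rightarrow>\<^sub>0 rat"

definition gpoly_scale :: "rat \<Rightarrow> 'v gpoly \<Rightarrow> 'v gpoly" where
  "gpoly_scale c a = Poly_Mapping.map (\<lambda>x. c * x) a"

definition gpoly_one :: "'v gpoly" where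
  "gpoly_one = Poly_Mapping.single {#} 1"

definition gpoly_gen :: "'v \<Rightarrow> 'v gpoly" where
  "gpoly_gen v = Poly_Mapping.single {#v#} 1"

text \<open>
  The sign is the Koszul sign of sorting the concatenation of two increasing monomials: one
  factor \<open>-1\<close> for each pair of odd generators that is out of order.
\<close>

definition mono_mult :: "('v::linorder \<Rightarrow> nat) \<Rightarrow> 'v multiset \<Rightarrow> 'v multiset \<Rightarrow> 'v gpoly" where
  "mono_mult dg m n =
     (if \<exists>v. odd (dg v) \<and> v \<in># m \<and> v \<in># n then 0
      else Poly_Mapping.single (m + n)
        ((-1) ^ card {(a, b). a \<in># m \<and> b \<in># n \<and> odd (dg a) \<and> odd (dg b) \<and> b < a}))"

definition gpoly_mult :: "('v::linorder \<Rightarrow> nat) \<Rightarrow> 'v gpoly \<Rightarrow> 'v gpoly \<Rightarrow> 'v gpoly" where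
  "gpoly_mult dg a b =
     (\<Sum>m \<in> Poly_Mapping.keys a. \<Sum>n \<in> Poly_Mapping.keys b.
        gpoly_scale (Poly_Mapping.lookup a m * Poly_Mapping.lookup b n) (mono_mult dg m n))"

definition monomials :: "'v set \<Rightarrow> ('v \<Rightarrow> nat) \<Rightarrow> nat \<Rightarrow> 'v multiset set" where
  "monomials G dg p =
     {m. set_mset m \<subseteq> G \<and> (\<forall>v. odd (dg v) \<longrightarrow> count m v \<le> 1) \<and> (\<Sum>v\<in>#m. dg v) = p}"

definition gpoly_hom :: "'v set \<Rightarrow> ('v \<Rightarrow> nat) \<Rightarrow> nat \<Rightarrow> 'v gpoly set" where
  "gpoly_hom G dg p = {a. Poly_Mapping.keys a \<subseteq> monomials G dg p}"

definition free_cdga ::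
    "'v::linorder set \<Rightarrow> ('v \<Rightarrow> nat) \<Rightarrow> ('v gpoly \<Rightarrow> 'v gpoly) \<Rightarrow> 'v gpoly dg_algebra" where
  "free_cdga G dg d =
     \<lparr>hom_part = gpoly_hom G dg, scal = gpoly_scale, unit_el = gpoly_one,
      mult_el = gpoly_mult dg, diff = d\<rparr>"

definition word_length_eq :: "nat \<Rightarrow> 'v gpoly set" where
  "word_length_eq k = {a. \<forall>m \<in> Poly_Mapping.keys a. size m = k}"

definition word_length_ge :: "nat \<Rightarrow> 'v gpoly set" where
  "word_length_ge k = {a. \<forall>m \<in> Poly_Mapping.keys a. k \<le> size m}"


section \<open>Pullbacks of singular simplices\<close>

text \<open>
  For \<open>\<alpha>\<close> monotone from \<open>{0..m}\<close> to \<open>{0..n}\<close>, \<open>simplex_map m \<alpha>\<close> is the affine map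
  from the standard \<open>m\<close>-simplex to the standard \<open>n\<close>-simplex
  that takes vertex \<open>i\<close> to vertex \<open>\<alpha> i\<close>.
\<close>

definition simplex_op :: "nat \<Rightarrow> nat \<Rightarrow> (nat \<Rightarrow> nat) \<Rightarrow> bool" where
  "simplex_op m n \<alpha> \<longleftrightarrow> mono_on {..m} \<alpha> \<and> \<alpha> ` {..m} \<subseteq> {..n}"

definition simplex_map :: "nat \<Rightarrow> (nat \<Rightarrow> nat) \<Rightarrow> (nat \<Rightarrow> real) \<Rightarrow> nat \<Rightarrow> real" where
  "simplex_map m \<alpha> x = (\<lambda>j. \<Sum>i \<in> {i. i \<le> m \<and> \<alpha> i = j}. x i)"

definition simplex_pullback ::
    "nat \<Rightarrow> (nat \<Rightarrow> nat) \<Rightarrow> ((nat \<Rightarrow> real) \<Rightarrow> 'x) \<Rightarrow> (nat \<Rightarrow> real) \<Rightarrow> 'x" where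
  "simplex_pullback m \<alpha> \<sigma> = restrict (\<sigma> \<circ> simplex_map m \<alpha>) (standard_simplex m)"


section \<open>Polynomial differential forms\<close>

text \<open>
  The rational polynomial forms on the \<open>n\<close>-simplex,
  \<open>\<Lambda>(t\<^sub>0,\<dots>,t\<^sub>n,dt\<^sub>0,\<dots>,dt\<^sub>n) / (\<Sum>t\<^sub>i - 1, \<Sum>dt\<^sub>i)\<close>, are represented by the free graded commutative
  algebra on \<open>t\<^sub>1,\<dots>,t\<^sub>n,dt\<^sub>1,\<dots>,dt\<^sub>n\<close>, eliminating \<open>t\<^sub>0\<close> and \<open>dt\<^sub>0\<close>. The natural
  number \<open>2 * i\<close> encodes \<open>t\<^sub>i\<close> and \<open>2 * i + 1\<close> encodes \<open>dt\<^sub>i\<close>.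
\<close>

definition form_deg :: "nat \<Rightarrow> nat" where
  "form_deg g = g mod 2"

definition form_gens :: "nat \<Rightarrow> nat set" where
  "form_gens n = {g. 1 \<le> g div 2 \<and> g div 2 \<le> n}"

text \<open>\<open>d\<omega> = \<Sum>\<^sub>i dt\<^sub>i (\<partial>\<omega>/\<partial>t\<^sub>i)\<close>\<close>

definition form_d :: "nat gpoly \<Rightarrow> nat gpoly" where
  "form_d a =
     (\<Sum>m \<in> Poly_Mapping.keys a. \<Sum>g \<in> {g. g \<in># m \<and> even g}.
        gpoly_scale (Poly_Mapping.lookup a m * of_nat (count m g))
          (mono_mult form_deg {#g + 1#} (m - {#g#})))"

definition bary_coord :: "nat \<Rightarrow> nat \<Rightarrow> nat gpoly" where
  "bary_coord m i =
     (if i = 0 then gpoly_one - (\<Sum>j=1..m. gpoly_gen (2 * j)) else gpoly_gen (2 * i))"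

definition bary_diff :: "nat \<Rightarrow> nat \<Rightarrow> nat gpoly" where
  "bary_diff m i =
     (if i = 0 then - (\<Sum>j=1..m. gpoly_gen (2 * j + 1)) else gpoly_gen (2 * i + 1))"

text \<open>
  The algebra map \<open>\<alpha>\<^sup>*\<close> sends \<open>t\<^sub>j\<close> to \<open>\<Sum>\<^bsub>\<alpha> i = j\<^esub> t\<^sub>i\<close> and \<open>dt\<^sub>j\<close> to \<open>\<Sum>\<^bsub>\<alpha> i = j\<^esub> dt\<^sub>i\<close>.
\<close>

definition form_pullback_gen :: "nat \<Rightarrow> (nat \<Rightarrow> nat) \<Rightarrow> nat \<Rightarrow> nat gpoly" where
  "form_pullback_gen m \<alpha> g =
     (\<Sum>i \<in> {i. i \<le> m \<and> \<alpha> i = g div 2}. if even g then bary_coord m i else bary_diff m i)"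

definition form_pullback :: "nat \<Rightarrow> (nat \<Rightarrow> nat) \<Rightarrow> nat gpoly \<Rightarrow> nat gpoly" where
  "form_pullback m \<alpha> a =
     (\<Sum>u \<in> Poly_Mapping.keys a.
        gpoly_scale (Poly_Mapping.lookup a u)
          (foldr (\<lambda>g b. gpoly_mult form_deg (form_pullback_gen m \<alpha> g) b)
             (sorted_list_of_multiset u) gpoly_one))"

text \<open>
  Sullivan's algebra \<open>A\<^bsub>PL\<^esub>(X)\<close>: the simplicial maps from the singular simplicial set
  of \<open>X\<close> to the simplicial algebra of polynomial forms.
\<close>

definition A_PL_hom ::
    "'x topology \<Rightarrow> nat \<Rightarrow> (nat \<Rightarrow> ((nat \<Rightarrow> real) \<Rightarrow> 'x) \<Rightarrow> nat gpoly) set" where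
  "A_PL_hom X p =
     {\<Phi>. (\<forall>n \<sigma>. singular_simplex n X \<sigma> \<longrightarrow> \<Phi> n \<sigma> \<in> gpoly_hom (form_gens n) form_deg p) \<and>
         (\<forall>n \<sigma>. \<not> singular_simplex n X \<sigma> \<longrightarrow> \<Phi> n \<sigma> = 0) \<and>
         (\<forall>m n \<alpha> \<sigma>. simplex_op m n \<alpha> \<and> singular_simplex n X \<sigma> \<longrightarrow>
            \<Phi> m (simplex_pullback m \<alpha> \<sigma>) = form_pullback m \<alpha> (\<Phi> n \<sigma>))}"

definition A_PL ::
    "'x topology \<Rightarrow> (nat \<Rightarrow> ((nat \<Rightarrow> real) \<Rightarrow> 'x) \<Rightarrow> nat gpoly) dg_algebra" where
  "A_PL X =
     \<lparr>hom_part = A_PL_hom X,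
      scal = (\<lambda>c \<Phi> n \<sigma>. gpoly_scale c (\<Phi> n \<sigma>)),
      unit_el = (\<lambda>n \<sigma>. if singular_simplex n X \<sigma> then gpoly_one else 0),
      mult_el = (\<lambda>\<Phi> \<Psi> n \<sigma>. gpoly_mult form_deg (\<Phi> n \<sigma>) (\<Psi> n \<sigma>)),
      diff = (\<lambda>\<Phi> n \<sigma>. form_d (\<Phi> n \<sigma>))\<rparr>"


section \<open>Singular cochains with rational coefficients\<close>

text \<open>
  A cochain \<open>f\<close> is a family over all degrees; \<open>f n \<sigma>\<close> is its value on the \<open>n\<close>-simplex \<open>\<sigma>\<close>. The
  product is the cup product, pairing the front \<open>p\<close>-face with the back \<open>(n-p)\<close>-face.
\<close>

definition cochain_hom ::
    "'x topology \<Rightarrow> nat \<Rightarrow> (nat \<Rightarrow> ((nat \<Rightarrow> real) \<Rightarrow> 'x) \<Rightarrow> rat) set" where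
  "cochain_hom X p = {f. \<forall>n \<sigma>. n \<noteq> p \<or> \<not> singular_simplex n X \<sigma> \<longrightarrow> f n \<sigma> = 0}"

definition singular_cochain_dga ::
    "'x topology \<Rightarrow> (nat \<Rightarrow> ((nat \<Rightarrow> real) \<Rightarrow> 'x) \<Rightarrow> rat) dg_algebra" where
  "singular_cochain_dga X =
     \<lparr>hom_part = cochain_hom X,
      scal = (\<lambda>c f n \<sigma>. c * f n \<sigma>),
      unit_el = (\<lambda>n \<sigma>. if n = 0 \<and> singular_simplex 0 X \<sigma> then 1 else 0),
      mult_el = (\<lambda>f g n \<sigma>. if singular_simplex n X \<sigma>
         then \<Sum>p\<le>n. f p (simplex_pullback p (\<lambda>i. i) \<sigma>)
                    * g (n - p) (simplex_pullback (n - p) (\<lambda>i. i + p) \<sigma>)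
         else 0),
      diff = (\<lambda>f n \<sigma>. if 0 < n \<and> singular_simplex n X \<sigma>
         then \<Sum>k\<le>n. (-1) ^ k * f (n - 1) (singular_face n k \<sigma>)
         else 0)\<rparr>"


section \<open>Simply connected CW complexes of finite type\<close>

definition simply_connected_space :: "'x topology \<Rightarrow> bool" where
  "simply_connected_space X \<longleftrightarrow>
     topspace X \<noteq> {} \<and> path_connected_space X \<and>
     (\<forall>g. pathin X g \<and> g 0 = g 1 \<longrightarrow>
        homotopic_with (\<lambda>h. h 0 = g 0 \<and> h 1 = g 0) (top_of_set {0..1}) X g (\<lambda>_. g 0))"

definition disc :: "nat \<Rightarrow> (nat \<Rightarrow> real) set" where
  "disc n = {x \<in> topspace (Euclidean_space n). (\<Sum>i<n. (x i)\<^sup>2) \<le> 1}"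

definition open_disc :: "nat \<Rightarrow> (nat \<Rightarrow> real) set" where
  "open_disc n = {x \<in> topspace (Euclidean_space n). (\<Sum>i<n. (x i)\<^sup>2) < 1}"

text \<open>\<open>C n\<close> is the set of characteristic maps of the \<open>n\<close>-cells.\<close>

definition cw_structure :: "'x topology \<Rightarrow> (nat \<Rightarrow> ((nat \<Rightarrow> real) \<Rightarrow> 'x) set) \<Rightarrow> bool" where
  "cw_structure X C \<longleftrightarrow>
     Hausdorff_space X \<and>
     (\<forall>n. \<forall>f \<in> C n.
        continuous_map (subtopology (Euclidean_space n) (disc n)) X f \<and>
        embedding_map (subtopology (Euclidean_space n) (open_disc n)) X f \<and>
        (\<exists>F. finite F \<and> F \<subseteq> (SIGMA k:{..<n}. C k) \<and>
           f ` (disc n - open_disc n) \<subseteq> (\<Union>(k, h) \<in> F. h ` open_disc k))) \<and>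
     (\<forall>x \<in> topspace X. \<exists>!(n, f). f \<in> C n \<and> x \<in> f ` open_disc n) \<and>
     (\<forall>S \<subseteq> topspace X. closedin X S \<longleftrightarrow> (\<forall>n. \<forall>f \<in> C n. closedin X (S \<inter> f ` disc n)))"

definition cw_complex_of_finite_type :: "'x topology \<Rightarrow> bool" where
  "cw_complex_of_finite_type X \<longleftrightarrow> (\<exists>C. cw_structure X C \<and> (\<forall>n. finite (C n)))"


section \<open>Minimal Sullivan models\<close>

text \<open>
  Since all generators have degree at least 2, decomposability of the differential implies the
  nilpotence condition in the general definition of a Sullivan algebra.
\<close>

definition minimal_sullivan_algebra ::
    "'v::linorder set \<Rightarrow> ('v \<Rightarrow> nat) \<Rightarrow> ('v gpoly \<Rightarrow> 'v gpoly) \<Rightarrow> bool" where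
  "minimal_sullivan_algebra G dg d \<longleftrightarrow>
     (\<forall>v \<in> G. 2 \<le> dg v) \<and> dga_derivation (free_cdga G dg d) \<and>
     (\<forall>v \<in> G. d (gpoly_gen v) \<in> word_length_ge 2)"

definition minimal_sullivan_model ::
    "'x topology \<Rightarrow> 'v::linorder set \<Rightarrow> ('v \<Rightarrow> nat) \<Rightarrow> ('v gpoly \<Rightarrow> 'v gpoly) \<Rightarrow> bool" where
  "minimal_sullivan_model X G dg d \<longleftrightarrow>
     minimal_sullivan_algebra G dg d \<and> (\<exists>\<phi>. dga_quasi_iso (free_cdga G dg d) (A_PL X) \<phi>)"

text \<open>
  Ellipticity of a space, expressed on its minimal model: \<open>dim V < \<infinity>\<close> and \<open>dim H(\<Lambda>V,d) < \<infinity>\<close>.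
  Because \<open>V\<close> is dual to the rational homotopy and \<open>H(\<Lambda>V,d)\<close> to the rational homology, this
  says that the rational homotopy and the rational homology are finite dimensional.
\<close>

definition elliptic ::
    "'v::linorder set \<Rightarrow> ('v \<Rightarrow> nat) \<Rightarrow> ('v gpoly \<Rightarrow> 'v gpoly) \<Rightarrow> bool" where
  "elliptic G dg d \<longleftrightarrow> finite G \<and> cohomology_dim (free_cdga G dg d) UNIV < \<infinity>"

definition coformal :: "'v set \<Rightarrow> ('v gpoly \<Rightarrow> 'v gpoly) \<Rightarrow> bool" where
  "coformal G d \<longleftrightarrow> (\<forall>v \<in> G. d (gpoly_gen v) \<in> word_length_eq 2)"

text \<open>The total dimension of the lower degree \<open>k\<close> part of the cohomology.\<close>

definition lower_cohomology_dim ::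
    "'v::linorder set \<Rightarrow> ('v \<Rightarrow> nat) \<Rightarrow> ('v gpoly \<Rightarrow> 'v gpoly) \<Rightarrow> nat \<Rightarrow> enat" where
  "lower_cohomology_dim G dg d k = cohomology_dim (free_cdga G dg d) (word_length_eq k)"

text \<open>
  A nonzero class in the highest nonvanishing degree. By Poincare duality that degree is one
  dimensional in the elliptic case, so that this is the same as a generator of it.
\<close>

definition represents_fundamental_class :: "('a::ab_group_add) dg_algebra \<Rightarrow> 'a \<Rightarrow> bool" where
  "represents_fundamental_class A w \<longleftrightarrow>
     (\<exists>n. w \<in> hom_part A n \<and> w \<in> cocycles A \<and> w \<notin> coboundaries A \<and>
        (\<forall>m > n. hom_part A m \<inter> cocycles A \<subseteq> coboundaries A))"

text \<open>The rational Toomer invariant, for a cocycle \<open>w\<close> representing the fundamental class.\<close>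

definition rational_toomer ::
    "'v::linorder set \<Rightarrow> ('v \<Rightarrow> nat) \<Rightarrow> ('v gpoly \<Rightarrow> 'v gpoly) \<Rightarrow> 'v gpoly \<Rightarrow> enat" where
  "rational_toomer G dg d w =
     (SUP k \<in> {k. \<exists>z \<in> cocycles (free_cdga G dg d) \<inter> word_length_ge k.
                  w - z \<in> coboundaries (free_cdga G dg d)}. enat k)"

end

theory Submission
  imports Defs "HOL-Library.Multiset_Order"
begin

text \<open>
  Write \<open>H\<^sub>k\<close> for the part of \<open>H(\<Lambda>V,d)\<close> of lower degree \<open>k\<close> and \<open>e\<close> for the Toomer invariant. It is the
  first alternative that is proved. It covers the truncated polynomial algebras as well: among
  coformal models these come only from \<open>\<Lambda>(x)\<close> with \<open>x\<close> odd and from \<open>\<Lambda>(x,y)\<close> with \<open>x\<close> even and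
  \<open>dy = x\<^sup>2\<close>, where \<open>e = 1\<close> leaves no \<open>k\<close> to consider. By the definition of \<open>e\<close> some cocycle of word
  length at least \<open>e\<close> is not a coboundary. So it suffices to show: if \<open>k \<ge> 1\<close> and \<open>dim H\<^sub>k \<le> 1\<close>, then
  \<open>H\<^sub>j = 0\<close> for every \<open>j > k\<close> (\<open>cohomology_vanishes_above\<close>). Here \<open>V\<close> may be assumed to contain an odd
  generator, because otherwise \<open>d = 0\<close> and \<open>H\<close> is finite dimensional only for \<open>V = 0\<close>
  (\<open>even_generators\<close>).

  The reason is a rank count. Let \<open>L\<close> be the graded Lie algebra whose bracket is dual to the quadratic
  differential. Then \<open>H\<^sub>k = Ext\<^sup>k(\<rat>,\<rat>)\<close> over \<open>UL\<close>, so the minimal free resolution \<open>F\<close> of \<open>\<rat>\<close> over \<open>UL\<close>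
  has \<open>F\<^sub>k = UL \<otimes> H\<^sub>k\<^sup>*\<close>. Measure a graded module by the limit, as \<open>t\<close> tends to \<open>1\<close>, of its
  Hilbert series divided by that of \<open>UL\<close>. Two facts hold. The images of the maps \<open>F\<^sub>k\<^sub>+\<^sub>1 \<rightarrow> F\<^sub>k\<close> have
  integral rank, since by exactness the rank is an alternating sum of the numbers \<open>dim H\<^sub>j\<close>. And a
  nonzero map between free modules has an image of positive rank. If \<open>dim H\<^sub>k \<le> 1\<close>, the images of
  \<open>F\<^sub>k\<^sub>+\<^sub>1 \<rightarrow> F\<^sub>k\<close> and \<open>F\<^sub>k \<rightarrow> F\<^sub>k\<^sub>-\<^sub>1\<close> have total rank at most \<open>1\<close>, so one of the two maps vanishes. For
  \<open>k \<ge> 1\<close> and \<open>H\<^sub>k \<noteq> 0\<close> the second one does not, by minimality; hence the first one does, and then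
  minimality gives \<open>F\<^sub>k\<^sub>+\<^sub>1 = 0\<close>. The argument repeats with \<open>k + 1\<close> in place of \<open>k\<close>.

  The proof is carried out in dual form, where \<open>UL\<close> need not be constructed. Let \<open>A = \<Lambda>(sV)\<close>, with a generator
  \<open>sv\<close> of degree \<open>|v| - 1\<close> for every generator \<open>v\<close>. The acyclic closure \<open>(\<Lambda>V \<otimes> A, D)\<close> extends \<open>d\<close> and
  is a complex \<open>\<Lambda>\<^sup>kV \<otimes> A \<rightarrow> \<Lambda>\<^sup>k\<^sup>+\<^sup>1V \<otimes> A\<close>, exact except for the constants in \<open>k = 0\<close>; it is built one generator at a time (\<open>stage_exists\<close>). Choose a
  complement \<open>S\<^sub>k\<close> of the cocycles in \<open>\<Lambda>\<^sup>kV\<close>. Dividing out the contractible part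
  \<open>S\<^sub>k \<otimes> A \<rightarrow> D(S\<^sub>k \<otimes> A)\<close> leaves a complex with terms \<open>H\<^sub>k \<otimes> A\<close>, dual to the minimal resolution. Its
  differential is represented by \<open>Q D\<close>, where \<open>Q\<close> is a projection along \<open>D(S\<^sub>k \<otimes> A)\<close>. The bound on
  the total rank is \<open>key_inequality\<close>, integrality is \<open>rank_Q\<close>, and positivity is \<open>rank_Q_pos\<close>. The last
  rests on \<open>growth\<close>: \<open>Q D\<close> is a differential operator over the polynomial algebra on the even
  generators of \<open>A\<close>, and iterated commutators with these generators turn it into a nonzero linear
  operator over that polynomial algebra without enlarging its image by more than a bounded factor.
\<close>

section \<open>Linear maps of polynomials\<close>

lemma lookup_gpoly_scale [simp]:
  "Poly_Mapping.lookup (gpoly_scale c a) m = c * Poly_Mapping.lookup a m"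
  unfolding gpoly_scale_def by (simp add: Poly_Mapping.map.rep_eq when_def)

interpretation gp: vector_space "gpoly_scale :: rat \<Rightarrow> 'v gpoly \<Rightarrow> 'v gpoly"
  by unfold_locales (rule poly_mapping_eqI; simp add: lookup_add algebra_simps)+

interpretation gpp: vector_space_pair
    "gpoly_scale :: rat \<Rightarrow> 'v gpoly \<Rightarrow> 'v gpoly" "gpoly_scale :: rat \<Rightarrow> 'w gpoly \<Rightarrow> 'w gpoly" ..

abbreviation glinear :: "('v gpoly \<Rightarrow> 'w gpoly) \<Rightarrow> bool" where
  "glinear \<equiv> Vector_Spaces.linear gpoly_scale gpoly_scale"

abbreviation mon :: "'v multiset \<Rightarrow> 'v gpoly" where
  "mon m \<equiv> Poly_Mapping.single m 1"

abbreviation coef :: "'v gpoly \<Rightarrow> 'v multiset \<Rightarrow> rat" where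
  "coef \<equiv> Poly_Mapping.lookup"

abbreviation keys :: "'v gpoly \<Rightarrow> 'v multiset set" where
  "keys \<equiv> Poly_Mapping.keys"

lemma glinearI:
  "(\<And>a b. f (a + b) = f a + f b) \<Longrightarrow> (\<And>c a. f (gpoly_scale c a) = gpoly_scale c (f a)) \<Longrightarrow> glinear f"
  by (simp add: Vector_Spaces.linear_iff gp.vector_space_axioms)

lemma scale_single: "gpoly_scale c (Poly_Mapping.single m x) = Poly_Mapping.single m (c * x)"
  by (rule poly_mapping_eqI) (simp add: lookup_single when_def)

lemma keys_scale: "keys (gpoly_scale c a) \<subseteq> keys a"
  by (auto simp: in_keys_iff)

lemma keys_sum: "keys (sum f A) \<subseteq> (\<Union>i\<in>A. keys (f i))"
proof
  fix m assume "m \<in> keys (sum f A)"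
  hence "(\<Sum>i\<in>A. coef (f i) m) \<noteq> 0" by (simp add: in_keys_iff lookup_sum)
  then obtain i where "i \<in> A" "coef (f i) m \<noteq> 0" by (meson sum.neutral)
  thus "m \<in> (\<Union>i\<in>A. keys (f i))" by (auto simp: in_keys_iff)
qed

definition gextend :: "('v multiset \<Rightarrow> 'w gpoly) \<Rightarrow> 'v gpoly \<Rightarrow> 'w gpoly" where
  "gextend f a = (\<Sum>m\<in>keys a. gpoly_scale (coef a m) (f m))"

lemma gextend_superset:
  assumes "finite K" "keys a \<subseteq> K"
  shows "gextend f a = (\<Sum>m\<in>K. gpoly_scale (coef a m) (f m))"
  unfolding gextend_def using assms
  by (intro sum.mono_neutral_left) (auto simp: in_keys_iff)

lemma glinear_gextend: "glinear (gextend f)"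
proof (rule glinearI)
  fix a b :: "'a gpoly" and c
  have k: "finite (keys a \<union> keys b)" by simp
  have "gextend f (a + b) = (\<Sum>m\<in>keys a \<union> keys b. gpoly_scale (coef (a+b) m) (f m))"
    by (rule gextend_superset[OF k keys_add])
  also have "\<dots> = (\<Sum>m\<in>keys a \<union> keys b. gpoly_scale (coef a m) (f m))
     + (\<Sum>m\<in>keys a \<union> keys b. gpoly_scale (coef b m) (f m))"
    by (simp add: lookup_add gp.scale_left_distrib sum.distrib)
  also have "\<dots> = gextend f a + gextend f b"
    using gextend_superset[OF k, of a f] gextend_superset[OF k, of b f] by simp
  finally show "gextend f (a + b) = gextend f a + gextend f b" .
  have "gextend f (gpoly_scale c a) = (\<Sum>m\<in>keys a. gpoly_scale (coef (gpoly_scale c a) m) (f m))"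
    by (rule gextend_superset[OF _ keys_scale]) simp
  thus "gextend f (gpoly_scale c a) = gpoly_scale c (gextend f a)"
    by (simp add: gextend_def gp.scale_sum_right)
qed

lemma gextend_mon [simp]: "gextend f (mon m) = f m"
  by (simp add: gextend_def)

lemma gpoly_eq_sum: "a = (\<Sum>m\<in>keys a. gpoly_scale (coef a m) (mon m))"
proof (rule poly_mapping_eqI)
  fix k
  have "coef (\<Sum>m\<in>keys a. gpoly_scale (coef a m) (mon m)) k = (\<Sum>m\<in>keys a. if m = k then coef a m else 0)"
    by (simp add: lookup_sum lookup_single when_def if_distrib cong: if_cong)
  thus "coef a k = coef (\<Sum>m\<in>keys a. gpoly_scale (coef a m) (mon m)) k"
    by (auto simp: in_keys_iff)
qed

lemma glinear_expand:
  assumes "glinear f"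
  shows "f a = (\<Sum>m\<in>keys a. gpoly_scale (coef a m) (f (mon m)))"
proof -
  have "f a = f (\<Sum>m\<in>keys a. gpoly_scale (coef a m) (mon m))" using gpoly_eq_sum[of a] by simp
  also have "\<dots> = (\<Sum>m\<in>keys a. gpoly_scale (coef a m) (f (mon m)))"
    using assms by (simp add: gpp.linear_sum gpp.linear_scale)
  finally show ?thesis .
qed

lemma glinear_eqI:
  assumes "glinear f" "glinear g" "\<And>m. m \<in> keys a \<Longrightarrow> f (mon m) = g (mon m)"
  shows "f a = g a"
  using glinear_expand[OF assms(1), of a] glinear_expand[OF assms(2), of a] assms(3) by simp

lemma keys_glinear:
  assumes "glinear f" shows "keys (f a) \<subseteq> (\<Union>m\<in>keys a. keys (f (mon m)))"
proof -
  have "keys (f a) \<subseteq> (\<Union>m\<in>keys a. keys (gpoly_scale (coef a m) (f (mon m))))"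
    by (subst glinear_expand[OF assms]) (rule keys_sum)
  also have "\<dots> \<subseteq> (\<Union>m\<in>keys a. keys (f (mon m)))"
    by (intro UN_mono keys_scale order_refl)
  finally show ?thesis .
qed

lemma glinear_add: "glinear f \<Longrightarrow> f (a + b) = f a + f b" by (simp add: gpp.linear_add)
lemma glinear_diff: "glinear f \<Longrightarrow> f (a - b) = f a - f b" by (simp add: gpp.linear_diff)
lemma glinear_scale: "glinear f \<Longrightarrow> f (gpoly_scale c a) = gpoly_scale c (f a)" by (simp add: gpp.linear_scale)
lemma glinear_0: "glinear f \<Longrightarrow> f 0 = 0" by (simp add: gpp.linear_0)
lemma glinear_neg: "glinear f \<Longrightarrow> f (- a) = - f a" by (simp add: gpp.linear_neg)
lemma glinear_sum: "glinear f \<Longrightarrow> f (sum g A) = (\<Sum>i\<in>A. f (g i))" by (simp add: gpp.linear_sum)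

lemma glinear_compose: "glinear f \<Longrightarrow> glinear g \<Longrightarrow> glinear (\<lambda>a. g (f a))"
  by (rule glinearI) (simp_all add: glinear_add glinear_scale)
lemma glinear_plus: "glinear f \<Longrightarrow> glinear g \<Longrightarrow> glinear (\<lambda>a. f a + g a)"
  by (rule glinearI) (simp_all add: glinear_add glinear_scale gp.scale_right_distrib)
lemma glinear_minus: "glinear f \<Longrightarrow> glinear g \<Longrightarrow> glinear (\<lambda>a. f a - g a)"
  by (rule glinearI) (simp_all add: glinear_add glinear_scale gp.scale_right_diff_distrib)
lemma glinear_scaled: "glinear f \<Longrightarrow> glinear (\<lambda>a. gpoly_scale c (f a))"
  by (rule glinearI) (simp_all add: glinear_add glinear_scale gp.scale_right_distrib mult.commute)
lemma glinear_setsum: "(\<And>i. i \<in> A \<Longrightarrow> glinear (f i)) \<Longrightarrow> glinear (\<lambda>a. \<Sum>i\<in>A. f i a)"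
  by (rule glinearI) (simp_all add: glinear_add glinear_scale gp.scale_sum_right sum.distrib)
lemma glinear_id: "glinear (\<lambda>a. a)" by (rule glinearI) simp_all
lemma glinear_zero: "glinear (\<lambda>a. 0)" by (rule glinearI) simp_all

lemmas glinear_intros = glinear_gextend glinear_plus glinear_minus glinear_scaled glinear_setsum
  glinear_id glinear_zero

subsection \<open>Spans of monomials\<close>

definition supp :: "'v multiset set \<Rightarrow> 'v gpoly set" where
  "supp W = {a. keys a \<subseteq> W}"

lemma subspace_supp: "gp.subspace (supp W)"
  unfolding gp.subspace_def
proof (intro conjI ballI allI)
  show "a + b \<in> supp W" if "a \<in> supp W" "b \<in> supp W" for a b
    using that Poly_Mapping.keys_add[of a b] by (auto simp: supp_def)
  show "gpoly_scale c a \<in> supp W" if "a \<in> supp W" for c a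
    using that keys_scale[of c a] by (auto simp: supp_def)
qed (simp add: supp_def)

lemma supp_add: "a \<in> supp W \<Longrightarrow> b \<in> supp W \<Longrightarrow> a + b \<in> supp W"
  using gp.subspace_add[OF subspace_supp] .
lemma supp_diff: "a \<in> supp W \<Longrightarrow> b \<in> supp W \<Longrightarrow> a - b \<in> supp W"
  using gp.subspace_diff[OF subspace_supp] .
lemma supp_scale: "a \<in> supp W \<Longrightarrow> gpoly_scale c a \<in> supp W"
  using gp.subspace_scale[OF subspace_supp] .
lemma supp_sum: "(\<And>i. i \<in> A \<Longrightarrow> f i \<in> supp W) \<Longrightarrow> sum f A \<in> supp W"
  using gp.subspace_sum[OF subspace_supp] .
lemma supp_0: "0 \<in> supp W" by (simp add: supp_def)
lemma supp_mono: "V \<subseteq> W \<Longrightarrow> supp V \<subseteq> supp W" by (auto simp: supp_def)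
lemma mon_supp [simp]: "mon m \<in> supp W \<longleftrightarrow> m \<in> W" by (simp add: supp_def)

lemma glinear_suppI:
  assumes "glinear f" "\<And>m. m \<in> W \<Longrightarrow> f (mon m) \<in> supp V" "a \<in> supp W"
  shows "f a \<in> supp V"
  using keys_glinear[OF assms(1), of a] assms(2,3) unfolding supp_def by fast

lemma supp_eq_span: "supp W = gp.span (mon ` W)"
proof
  show "supp W \<subseteq> gp.span (mon ` W)"
  proof
    fix a assume "a \<in> supp W"
    hence "(\<Sum>m\<in>keys a. gpoly_scale (coef a m) (mon m)) \<in> gp.span (mon ` W)"
      by (intro gp.span_sum gp.span_scale gp.span_base) (auto simp: supp_def)
    thus "a \<in> gp.span (mon ` W)" using gpoly_eq_sum[of a] by simp
  qed
  show "gp.span (mon ` W) \<subseteq> supp W"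
    by (rule gp.span_minimal[OF _ subspace_supp]) auto
qed

lemma inj_mon: "inj_on mon W" by (auto intro!: inj_onI dest: arg_cong[where f = keys])

lemma independent_mon: "gp.independent (mon ` W)"
proof -
  have "gp.independent (mon ` W)" if "finite W" for W :: "'a multiset set"
  proof (rule gp.independent_if_scalars_zero)
    show "finite (mon ` W)" using that by simp
    fix f :: "'a gpoly \<Rightarrow> rat" and x assume s: "(\<Sum>x\<in>mon ` W. gpoly_scale (f x) x) = 0" and "x \<in> mon ` W"
    then obtain k where k: "k \<in> W" "x = mon k" by auto
    have "(\<Sum>m\<in>W. gpoly_scale (f (mon m)) (mon m)) = 0"
      using s by (simp add: sum.reindex[OF inj_mon] o_def)
    hence "coef (\<Sum>m\<in>W. gpoly_scale (f (mon m)) (mon m)) k = 0" by simp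
    hence "(\<Sum>m\<in>W. if m = k then f (mon m) else 0) = 0"
      by (simp add: lookup_sum lookup_single when_def if_distrib cong: if_cong)
    thus "f x = 0" using k that by simp
  qed
  hence fin: "gp.independent (mon ` W)" if "finite W" for W :: "'a multiset set" using that by blast
  have "gp.independent S" if S: "finite S" "S \<subseteq> mon ` W" for S :: "'a gpoly set"
  proof -
    obtain W' where "W' \<subseteq> W" "finite W'" "S = mon ` W'" using finite_subset_image[OF S] by blast
    thus ?thesis using fin by blast
  qed
  thus ?thesis unfolding gp.independent_explicit_finite_subsets gp.independent_explicit_module by blast
qed

lemma dim_supp: "gp.dim (supp W) = card W"
  unfolding supp_eq_span
  by (subst gp.dim_span_eq_card_independent[OF independent_mon]) (rule card_image[OF inj_mon])

text \<open>
  The space of all polynomials has infinite dimension and \<open>dim\<close> is zero on subspaces without a finite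
  basis, so the comparisons of dimensions below are restricted to subspaces of a finitely generated space.
\<close>

definition fin_dim :: "'v gpoly set \<Rightarrow> bool" where
  "fin_dim V \<longleftrightarrow> (\<exists>B. finite B \<and> V \<subseteq> gp.span B)"

lemma fin_dim_supp: "finite W \<Longrightarrow> fin_dim (supp W)"
  unfolding fin_dim_def supp_eq_span by blast

lemma fin_dim_subset: "fin_dim W \<Longrightarrow> V \<subseteq> W \<Longrightarrow> fin_dim V"
  unfolding fin_dim_def by blast

lemma fin_dim_image: "fin_dim V \<Longrightarrow> glinear f \<Longrightarrow> fin_dim (f ` V)"
  unfolding fin_dim_def by (metis finite_imageI gpp.linear_span_image image_mono)

lemma finite_independent: "fin_dim V \<Longrightarrow> B \<subseteq> V \<Longrightarrow> gp.independent B \<Longrightarrow> finite B"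
  unfolding fin_dim_def using gp.independent_span_bound by (metis subset_trans)

lemma gdim_mono:
  assumes "U \<subseteq> V" "fin_dim V" shows "gp.dim U \<le> gp.dim V"
proof -
  obtain B where B: "B \<subseteq> U" "gp.independent B" "U \<subseteq> gp.span B" "card B = gp.dim U"
    using gp.basis_exists[of U] by auto
  obtain C where C: "C \<subseteq> V" "gp.independent C" "V \<subseteq> gp.span C" "card C = gp.dim V"
    using gp.basis_exists[of V] by auto
  have "finite C" using finite_independent assms C by blast
  thus ?thesis using gp.independent_span_bound[of C B] B C assms(1) by auto
qed

lemma gdim_le_sum:
  assumes "U \<subseteq> {x + y | x y. x \<in> V \<and> y \<in> W}" "fin_dim V" "fin_dim W"
  shows "gp.dim U \<le> gp.dim V + gp.dim W"
proof -
  obtain B where B: "B \<subseteq> V" "gp.independent B" "V \<subseteq> gp.span B" "card B = gp.dim V"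
    using gp.basis_exists[of V] by auto
  obtain C where C: "C \<subseteq> W" "gp.independent C" "W \<subseteq> gp.span C" "card C = gp.dim W"
    using gp.basis_exists[of W] by auto
  have fin: "finite B" "finite C" using finite_independent assms B C by blast+
  have "U \<subseteq> gp.span (B \<union> C)"
  proof
    fix u assume "u \<in> U"
    then obtain x y where "u = x + y" "x \<in> V" "y \<in> W" using assms(1) by auto
    thus "u \<in> gp.span (B \<union> C)"
      using B(3) C(3) gp.span_mono[of B "B \<union> C"] gp.span_mono[of C "B \<union> C"] by (auto intro!: gp.span_add)
  qed
  hence "gp.dim U \<le> card (B \<union> C)" using fin by (intro gp.dim_le_card) auto
  also have "\<dots> \<le> card B + card C" by (rule card_Un_le)
  finally show ?thesis using B C by simp
qed

lemma rank_nullity: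
  assumes V: "gp.subspace V" "fin_dim V" and f: "glinear f"
  shows "gp.dim V = gp.dim (f ` V) + gp.dim {x \<in> V. f x = 0}"
proof -
  let ?N = "{x \<in> V. f x = 0}"
  have sN: "gp.subspace ?N" using V f
    by (auto simp: gp.subspace_def glinear_add glinear_scale glinear_0)
  obtain B where B: "B \<subseteq> ?N" "gp.independent B" "?N \<subseteq> gp.span B" "card B = gp.dim ?N"
    using gp.basis_exists[of ?N] by auto
  obtain C where C: "B \<subseteq> C" "C \<subseteq> V" "gp.independent C" "V \<subseteq> gp.span C"
    using gp.maximal_independent_subset_extend[of B V] B by auto
  have finC: "finite C" using finite_independent V C by blast
  have spC: "gp.span C = V" using C V by (meson gp.span_minimal subset_antisym)
  have spB: "gp.span B = ?N" using B sN by (meson gp.span_minimal subset_antisym)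
  let ?E = "C - B"
  have finE: "finite ?E" using finC by simp
  have zero: "\<And>v. v \<in> gp.span ?E \<Longrightarrow> f v = 0 \<Longrightarrow> v = 0"
  proof -
    fix v assume v: "v \<in> gp.span ?E" "f v = 0"
    have "v \<in> V" using v spC gp.span_mono[of ?E C] by auto
    hence "v \<in> gp.span B" using v spB by auto
    \<comment> \<open>the part of the basis that extends a basis of the kernel meets the kernel only in 0\<close>
    have "gp.span ?E \<inter> gp.span (C - ?E) = {0}"
    proof -
      have "gp.span ?E \<inter> gp.span B \<subseteq> {0}"
      proof
        fix x assume x: "x \<in> gp.span ?E \<inter> gp.span B"
        obtain u where u: "x = (\<Sum>b\<in>?E. gpoly_scale (u b) b)"
          using x finE by (auto simp: gp.span_finite)
        obtain w where w: "x = (\<Sum>b\<in>B. gpoly_scale (w b) b)"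
          using x finite_subset[OF C(1) finC] by (auto simp: gp.span_finite)
        let ?g = "\<lambda>b. if b \<in> B then - w b else u b"
        have "(\<Sum>b\<in>C. gpoly_scale (?g b) b) = (\<Sum>b\<in>?E. gpoly_scale (?g b) b) + (\<Sum>b\<in>B. gpoly_scale (?g b) b)"
          using sum.subset_diff[OF C(1) finC] by blast
        also have "\<dots> = x + (- x)"
        proof -
          have "(\<Sum>b\<in>?E. gpoly_scale (?g b) b) = x" unfolding u by (rule sum.cong) auto
          moreover have "(\<Sum>b\<in>B. gpoly_scale (?g b) b) = - x" unfolding w
            by (simp add: gp.scale_minus_left sum_negf)
          ultimately show ?thesis by simp
        qed
        finally have g0: "(\<Sum>b\<in>C. gpoly_scale (?g b) b) = 0" by simp
        have "\<forall>b\<in>C. ?g b = 0" by (intro ballI gp.independentD[OF C(3) finC subset_refl g0])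
        hence "\<forall>b\<in>?E. u b = 0" by auto
        thus "x \<in> {0}" unfolding u by simp
      qed
      moreover have "C - ?E = B" using C(1) by auto
      ultimately show ?thesis using gp.span_zero by auto
    qed
    moreover have "C - ?E = B" using C(1) by auto
    ultimately show "v = 0" using v \<open>v \<in> gp.span B\<close> by auto
  qed
  have inj: "inj_on f (gp.span ?E)"
    using gpp.linear_inj_on_iff_eq_0[OF f gp.subspace_span, of ?E] zero by blast
  have indE: "gp.independent ?E" using gp.independent_mono[OF C(3)] by auto
  have indf: "gp.independent (f ` ?E)"
    using gpp.linear_independent_injective_image[OF f indE inj] .
  have im: "f ` V = gp.span (f ` ?E)"
  proof
    show "gp.span (f ` ?E) \<subseteq> f ` V"
      using gpp.linear_span_image[OF f, of ?E] spC gp.span_mono[of ?E C] by auto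
    show "f ` V \<subseteq> gp.span (f ` ?E)"
    proof -
      have "f ` V = gp.span (f ` C)" using spC gpp.linear_span_image[OF f] by metis
      moreover have "f ` C \<subseteq> gp.span (f ` ?E)"
      proof
        fix y assume "y \<in> f ` C"
        then obtain c where c: "c \<in> C" "y = f c" by auto
        show "y \<in> gp.span (f ` ?E)"
        proof (cases "c \<in> B")
          case True
          hence "f c = 0" using B(1) by auto
          thus ?thesis using c gp.span_zero[of "f ` ?E"] by simp
        next
          case False thus ?thesis using c by (auto intro: gp.span_base)
        qed
      qed
      ultimately show ?thesis by (metis gp.span_minimal gp.subspace_span)
    qed
  qed
  have "gp.dim (f ` V) = card (f ` ?E)" unfolding im by (rule gp.dim_span_eq_card_independent[OF indf])
  also have "\<dots> = card ?E" by (meson card_image gp.span_superset inj inj_on_subset)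
  finally have 1: "gp.dim (f ` V) = card C - card B" using card_Diff_subset finC C(1) finite_subset by metis
  have "card B \<le> card C" using C(1) finC card_mono by blast
  moreover have "gp.dim V = card C" using gp.basis_card_eq_dim C by metis
  ultimately show ?thesis using 1 B(4) by simp
qed

text \<open>
  Multisets form an additive monoid with unit \<open>{#}\<close>, so this rule would rewrite the monomial of length
  zero into the unit of the commutative product of \<open>\<Rightarrow>\<^sub>0\<close>, which differs from the graded one.
\<close>

declare Poly_Mapping.single_one [simp del]

section \<open>Graded commutativity and derivations\<close>

locale gca =
  fixes dg :: "'w::linorder \<Rightarrow> nat"
begin

abbreviation gmul :: "'w gpoly \<Rightarrow> 'w gpoly \<Rightarrow> 'w gpoly" (infixl "\<star>" 70) where
  "a \<star> b \<equiv> gpoly_mult dg a b"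

definition common_odd :: "'w multiset \<Rightarrow> 'w multiset \<Rightarrow> bool" where
  "common_odd m n \<longleftrightarrow> (\<exists>v. odd (dg v) \<and> v \<in># m \<and> v \<in># n)"

definition inversions :: "'w multiset \<Rightarrow> 'w multiset \<Rightarrow> ('w \<times> 'w) set" where
  "inversions m n = {(a, b). a \<in># m \<and> b \<in># n \<and> odd (dg a) \<and> odd (dg b) \<and> b < a}"

definition koszul :: "'w multiset \<Rightarrow> 'w multiset \<Rightarrow> rat" where
  "koszul m n = (if common_odd m n then 0 else (-1) ^ card (inversions m n))"

lemma mono_mult_koszul: "mono_mult dg m n = Poly_Mapping.single (m + n) (koszul m n)"
  unfolding mono_mult_def koszul_def common_odd_def inversions_def by auto

lemma finite_inversions: "finite (inversions m n)"
  by (rule finite_subset[of _ "set_mset m \<times> set_mset n"]) (auto simp: inversions_def)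

text \<open>
  Both sides count, with sign, the inversions among the three words, pair by pair.
\<close>

lemma koszul_assoc: "koszul m n * koszul (m + n) k = koszul n k * koszul m (n + k)"
proof (cases "common_odd m n \<or> common_odd m k \<or> common_odd n k")
  case True thus ?thesis by (auto simp: koszul_def common_odd_def)
next
  case False
  have "inversions (m + n) k = inversions m k \<union> inversions n k"
       "inversions m (n + k) = inversions m n \<union> inversions m k"
    by (auto simp: inversions_def)
  moreover have "inversions m k \<inter> inversions n k = {}" "inversions m n \<inter> inversions m k = {}"
    using False by (auto simp: inversions_def common_odd_def)
  ultimately have "card (inversions (m + n) k) = card (inversions m k) + card (inversions n k)"
       "card (inversions m (n + k)) = card (inversions m n) + card (inversions m k)"
    by (simp_all add: card_Un_disjoint finite_inversions)
  moreover have "\<not> common_odd (m + n) k" "\<not> common_odd m (n + k)"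
    using False by (auto simp: common_odd_def)
  ultimately show ?thesis using False by (simp add: koszul_def power_add)
qed

lemma mult_eq_gextend: "a \<star> b = gextend (\<lambda>m. gextend (\<lambda>n. mono_mult dg m n) b) a"
  unfolding gpoly_mult_def gextend_def by (simp add: gp.scale_sum_right)

lemma glinear_mult_left: "glinear (\<lambda>a. a \<star> b)"
  unfolding mult_eq_gextend by (rule glinear_gextend)

lemma glinear_mult_right: "glinear (\<lambda>b. a \<star> b)"
  unfolding mult_eq_gextend gextend_def[of _ a]
  by (intro glinear_setsum glinear_scaled glinear_gextend)

lemma mon_mult_mon: "mon m \<star> mon n = Poly_Mapping.single (m + n) (koszul m n)"
  by (simp add: mult_eq_gextend mono_mult_koszul)

lemma mon_mult_mon': "mon m \<star> mon n = gpoly_scale (koszul m n) (mon (m + n))"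
  by (simp add: mon_mult_mon scale_single)

lemma mult_add_left: "(a + b) \<star> c = a \<star> c + b \<star> c" by (rule glinear_add[OF glinear_mult_left])
lemma mult_add_right: "c \<star> (a + b) = c \<star> a + c \<star> b" by (rule glinear_add[OF glinear_mult_right])
lemma mult_diff_left: "(a - b) \<star> c = a \<star> c - b \<star> c" by (rule glinear_diff[OF glinear_mult_left])
lemma mult_scale_left: "gpoly_scale r a \<star> c = gpoly_scale r (a \<star> c)" by (rule glinear_scale[OF glinear_mult_left])
lemma mult_scale_right: "c \<star> gpoly_scale r a = gpoly_scale r (c \<star> a)" by (rule glinear_scale[OF glinear_mult_right])
lemma mult_0_left [simp]: "0 \<star> c = 0" by (rule glinear_0[OF glinear_mult_left])
lemma mult_0_right [simp]: "c \<star> 0 = 0" by (rule glinear_0[OF glinear_mult_right])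
lemma mult_sum_right: "c \<star> sum f A = (\<Sum>i\<in>A. c \<star> f i)" by (rule glinear_sum[OF glinear_mult_right])

lemma gmult_assoc: "(a \<star> b) \<star> c = a \<star> (b \<star> c)"
proof -
  have 1: "(mon m \<star> mon n) \<star> mon k = mon m \<star> (mon n \<star> mon k)" for m n k
    by (simp add: mon_mult_mon' mult_scale_left mult_scale_right koszul_assoc add.assoc)
  have 2: "(mon m \<star> mon n) \<star> c = mon m \<star> (mon n \<star> c)" for m n
    by (rule glinear_eqI[where a = c and f = "\<lambda>c. (mon m \<star> mon n) \<star> c"]) (intro 1 glinear_compose[OF glinear_mult_right glinear_mult_right] glinear_mult_right)+
  have 3: "(mon m \<star> b) \<star> c = mon m \<star> (b \<star> c)" for m
    by (rule glinear_eqI[where a = b and f = "\<lambda>b. (mon m \<star> b) \<star> c"]) (intro 2 glinear_compose[OF glinear_mult_left glinear_mult_right] glinear_compose[OF glinear_mult_right glinear_mult_left] glinear_mult_left)+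
  show ?thesis
    by (rule glinear_eqI[where a = a and f = "\<lambda>a. (a \<star> b) \<star> c"]) (intro 3 glinear_compose[OF glinear_mult_left glinear_mult_left] glinear_mult_left)+
qed

lemma koszul_empty [simp]: "koszul {#} m = 1" "koszul m {#} = 1"
  by (auto simp: koszul_def common_odd_def inversions_def)

lemma one_mult [simp]: "mon {#} \<star> a = a"
  by (rule glinear_eqI[where f = "\<lambda>a. mon {#} \<star> a" and g = "\<lambda>a. a"])
     (auto intro: glinear_mult_right glinear_id simp: mon_mult_mon)

lemma mult_one [simp]: "a \<star> mon {#} = a"
  by (rule glinear_eqI[where f = "\<lambda>a. a \<star> mon {#}" and g = "\<lambda>a. a"])
     (auto intro: glinear_mult_left glinear_id simp: mon_mult_mon)

lemma supp_mult:
  assumes "a \<in> supp A" "b \<in> supp B"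
    and "\<And>m n. m \<in> A \<Longrightarrow> n \<in> B \<Longrightarrow> \<not> common_odd m n \<Longrightarrow> m + n \<in> C"
  shows "a \<star> b \<in> supp C"
proof -
  have "mon m \<star> mon n \<in> supp C" if "m \<in> A" "n \<in> B" for m n
    using assms(3)[OF that] by (cases "common_odd m n") (auto simp: mon_mult_mon supp_def koszul_def)
  hence "mon m \<star> b \<in> supp C" if "m \<in> A" for m
    using glinear_suppI[OF glinear_mult_right _ assms(2)] that by blast
  thus ?thesis using glinear_suppI[OF glinear_mult_left _ assms(1)] by blast
qed

subsection \<open>Parity\<close>

text \<open>
  The graded product is associative on all multisets; commutativity and the Leibniz rule need
  the multisets that are monomials of the free graded commutative algebra.
\<close>

definition valid :: "'w multiset \<Rightarrow> bool" where
  "valid m \<longleftrightarrow> (\<forall>v. odd (dg v) \<longrightarrow> count m v \<le> 1)"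

definition odd_count :: "'w multiset \<Rightarrow> nat" where
  "odd_count m = size (filter_mset (\<lambda>v. odd (dg v)) m)"

definition parity_mons :: "nat \<Rightarrow> 'w multiset set" where
  "parity_mons i = {m. valid m \<and> even (odd_count m + i)}"

lemma odd_count_simps [simp]: "odd_count {#} = 0" "odd_count (m + n) = odd_count m + odd_count n"
  "odd_count (add_mset v m) = (if odd (dg v) then 1 else 0) + odd_count m"
  by (simp_all add: odd_count_def)

lemma valid_empty [simp]: "valid {#}" by (simp add: valid_def)

lemma valid_subset: "valid m \<Longrightarrow> n \<subseteq># m \<Longrightarrow> valid n"
  unfolding valid_def by (meson mset_subset_eq_count order_trans)

lemma valid_add: "valid m \<Longrightarrow> valid n \<Longrightarrow> \<not> common_odd m n \<Longrightarrow> valid (m + n)"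
proof (unfold valid_def, intro allI impI)
  fix v assume a: "\<forall>v. odd (dg v) \<longrightarrow> count m v \<le> 1" "\<forall>v. odd (dg v) \<longrightarrow> count n v \<le> 1"
    "\<not> common_odd m n" "odd (dg v)"
  hence "count m v \<le> 1" "count n v \<le> 1" "count m v = 0 \<or> count n v = 0"
    by (auto simp: common_odd_def count_eq_zero_iff)
  thus "count (m + n) v \<le> 1" by auto
qed

lemma valid_add_mset: "valid (add_mset v m) \<longleftrightarrow> valid m \<and> (odd (dg v) \<longrightarrow> v \<notin># m)"
  unfolding valid_def by (auto simp: count_eq_zero_iff le_Suc_eq split: if_splits)

lemma odd_count_card: "valid m \<Longrightarrow> odd_count m = card {v \<in> set_mset m. odd (dg v)}"
proof (induction m)
  case empty thus ?case by simp
next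
  case (add v m)
  have "{x \<in> set_mset (add_mset v m). odd (dg x)} =
      (if odd (dg v) then insert v {x \<in> set_mset m. odd (dg x)} else {x \<in> set_mset m. odd (dg x)})" by auto
  thus ?case using add by (auto simp: valid_add_mset)
qed

text \<open>
  A pair of odd generators, one from \<open>m\<close> and one from \<open>n\<close>, is an inversion in exactly one of the two orders.
\<close>

lemma koszul_comm:
  assumes "valid m" "valid n"
  shows "koszul m n = (-1) ^ (odd_count m * odd_count n) * koszul n m"
proof (cases "common_odd m n")
  case True thus ?thesis by (auto simp: koszul_def common_odd_def)
next
  case False
  let ?M = "{v \<in> set_mset m. odd (dg v)}" and ?N = "{v \<in> set_mset n. odd (dg v)}"
  have e: "?M \<times> ?N = inversions m n \<union> prod.swap ` inversions n m"
  proof (rule equalityI; rule subsetI)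
    fix p assume "p \<in> ?M \<times> ?N"
    then obtain x y where p: "p = (x, y)" "x \<in># m" "y \<in># n" "odd (dg x)" "odd (dg y)" by auto
    hence "x \<noteq> y" using False by (auto simp: common_odd_def)
    hence "p \<in> inversions m n \<or> (y, x) \<in> inversions n m" using p by (auto simp: inversions_def)
    moreover have "p = prod.swap (y, x)" using p by simp
    ultimately show "p \<in> inversions m n \<union> prod.swap ` inversions n m" by blast
  qed (auto simp: inversions_def)
  have d: "inversions m n \<inter> prod.swap ` inversions n m = {}"
    by (auto simp: inversions_def)
  have "odd_count m * odd_count n = card (?M \<times> ?N)" using assms by (simp add: odd_count_card card_cartesian_product)
  also have "\<dots> = card (inversions m n) + card (inversions n m)"
    unfolding e by (subst card_Un_disjoint[OF _ _ d]) (simp_all add: finite_inversions card_image)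
  finally have "(-1::rat) ^ (odd_count m * odd_count n) * (-1) ^ card (inversions n m) = (-1) ^ card (inversions m n)"
    by (simp add: power_add flip: power_mult_distrib)
  moreover have "\<not> common_odd n m" using False by (auto simp: common_odd_def)
  ultimately show ?thesis using False by (simp add: koszul_def)
qed

lemma graded_commute:
  assumes a: "a \<in> supp (parity_mons i)" and b: "b \<in> supp (parity_mons j)"
  shows "a \<star> b = gpoly_scale ((-1) ^ (i * j)) (b \<star> a)"
proof -
  have s: "(-1::rat) ^ (odd_count m * odd_count n) = (-1) ^ (i * j)" if "m \<in> parity_mons i" "n \<in> parity_mons j" for m n
    using that by (auto simp: parity_mons_def minus_one_power_iff)
  have 1: "mon m \<star> mon n = gpoly_scale ((-1) ^ (i * j)) (mon n \<star> mon m)" if "m \<in> parity_mons i" "n \<in> parity_mons j" for m n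
    using that s[OF that] koszul_comm[of m n]
    by (simp add: mon_mult_mon scale_single add.commute parity_mons_def)
  have 2: "mon m \<star> b = gpoly_scale ((-1) ^ (i * j)) (b \<star> mon m)" if "m \<in> parity_mons i" for m
    using 1[OF that] b
    by (intro glinear_eqI[where a = b and f = "\<lambda>b. mon m \<star> b"] glinear_scaled glinear_mult_left glinear_mult_right)
       (auto simp: supp_def)
  show ?thesis
    using 2 a
    by (intro glinear_eqI[where a = a and f = "\<lambda>a. a \<star> b"] glinear_scaled glinear_mult_left glinear_mult_right)
       (auto simp: supp_def)
qed

subsection \<open>Generators\<close>

abbreviation gen :: "'w \<Rightarrow> 'w gpoly" where "gen v \<equiv> mon {#v#}"

definition below :: "'w multiset \<Rightarrow> 'w \<Rightarrow> nat" where
  "below m u = card {b \<in> set_mset m. odd (dg b) \<and> b < u}"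

lemma koszul_gen:
  "koszul {#u#} m = (if odd (dg u) then if u \<in># m then 0 else (-1) ^ below m u else 1)"
proof -
  have "inversions {#u#} m = (if odd (dg u) then Pair u ` {b \<in> set_mset m. odd (dg b) \<and> b < u} else {})"
    by (auto simp: inversions_def)
  thus ?thesis by (auto simp: koszul_def common_odd_def below_def card_image inj_on_def)
qed

lemma gen_mult_mon: "gen u \<star> mon m = gpoly_scale (koszul {#u#} m) (mon (add_mset u m))"
  by (simp add: mon_mult_mon')

lemma gen_parity_mons: "gen u \<in> supp (parity_mons (dg u))"
  by (auto simp: parity_mons_def valid_def)

text \<open>
  Splitting off the least generator costs no sign, since it already stands in front.
\<close>

lemma mono_induct [consumes 1, case_names one gen]:
  assumes "valid m" and "P {#}"
    and "\<And>u m. valid (add_mset u m) \<Longrightarrow> mon (add_mset u m) = gen u \<star> mon m \<Longrightarrow> P m \<Longrightarrow> P (add_mset u m)"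
  shows "P m"
  using assms(1)
proof (induction "size m" arbitrary: m)
  case 0 thus ?case using assms(2) by simp
next
  case (Suc k)
  define u where "u = Min (set_mset m)"
  have ne: "set_mset m \<noteq> {}" using Suc(2) by auto
  hence "u \<in># m" unfolding u_def by (intro Min_in) auto
  then obtain m' where m: "m = add_mset u m'" by (meson multi_member_split)
  have "b \<in># m" if "b \<in># m'" for b unfolding m using that by simp
  hence "\<not> b < u" if "b \<in># m'" for b using that unfolding u_def by (simp add: not_less)
  hence "below m' u = 0" unfolding below_def by (auto intro: card_eq_0_iff[THEN iffD2])
  hence "mon (add_mset u m') = gen u \<star> mon m'"
    using Suc.prems m by (auto simp: gen_mult_mon koszul_gen valid_add_mset)
  thus ?case using Suc assms(3)[of u m'] m by (auto simp: valid_add_mset)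
qed

subsection \<open>Derivations\<close>

text \<open>
  The left partial derivative: the sign is that of moving \<open>v\<close> to the front of the monomial.
\<close>

definition partial_der :: "'w \<Rightarrow> 'w gpoly \<Rightarrow> 'w gpoly" where
  "partial_der v = gextend (\<lambda>m. gpoly_scale (if even (dg v) then of_nat (count m v) else
      if v \<in># m then (-1) ^ below m v else 0) (mon (m - {#v#})))"

lemma below_add_even [simp]: "even (dg u) \<Longrightarrow> below (add_mset u m) v = below m v"
  unfolding below_def by (rule arg_cong[where f = card]) auto

lemma below_add_odd: "odd (dg u) \<Longrightarrow> u \<notin># m \<Longrightarrow> below (add_mset u m) v = below m v + (if u < v then 1 else 0)"
proof -
  assume a: "odd (dg u)" "u \<notin># m"
  have "{b \<in> set_mset (add_mset u m). odd (dg b) \<and> b < v} =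
      (if u < v then insert u {b \<in> set_mset m. odd (dg b) \<and> b < v} else {b \<in> set_mset m. odd (dg b) \<and> b < v})"
    using a by auto
  thus ?thesis using a by (auto simp: below_def)
qed

lemma partial_der_mon: "partial_der v (mon m) = gpoly_scale (if even (dg v) then of_nat (count m v) else
      if v \<in># m then (-1) ^ below m v else 0) (mon (m - {#v#}))"
  by (simp add: partial_der_def)

lemma partial_der_mon_notin: "v \<notin># m \<Longrightarrow> partial_der v (mon m) = 0"
  by (simp add: partial_der_mon count_eq_zero_iff)

lemma glinear_partial_der: "glinear (partial_der v)" unfolding partial_der_def by (rule glinear_gextend)

text \<open>
  The Leibniz rule for a generator as left factor. Everything else about derivations follows
  from this rule by associativity, so the signs are compared only here.
\<close>

lemma partial_der_gen_mon:
  assumes m: "valid m"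
  shows "partial_der v (gen u \<star> mon m) =
    (if u = v then mon m else 0) + gpoly_scale ((-1) ^ (dg u * dg v)) (gen u \<star> partial_der v (mon m))"
proof (cases "v \<in># m")
  case False
  show ?thesis
  proof (cases "u = v")
    case True
    have "count m v = 0" using False by (simp add: count_eq_zero_iff)
    thus ?thesis using False True
      by (auto simp: gen_mult_mon koszul_gen partial_der_mon glinear_scale[OF glinear_partial_der]
          below_add_odd simp flip: power_mult_distrib)
  next
    case neq: False
    hence "partial_der v (mon (add_mset u m)) = 0" using False by (intro partial_der_mon_notin) auto
    thus ?thesis using False neq
      by (simp add: gen_mult_mon glinear_scale[OF glinear_partial_der] partial_der_mon_notin)
  qed
next
  case True
  then obtain n where mn: "m = add_mset v n" by (meson multi_member_split)
  have vn: "valid n" and vo: "odd (dg v) \<Longrightarrow> v \<notin># n" using m mn by (auto simp: valid_add_mset)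
  show ?thesis
  proof (cases "u = v")
    case True
    show ?thesis
    proof (cases "even (dg v)")
      case True
      thus ?thesis using \<open>u = v\<close> mn
        by (simp add: gen_mult_mon koszul_gen partial_der_mon glinear_scale[OF glinear_partial_der]
            mult_scale_right) (rule poly_mapping_eqI, simp only: lookup_add lookup_gpoly_scale, simp add: algebra_simps)
    next
      case False
      have "below (add_mset v n) v = below n v" using False vo by (simp add: below_add_odd)
      thus ?thesis using \<open>u = v\<close> mn vo False
        by (simp add: gen_mult_mon koszul_gen partial_der_mon glinear_scale[OF glinear_partial_der] glinear_0[OF glinear_partial_der]
            mult_scale_right gp.scale_minus_left flip: power_mult_distrib)
    qed
  next
    case neq: False
    have e: "add_mset u (add_mset v n) - {#v#} = add_mset u n" using neq by simp
    show ?thesis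
    proof (cases "even (dg v)")
      case True
      have "koszul {#u#} (add_mset v n) = koszul {#u#} n" using True neq by (auto simp: koszul_gen)
      thus ?thesis using neq mn True
        by (simp add: gen_mult_mon partial_der_mon glinear_scale[OF glinear_partial_der] mult_scale_right e mult.commute)
    next
      case ov: False
      show ?thesis
      proof (cases "even (dg u)")
        case True
        thus ?thesis using neq mn ov
          by (simp add: gen_mult_mon koszul_gen partial_der_mon glinear_scale[OF glinear_partial_der] mult_scale_right e)
      next
        case ou: False
        show ?thesis
        proof (cases "u \<in># n")
          case True
          thus ?thesis using neq mn ou ov
            by (simp add: gen_mult_mon koszul_gen partial_der_mon glinear_scale[OF glinear_partial_der] glinear_0[OF glinear_partial_der] mult_scale_right)
        next
          case False
          have 1: "below (add_mset u (add_mset v n)) v = below n v + (if u < v then 1 else 0)"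
            using ou ov neq vo False by (simp add: below_add_odd)
          have 2: "below (add_mset v n) u = below n u + (if v < u then 1 else 0)" "below (add_mset v n) v = below n v"
            using ov vo by (simp_all add: below_add_odd)
          have 3: "(u < v) = (\<not> v < u)" using neq by auto
          show ?thesis using neq mn ou ov False 1 2 3
            by (simp add: gen_mult_mon koszul_gen partial_der_mon glinear_scale[OF glinear_partial_der] mult_scale_right e mult.commute)
        qed
      qed
    qed
  qed
qed

lemma partial_der_gen:
  assumes "b \<in> supp (Collect valid)"
  shows "partial_der v (gen u \<star> b) = (if u = v then b else 0) + gpoly_scale ((-1) ^ (dg u * dg v)) (gen u \<star> partial_der v b)"
proof -
  have "glinear (\<lambda>b. (if u = v then b else 0) + gpoly_scale ((-1) ^ (dg u * dg v)) (gen u \<star> partial_der v b))"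
    by (cases "u = v") (auto intro!: glinear_intros glinear_compose[OF glinear_partial_der glinear_mult_right])
  thus ?thesis using assms partial_der_gen_mon
    by (intro glinear_eqI[where a = b and f = "\<lambda>b. partial_der v (gen u \<star> b)"] glinear_compose[OF glinear_mult_right glinear_partial_der])
       (auto simp: supp_def)
qed

text \<open>
  The derivation that takes \<open>v\<close> in \<open>S\<close> to \<open>\<phi> v\<close> and the other generators to zero, provided that
  \<open>\<phi>\<close> changes the parity of every generator.
\<close>

definition der :: "'w set \<Rightarrow> ('w \<Rightarrow> 'w gpoly) \<Rightarrow> 'w gpoly \<Rightarrow> 'w gpoly" where
  "der S \<phi> b = (\<Sum>v\<in>S. \<phi> v \<star> partial_der v b)"

lemma glinear_der: "glinear (der S \<phi>)"
  unfolding der_def by (intro glinear_setsum glinear_compose[OF glinear_partial_der glinear_mult_right])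

text \<open>
  Every grading of the algebra for which \<open>\<phi>\<close> is homogeneous is respected by the derivation; this lemma
  yields all of them, by a suitable choice of \<open>A\<close> and \<open>C\<close>.
\<close>

lemma supp_der:
  assumes "a \<in> supp A"
    and "\<And>m v k. m \<in> A \<Longrightarrow> v \<in># m \<Longrightarrow> v \<in> S \<Longrightarrow> k \<in> keys (\<phi> v) \<Longrightarrow> \<not> common_odd k (m - {#v#})
      \<Longrightarrow> k + (m - {#v#}) \<in> C"
  shows "der S \<phi> a \<in> supp C"
proof (rule glinear_suppI[OF glinear_der _ assms(1)])
  fix m assume m: "m \<in> A"
  have "\<phi> v \<star> partial_der v (mon m) \<in> supp C" if "v \<in> S" for v
  proof (cases "v \<in># m")
    case True
    have "\<phi> v \<star> mon (m - {#v#}) \<in> supp C"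
      by (rule supp_mult[where A = "keys (\<phi> v)" and B = "{m - {#v#}}"])
         (use assms(2)[OF m True that] in \<open>auto simp: supp_def\<close>)
    thus ?thesis by (simp add: partial_der_mon mult_scale_right supp_scale)
  next
    case False thus ?thesis by (simp add: partial_der_mon_notin supp_0)
  qed
  thus "der S \<phi> (mon m) \<in> supp C" unfolding der_def by (rule supp_sum)
qed

lemma der_cong_supp:
  assumes "\<And>m v. m \<in> keys a \<Longrightarrow> v \<in># m \<Longrightarrow> v \<in> S \<Longrightarrow> \<phi> v = \<psi> v"
  shows "der S \<phi> a = der S \<psi> a"
proof (rule glinear_eqI[OF glinear_der glinear_der])
  fix m assume "m \<in> keys a"
  thus "der S \<phi> (mon m) = der S \<psi> (mon m)" unfolding der_def
    using assms by (intro sum.cong refl) (metis partial_der_mon_notin mult_0_right)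
qed

definition odd_der :: "'w set \<Rightarrow> ('w \<Rightarrow> 'w gpoly) \<Rightarrow> bool" where
  "odd_der S \<phi> \<longleftrightarrow> finite S \<and> (\<forall>v\<in>S. \<phi> v \<in> supp (parity_mons (dg v + 1)))"

lemma partial_der_one [simp]: "partial_der v (mon {#}) = 0" by (simp add: partial_der_mon_notin)

lemma der_one [simp]: "der S \<phi> (mon {#}) = 0" by (simp add: der_def)

lemma der_gen_mult:
  assumes "odd_der S \<phi>" "u \<in> S" "b \<in> supp (Collect valid)"
  shows "der S \<phi> (gen u \<star> b) = \<phi> u \<star> b + gpoly_scale ((-1) ^ dg u) (gen u \<star> der S \<phi> b)"
proof -
  have fin: "finite S" using assms by (simp add: odd_der_def)
  have c: "\<phi> v \<star> gpoly_scale ((-1) ^ (dg u * dg v)) (gen u \<star> partial_der v b)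
      = gpoly_scale ((-1) ^ dg u) (gen u \<star> (\<phi> v \<star> partial_der v b))" if "v \<in> S" for v
  proof -
    have "\<phi> v \<star> gen u = gpoly_scale ((-1) ^ ((dg v + 1) * dg u)) (gen u \<star> \<phi> v)"
      using assms(1) that by (intro graded_commute gen_parity_mons) (auto simp: odd_der_def)
    moreover have "(-1::rat) ^ (dg u * dg v) * (-1) ^ ((dg v + 1) * dg u) = (-1) ^ dg u"
      by (auto simp: minus_one_power_iff)
    ultimately show ?thesis
      by (simp add: mult_scale_right mult_scale_left flip: gmult_assoc)
  qed
  have "der S \<phi> (gen u \<star> b) = (\<Sum>v\<in>S. \<phi> v \<star> (if u = v then b else 0)
      + gpoly_scale ((-1) ^ dg u) (gen u \<star> (\<phi> v \<star> partial_der v b)))"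
    unfolding der_def by (intro sum.cong refl) (simp only: partial_der_gen[OF assms(3)] mult_add_right c)
  also have "\<dots> = (\<Sum>v\<in>S. if u = v then \<phi> v \<star> b else 0)
      + gpoly_scale ((-1) ^ dg u) (gen u \<star> der S \<phi> b)"
    unfolding der_def sum.distrib mult_sum_right gp.scale_sum_right
    by (intro arg_cong2[where f = plus] sum.cong refl) auto
  also have "(\<Sum>v\<in>S. if u = v then \<phi> v \<star> b else 0) = \<phi> u \<star> b" using fin assms(2) by simp
  finally show ?thesis .
qed

lemma der_gen:
  assumes "odd_der S \<phi>" "u \<in> S" shows "der S \<phi> (gen u) = \<phi> u"
  using der_gen_mult[OF assms, of "mon {#}"] by simp

definition mons :: "'w set \<Rightarrow> 'w multiset set" where
  "mons S = {m. valid m \<and> set_mset m \<subseteq> S}"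

lemma mons_empty [simp]: "{#} \<in> mons S" by (simp add: mons_def)

lemma mons_valid: "mons S \<subseteq> Collect valid" by (auto simp: mons_def)

lemma supp_mons_valid: "a \<in> supp (mons S) \<Longrightarrow> a \<in> supp (Collect valid)"
  using supp_mono[OF mons_valid] by blast

lemma supp_mons_mult: "a \<in> supp (mons S) \<Longrightarrow> b \<in> supp (mons S) \<Longrightarrow> a \<star> b \<in> supp (mons S)"
  by (erule supp_mult, assumption) (auto simp: mons_def intro: valid_add)

lemma supp_mons_der:
  assumes "\<And>v. v \<in> S \<Longrightarrow> v \<in> T \<Longrightarrow> \<phi> v \<in> supp (mons T)" "a \<in> supp (mons T)"
  shows "der S \<phi> a \<in> supp (mons T)"
proof (rule supp_der[OF assms(2)])
  fix m v k assume a: "m \<in> mons T" "v \<in># m" "v \<in> S" "k \<in> keys (\<phi> v)" "\<not> common_odd k (m - {#v#})"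
  have "k \<in> mons T" using a assms(1)[of v] by (auto simp: supp_def mons_def)
  moreover have "m - {#v#} \<in> mons T" using a valid_subset[of m "m - {#v#}"]
    by (auto simp: mons_def dest: in_diffD)
  ultimately show "k + (m - {#v#}) \<in> mons T" using a(5) valid_add by (auto simp: mons_def)
qed

lemma der_mult:
  assumes D: "odd_der S \<phi>" and a: "a \<in> supp (mons S \<inter> parity_mons i)" and b: "b \<in> supp (mons S)"
  shows "der S \<phi> (a \<star> b) = der S \<phi> a \<star> b + gpoly_scale ((-1) ^ i) (a \<star> der S \<phi> b)"
proof -
  have mon: "set_mset m \<subseteq> S \<Longrightarrow> \<forall>b \<in> supp (mons S). der S \<phi> (mon m \<star> b) =
      der S \<phi> (mon m) \<star> b + gpoly_scale ((-1) ^ odd_count m) (mon m \<star> der S \<phi> b)" if "valid m" for m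
    using that
  proof (induction m rule: mono_induct)
    case one thus ?case by simp
  next
    case (gen u m)
    have u: "u \<in> S" "set_mset m \<subseteq> S" and vm: "valid m" using gen by (auto simp: valid_add_mset)
    have mm: "mon m \<in> supp (mons S)" using u vm by (simp add: mons_def)
    have s: "(-1::rat) ^ dg u = (-1) ^ (if odd (dg u) then 1 else 0)" by auto
    show ?case
    proof
      fix b assume b: "b \<in> supp (mons S)"
      have mb: "mon m \<star> b \<in> supp (Collect valid)" using supp_mons_mult[OF mm b] by (rule supp_mons_valid)
      have "der S \<phi> (mon (add_mset u m) \<star> b) = der S \<phi> (gen u \<star> (mon m \<star> b))"
        by (simp only: gen.hyps gmult_assoc)
      also have "\<dots> = \<phi> u \<star> (mon m \<star> b) + gpoly_scale ((-1) ^ dg u) (gen u \<star> der S \<phi> (mon m \<star> b))"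
        by (rule der_gen_mult[OF D u(1) mb])
      also have "der S \<phi> (mon m \<star> b) = der S \<phi> (mon m) \<star> b + gpoly_scale ((-1) ^ odd_count m) (mon m \<star> der S \<phi> b)"
        using gen.IH u b by blast
      also have "\<phi> u \<star> (mon m \<star> b) + gpoly_scale ((-1) ^ dg u) (gen u \<star> (der S \<phi> (mon m) \<star> b
            + gpoly_scale ((-1) ^ odd_count m) (mon m \<star> der S \<phi> b)))
          = (\<phi> u \<star> mon m + gpoly_scale ((-1) ^ dg u) (gen u \<star> der S \<phi> (mon m))) \<star> b
            + gpoly_scale ((-1) ^ (dg u) * (-1) ^ odd_count m) ((gen u \<star> mon m) \<star> der S \<phi> b)"
        by (simp add: mult_add_left mult_add_right mult_scale_left mult_scale_right gmult_assoc
            gp.scale_right_distrib add.assoc)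
      also have "\<phi> u \<star> mon m + gpoly_scale ((-1) ^ dg u) (gen u \<star> der S \<phi> (mon m)) = der S \<phi> (mon (add_mset u m))"
        unfolding gen.hyps by (rule der_gen_mult[OF D u(1), symmetric]) (use vm in simp)
      finally show "der S \<phi> (mon (add_mset u m) \<star> b) = der S \<phi> (mon (add_mset u m)) \<star> b +
          gpoly_scale ((-1) ^ odd_count (add_mset u m)) (mon (add_mset u m) \<star> der S \<phi> b)"
        unfolding gen.hyps(2) s by (simp add: power_add)
    qed
  qed
  have "der S \<phi> (mon m \<star> b) = der S \<phi> (mon m) \<star> b + gpoly_scale ((-1) ^ i) (mon m \<star> der S \<phi> b)"
    if "m \<in> keys a" for m
  proof -
    have "m \<in> mons S" "m \<in> parity_mons i" using that a by (auto simp: supp_def)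
    moreover hence "(-1::rat) ^ odd_count m = (-1) ^ i" by (auto simp: parity_mons_def minus_one_power_iff)
    ultimately show ?thesis using mon[of m] b by (auto simp: mons_def)
  qed
  thus ?thesis
    by (intro glinear_eqI[where a = a and f = "\<lambda>a. der S \<phi> (a \<star> b)"] glinear_compose[OF glinear_mult_left glinear_der]
        glinear_plus glinear_scaled glinear_compose[OF glinear_der glinear_mult_left] glinear_mult_left)
qed

text \<open>
  The anticommutator of two odd derivations is an even derivation. With both derivations equal to a
  differential this shows that its square is determined on generators; with a differential and a
  contraction it computes the homotopy that makes the acyclic closure acyclic.
\<close>

lemma anticommutator_gen_mult:
  assumes D: "odd_der S \<phi>" "odd_der S \<psi>"
    and cl: "\<And>v. v \<in> S \<Longrightarrow> \<phi> v \<in> supp (mons S)" "\<And>v. v \<in> S \<Longrightarrow> \<psi> v \<in> supp (mons S)"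
    and u: "u \<in> S" and b: "b \<in> supp (mons S)"
  shows "der S \<phi> (der S \<psi> (gen u \<star> b)) + der S \<psi> (der S \<phi> (gen u \<star> b)) =
    (der S \<phi> (\<psi> u) + der S \<psi> (\<phi> u)) \<star> b + gen u \<star> (der S \<phi> (der S \<psi> b) + der S \<psi> (der S \<phi> b))"
proof -
  let ?e = "(-1::rat) ^ dg u"
  have e: "?e * ?e = 1" by (simp flip: power_mult_distrib)
  have 1: "der S \<phi> (der S \<psi> (gen u \<star> b)) =
      der S \<phi> (\<psi> u) \<star> b - gpoly_scale ?e (\<psi> u \<star> der S \<phi> b)
      + gpoly_scale ?e (\<phi> u \<star> der S \<psi> b) + gen u \<star> der S \<phi> (der S \<psi> b)"
    if D: "odd_der S \<phi>" "odd_der S \<psi>"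
    and cl: "\<And>v. v \<in> S \<Longrightarrow> \<phi> v \<in> supp (mons S)" "\<And>v. v \<in> S \<Longrightarrow> \<psi> v \<in> supp (mons S)" for \<phi> \<psi>
  proof -
    have p: "\<psi> u \<in> supp (mons S \<inter> parity_mons (dg u + 1))"
      using cl(2)[OF u] D(2) u by (auto simp: odd_der_def supp_def)
    have sb: "der S \<psi> b \<in> supp (Collect valid)"
      using supp_mons_der[OF cl(2) b] by (rule supp_mons_valid)
    have "der S \<psi> (gen u \<star> b) = \<psi> u \<star> b + gpoly_scale ?e (gen u \<star> der S \<psi> b)"
      by (rule der_gen_mult[OF D(2) u supp_mons_valid[OF b]])
    moreover have "der S \<phi> (\<psi> u \<star> b) = der S \<phi> (\<psi> u) \<star> b + gpoly_scale ((-1) ^ (dg u + 1)) (\<psi> u \<star> der S \<phi> b)"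
      by (rule der_mult[OF D(1) p b])
    moreover have "der S \<phi> (gen u \<star> der S \<psi> b) = \<phi> u \<star> der S \<psi> b + gpoly_scale ?e (gen u \<star> der S \<phi> (der S \<psi> b))"
      by (rule der_gen_mult[OF D(1) u sb])
    ultimately show ?thesis using e
      by (simp add: glinear_add[OF glinear_der] glinear_scale[OF glinear_der] gp.scale_right_distrib gp.scale_minus_left)
  qed
  have 2: "der S \<phi> (der S \<psi> (gen u \<star> b)) =
      der S \<phi> (\<psi> u) \<star> b - gpoly_scale ?e (\<psi> u \<star> der S \<phi> b)
      + gpoly_scale ?e (\<phi> u \<star> der S \<psi> b) + gen u \<star> der S \<phi> (der S \<psi> b)"
    using D cl by (intro 1)
  have 3: "der S \<psi> (der S \<phi> (gen u \<star> b)) =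
      der S \<psi> (\<phi> u) \<star> b - gpoly_scale ?e (\<phi> u \<star> der S \<psi> b)
      + gpoly_scale ?e (\<psi> u \<star> der S \<phi> b) + gen u \<star> der S \<psi> (der S \<phi> b)"
    using D cl by (intro 1)
  show ?thesis unfolding 2 3 by (simp add: mult_add_left mult_add_right)
qed

end

section \<open>The acyclic closure\<close>

context gca begin

lemma der_sq:
  assumes D: "odd_der S \<phi>" and cl: "\<And>v. v \<in> S \<Longrightarrow> \<phi> v \<in> supp (mons S)"
    and X: "X \<subseteq> S" "\<And>v. v \<in> X \<Longrightarrow> der S \<phi> (\<phi> v) = 0" and a: "a \<in> supp (mons X)"
  shows "der S \<phi> (der S \<phi> a) = 0"
proof -
  have "set_mset m \<subseteq> X \<Longrightarrow> der S \<phi> (der S \<phi> (mon m)) = 0" if "valid m" for m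
    using that
  proof (induction m rule: mono_induct)
    case one thus ?case by (simp add: glinear_0[OF glinear_der])
  next
    case (gen u m)
    have u: "u \<in> S" "u \<in> X" and m: "mon m \<in> supp (mons S)"
      using gen X by (auto simp: mons_def valid_add_mset)
    have z: "der S \<phi> (der S \<phi> (mon m)) = 0" using gen by simp
    have "gpoly_scale 2 (der S \<phi> (der S \<phi> (mon (add_mset u m)))) =
       der S \<phi> (der S \<phi> (gen u \<star> mon m)) + der S \<phi> (der S \<phi> (gen u \<star> mon m))"
      unfolding gen.hyps(2) by (metis gp.scale_left_distrib gp.scale_one one_add_one)
    also have "\<dots> = 0"
      using anticommutator_gen_mult[OF D D cl cl u(1) m] X(2)[OF u(2)] z by simp
    finally show ?case by simp
  qed
  hence "der S \<phi> (der S \<phi> (mon m)) = 0" if "m \<in> keys a" for m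
    using that a by (auto simp: supp_def mons_def)
  thus ?thesis
    by (intro glinear_eqI[where a = a and f = "\<lambda>a. der S \<phi> (der S \<phi> a)" and g = "\<lambda>a. 0"]
      glinear_compose[OF glinear_der glinear_der] glinear_zero)
qed

end

text \<open>
  \<open>Bar v\<close> stands for the generator \<open>sv\<close> of degree \<open>|v| - 1\<close> whose differential is \<open>v\<close> up to a correction.
  In the linear order all of \<open>V\<close> precedes all of \<open>sV\<close>, so a monomial of \<open>\<Lambda>V \<otimes> \<Lambda>(sV)\<close>
  splits into its two factors without sign.
\<close>

datatype 'v dbl = Base 'v | Bar 'v

instantiation dbl :: (linorder) linorder
begin

fun less_eq_dbl :: "'a dbl \<Rightarrow> 'a dbl \<Rightarrow> bool" where
  "less_eq_dbl (Base u) (Base v) \<longleftrightarrow> u \<le> v"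
| "less_eq_dbl (Bar u) (Bar v) \<longleftrightarrow> u \<le> v"
| "less_eq_dbl (Base u) (Bar v) \<longleftrightarrow> True"
| "less_eq_dbl (Bar u) (Base v) \<longleftrightarrow> False"

definition less_dbl :: "'a dbl \<Rightarrow> 'a dbl \<Rightarrow> bool" where
  "less_dbl x y \<longleftrightarrow> x \<le> y \<and> \<not> y \<le> x"

instance
proof
  fix x y z :: "'a dbl"
  show "(x < y) = (x \<le> y \<and> \<not> y \<le> x)" by (rule less_dbl_def)
  show "x \<le> x" by (cases x) auto
  show "x \<le> y \<Longrightarrow> y \<le> z \<Longrightarrow> x \<le> z" by (cases x; cases y; cases z) auto
  show "x \<le> y \<Longrightarrow> y \<le> x \<Longrightarrow> x = y" by (cases x; cases y) auto
  show "x \<le> y \<or> y \<le> x" by (cases x; cases y) auto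
qed

end

text \<open>
  Word length in \<open>V\<close> alone.
\<close>

fun gen_length :: "'v dbl \<Rightarrow> nat" where
  "gen_length (Base v) = 1" | "gen_length (Bar v) = 0"

definition base_length :: "'v dbl multiset \<Rightarrow> nat" where
  "base_length m = (\<Sum>x\<in>#m. gen_length x)"

lemma base_length_simps [simp]: "base_length {#} = 0" "base_length (m + n) = base_length m + base_length n" "base_length (add_mset x m) = gen_length x + base_length m"
  by (simp_all add: base_length_def)

locale quadratic_model =
  fixes G :: "'v::linorder set" and dg :: "'v \<Rightarrow> nat" and d0 :: "'v \<Rightarrow> 'v dbl gpoly"
begin

fun deg :: "'v dbl \<Rightarrow> nat" where
  "deg (Base v) = dg v" | "deg (Bar v) = dg v - 1"

text \<open>
  Degree minus word length in \<open>V\<close>. A differential that raises both by one preserves this weight, and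
  since the weight is positive on generators there are only finitely many monomials of each weight.
\<close>

fun gen_weight :: "'v dbl \<Rightarrow> nat" where
  "gen_weight (Base v) = dg v - 1" | "gen_weight (Bar v) = dg v - 1"

definition weight :: "'v dbl multiset \<Rightarrow> nat" where
  "weight m = (\<Sum>x\<in>#m. gen_weight x)"

lemma weight_simps [simp]: "weight {#} = 0" "weight (m + n) = weight m + weight n" "weight (add_mset x m) = gen_weight x + weight m"
  by (simp_all add: weight_def)

end

sublocale quadratic_model \<subseteq> gca deg .

context quadratic_model begin

notation gmul (infixl "\<star>" 70)

definition gens :: "'v set \<Rightarrow> 'v dbl set" where
  "gens P = Base ` P \<union> Bar ` P"

definition cell :: "'v dbl set \<Rightarrow> nat \<Rightarrow> nat \<Rightarrow> 'v dbl multiset set" where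
  "cell X k n = {m \<in> mons X. base_length m = k \<and> weight m = n}"

definition diff_on_gens :: "('v \<Rightarrow> 'v dbl gpoly) \<Rightarrow> 'v dbl \<Rightarrow> 'v dbl gpoly" where
  "diff_on_gens \<psi> x = (case x of Base v \<Rightarrow> d0 v | Bar v \<Rightarrow> \<psi> v)"

abbreviation diffl :: "('v \<Rightarrow> 'v dbl gpoly) \<Rightarrow> 'v dbl gpoly \<Rightarrow> 'v dbl gpoly" where
  "diffl \<psi> \<equiv> der (gens G) (diff_on_gens \<psi>)"

lemma diff_on_gens_simps [simp]: "diff_on_gens \<psi> (Base v) = d0 v" "diff_on_gens \<psi> (Bar v) = \<psi> v"
  by (simp_all add: diff_on_gens_def)

lemma cell_mons: "cell X k n \<subseteq> mons X" by (auto simp: cell_def)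

lemma mons_mono: "X \<subseteq> Y \<Longrightarrow> mons X \<subseteq> mons Y" by (auto simp: mons_def)

lemma cell_mono: "X \<subseteq> Y \<Longrightarrow> cell X k n \<subseteq> cell Y k n" by (auto simp: cell_def mons_def)

lemma supp_cell_der:
  assumes "\<And>x. x \<in> X \<Longrightarrow> x \<in> S \<Longrightarrow> \<phi> x \<in> supp (cell X (gen_length x + 1) (gen_weight x))" "a \<in> supp (cell X k n)"
  shows "der S \<phi> a \<in> supp (cell X (k + 1) n)"
proof (rule supp_der[OF assms(2)])
  fix m v h assume a: "m \<in> cell X k n" "v \<in># m" "v \<in> S" "h \<in> keys (\<phi> v)" "\<not> common_odd h (m - {#v#})"
  obtain r where r: "m = add_mset v r" using a(2) by (meson multi_member_split)
  have v: "v \<in> X" and vr: "valid r" "set_mset r \<subseteq> X" using a r by (auto simp: cell_def mons_def valid_add_mset)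
  have "h \<in> cell X (gen_length v + 1) (gen_weight v)" using assms(1)[OF v a(3)] a(4) by (auto simp: supp_def)
  thus "h + (m - {#v#}) \<in> cell X (k + 1) n" using a vr r valid_add[of h r] by (auto simp: cell_def mons_def)
qed

end

text \<open>
  A quadratic differential on the generators of \<open>\<Lambda>V\<close>. Since the generators have degree at least \<open>2\<close>, the two factors
  of a term of \<open>dv\<close> have smaller degree than \<open>v\<close>, which makes it possible to add generators in the
  order of their degrees.
\<close>

locale coformal_model = quadratic_model G dg d0
  for G :: "'v::linorder set" and dg :: "'v \<Rightarrow> nat" and d0 :: "'v \<Rightarrow> 'v dbl gpoly" +
  assumes finG: "finite G" and dg2: "\<And>v. v \<in> G \<Longrightarrow> 2 \<le> dg v"
    and quad: "\<And>v. v \<in> G \<Longrightarrow> d0 v \<in> supp (cell (Base ` {u \<in> G. dg u < dg v}) 2 (dg v - 1))"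
    and closed: "\<And>v. v \<in> G \<Longrightarrow> diffl (\<lambda>_. 0) (d0 v) = 0"
begin

lemma fin_gens: "finite (gens G)" using finG by (simp add: gens_def)

lemma odd_count_base_length_weight: "set_mset m \<subseteq> gens G \<Longrightarrow> even (odd_count m + (base_length m + weight m))"
proof (induction m)
  case (add x m)
  have "even (deg x + (gen_length x + gen_weight x))" using add.prems by (cases x) (auto simp: gens_def dest!: dg2)
  thus ?case using add by auto
qed simp

lemma cell_parity_mons: "X \<subseteq> gens G \<Longrightarrow> cell X k n \<subseteq> parity_mons (k + n)"
proof
  fix m assume X: "X \<subseteq> gens G" and m: "m \<in> cell X k n"
  hence "valid m" "set_mset m \<subseteq> gens G" "base_length m = k" "weight m = n" by (auto simp: cell_def mons_def)
  thus "m \<in> parity_mons (k + n)" using odd_count_base_length_weight[of m] by (simp add: parity_mons_def)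
qed

text \<open>
  \<open>\<psi> w\<close> is the differential of \<open>Bar w\<close>. The last clause says that the closure over the generators in \<open>P\<close>
  has the cohomology of a point; it is stated separately for each word length \<open>k\<close> and weight \<open>n\<close>.
\<close>

definition stage :: "('v \<Rightarrow> 'v dbl gpoly) \<Rightarrow> 'v set \<Rightarrow> bool" where
  "stage \<psi> P \<longleftrightarrow> (\<forall>w. w \<notin> P \<longrightarrow> \<psi> w = 0) \<and>
     (\<forall>w\<in>P. \<psi> w \<in> supp (cell (gens P) 1 (dg w - 1)) \<and> diffl \<psi> (\<psi> w) = 0) \<and>
     (\<forall>k n. \<forall>z\<in>supp (cell (gens P) k n). diffl \<psi> z = 0 \<longrightarrow>
        (k = 0 \<longrightarrow> z \<in> supp {{#}}) \<and> (k > 0 \<longrightarrow> (\<exists>y\<in>supp (cell (gens P) (k - 1) n). diffl \<psi> y = z)))"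

definition downset :: "'v set \<Rightarrow> bool" where
  "downset P \<longleftrightarrow> P \<subseteq> G \<and> (\<forall>w\<in>P. \<forall>u\<in>G. dg u < dg w \<longrightarrow> u \<in> P)"

lemma gens_mono: "P \<subseteq> Q \<Longrightarrow> gens P \<subseteq> gens Q" by (auto simp: gens_def)

lemma diff_on_gens_cell:
  assumes P: "downset P"
    and \<psi>: "\<forall>w\<in>P. \<psi> w \<in> supp (cell (gens P) 1 (dg w - 1))" and x: "x \<in> gens P"
  shows "diff_on_gens \<psi> x \<in> supp (cell (gens P) (gen_length x + 1) (gen_weight x))"
proof (cases x)
  case (Base v)
  hence v: "v \<in> P" using x by (auto simp: gens_def)
  hence "Base ` {u \<in> G. dg u < dg v} \<subseteq> gens P" using P by (auto simp: gens_def downset_def)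
  moreover have "v \<in> G" using v P by (auto simp: downset_def)
  ultimately have "d0 v \<in> supp (cell (gens P) 2 (dg v - 1))" using quad[of v] supp_mono[OF cell_mono] by blast
  thus ?thesis using Base by (simp add: numeral_2_eq_2)
next
  case (Bar v) thus ?thesis using \<psi> x by (auto simp: gens_def)
qed

lemma odd_derI:
  assumes "\<And>x. x \<in> gens G \<Longrightarrow> \<phi> x \<in> supp (parity_mons (deg x + 1))"
  shows "odd_der (gens G) \<phi>"
  using assms fin_gens by (simp add: odd_der_def)

lemma cell_parity_mons_gen:
  assumes "x \<in> gens G" "a \<in> supp (cell (gens G) k n)" "even (k + n + (gen_length x + 1 + gen_weight x))"
  shows "a \<in> supp (parity_mons (deg x + 1))"
proof -
  have "even (deg x + (gen_length x + gen_weight x))" using assms(1) by (cases x) (auto simp: gens_def dest!: dg2)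
  moreover have "a \<in> supp (parity_mons (k + n))" using assms(2) supp_mono[OF cell_parity_mons[OF subset_refl]] by blast
  moreover have "parity_mons i = parity_mons j" if "even (i + j)" for i j using that by (auto simp: parity_mons_def)
  ultimately show ?thesis using assms(3) by (metis (no_types, lifting) even_add odd_one)
qed

lemma stage_odd_der:
  assumes P: "downset P"
    and \<psi>: "\<forall>w\<in>P. \<psi> w \<in> supp (cell (gens P) 1 (dg w - 1))" and z: "\<forall>w. w \<notin> P \<longrightarrow> \<psi> w = 0"
  shows "odd_der (gens G) (diff_on_gens \<psi>)" "\<And>x. x \<in> gens G \<Longrightarrow> diff_on_gens \<psi> x \<in> supp (cell (gens G) (gen_length x + 1) (gen_weight x))"
proof -
  show *: "diff_on_gens \<psi> x \<in> supp (cell (gens G) (gen_length x + 1) (gen_weight x))" if x: "x \<in> gens G" for x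
  proof (cases "x \<in> Bar ` (G - P)")
    case True thus ?thesis using z by (auto simp: supp_0)
  next
    case False
    show ?thesis
    proof (cases x)
      case (Base v)
      have sub: "Base ` {u \<in> G. dg u < dg v} \<subseteq> gens G" by (auto simp: gens_def)
      hence "d0 v \<in> supp (cell (gens G) 2 (dg v - 1))"
        using quad[of v] x Base subsetD[OF supp_mono[OF cell_mono[OF sub]]] by (auto simp: gens_def)
      thus ?thesis using Base by (simp add: numeral_2_eq_2)
    next
      case (Bar v)
      hence "v \<in> P" using x False by (auto simp: gens_def)
      hence "\<psi> v \<in> supp (cell (gens P) 1 (dg v - 1))" using \<psi> by blast
      moreover have PG: "P \<subseteq> G" using P by (simp add: downset_def)
      ultimately have "\<psi> v \<in> supp (cell (gens G) 1 (dg v - 1))"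
        using subsetD[OF supp_mono[OF cell_mono[OF gens_mono[OF PG]]]] by blast
      thus ?thesis using Bar by simp
    qed
  qed
  show "odd_der (gens G) (diff_on_gens \<psi>)"
    using * by (intro odd_derI cell_parity_mons_gen[OF _ *]) auto
qed

text \<open>
  The cocycle \<open>dw\<close> has word length two, so it is \<open>D \<Phi>\<close> in the closure over \<open>P\<close>. With
  \<open>D(Bar w) = w - \<Phi>\<close> the new pair of generators is contractible. To see this, let \<open>s\<close> be the odd derivation that
  takes \<open>w\<close> to \<open>Bar w\<close> and the other generators to zero. Then \<open>L = Ds + sD\<close> multiplies a monomial by the number
  \<open>q\<close> of its factors \<open>w\<close> and \<open>Bar w\<close>, up to terms with fewer such factors. Subtracting \<open>D(sz)/q\<close> from a
  cocycle \<open>z\<close> therefore removes its leading part, and after finitely many steps \<open>z\<close> lies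
  over \<open>P\<close>.
\<close>

lemma stage_step:
  assumes P0: "downset P"
    and w: "w \<in> G" "w \<notin> P" "\<And>u. u \<in> G \<Longrightarrow> dg u < dg w \<Longrightarrow> u \<in> P"
    and st: "stage \<psi> P"
  shows "\<exists>\<psi>'. stage \<psi>' (insert w P)"
proof -
  have P: "P \<subseteq> G" "\<And>w u. w \<in> P \<Longrightarrow> u \<in> G \<Longrightarrow> dg u < dg w \<Longrightarrow> u \<in> P"
    using P0 by (auto simp: downset_def)
  let ?X = "gens P" and ?P = "insert w P"
  let ?Y = "gens ?P"
  have XY: "?X \<subseteq> ?Y" "?Y \<subseteq> gens G" using P w by (auto simp: gens_def)
  have wX: "Base w \<notin> ?X" "Bar w \<notin> ?X" using w by (auto simp: gens_def)
  have wY: "Base w \<in> ?Y" "Bar w \<in> ?Y" "Base w \<in> gens G" "Bar w \<in> gens G" using w by (auto simp: gens_def)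
  have \<psi>: "\<And>v. v \<in> P \<Longrightarrow> \<psi> v \<in> supp (cell ?X 1 (dg v - 1))" "\<And>v. v \<in> P \<Longrightarrow> diffl \<psi> (\<psi> v) = 0"
    "\<And>v. v \<notin> P \<Longrightarrow> \<psi> v = 0"
    and ac: "\<And>k n z. z \<in> supp (cell ?X k n) \<Longrightarrow> diffl \<psi> z = 0 \<Longrightarrow>
        (k = 0 \<longrightarrow> z \<in> supp {{#}}) \<and> (k > 0 \<longrightarrow> (\<exists>y\<in>supp (cell ?X (k - 1) n). diffl \<psi> y = z))"
    using st unfolding stage_def by auto
  have d0w: "d0 w \<in> supp (cell ?X 2 (dg w - 1))"
  proof -
    have "Base ` {u \<in> G. dg u < dg w} \<subseteq> ?X" using w(3) by (auto simp: gens_def)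
    thus ?thesis using quad[OF w(1)] supp_mono[OF cell_mono] by blast
  qed
  have d0base: "diffl \<rho> (d0 v) = 0" if "v \<in> G" for v \<rho>
  proof -
    have "diffl \<rho> (d0 v) = diffl (\<lambda>_. 0) (d0 v)"
    proof (rule der_cong_supp)
      fix m x assume "m \<in> keys (d0 v)" "x \<in># m"
      moreover have "m \<in> cell (Base ` {u \<in> G. dg u < dg v}) 2 (dg v - 1)"
        using calculation(1) quad[OF that] unfolding supp_def by blast
      ultimately have "x \<in> range Base" by (auto simp: cell_def mons_def)
      thus "diff_on_gens \<rho> x = diff_on_gens (\<lambda>_. 0) x" by auto
    qed
    thus ?thesis using closed[OF that] by simp
  qed
  obtain \<Phi> where \<Phi>: "\<Phi> \<in> supp (cell ?X 1 (dg w - 1))" "diffl \<psi> \<Phi> = d0 w"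
    using ac[OF d0w d0base[OF w(1)]] by auto
  define \<psi>' where "\<psi>' = \<psi>(w := gen (Base w) - \<Phi>)"
  let ?D = "diffl \<psi>'"
  have agree: "?D a = diffl \<psi> a" if "a \<in> supp (mons ?X)" for a
  proof (rule der_cong_supp)
    fix m x assume "m \<in> keys a" "x \<in># m"
    hence "x \<in> ?X" using that by (auto simp: supp_def mons_def)
    thus "diff_on_gens \<psi>' x = diff_on_gens \<psi> x" using wX by (cases x) (auto simp: \<psi>'_def)
  qed
  have cX: "a \<in> supp (cell ?X k n) \<Longrightarrow> a \<in> supp (mons ?X)" for a k n
    using supp_mono[OF cell_mons] by blast
  have cY: "a \<in> supp (cell ?X k n) \<Longrightarrow> a \<in> supp (cell ?Y k n)" for a k n
    using supp_mono[OF cell_mono[OF XY(1)]] by blast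
  have mY: "a \<in> supp (mons ?X) \<Longrightarrow> a \<in> supp (mons ?Y)" for a
    using supp_mono[OF mons_mono[OF XY(1)]] by blast
  have gw: "gen (Base w) \<in> supp (cell ?Y 1 (dg w - 1))" "gen (Bar w) \<in> supp (cell ?Y 0 (dg w - 1))"
    using wY by (auto simp: cell_def mons_def valid_add_mset)
  have \<psi>'1: "\<psi>' v \<in> supp (cell ?Y 1 (dg v - 1))" if "v \<in> ?P" for v
  proof (cases "v = w")
    case True thus ?thesis using supp_diff[OF gw(1) cY[OF \<Phi>(1)]] by (simp add: \<psi>'_def)
  next
    case False thus ?thesis using that cY[OF \<psi>(1)[of v]] by (simp add: \<psi>'_def)
  qed
  have \<psi>'0: "v \<notin> ?P \<Longrightarrow> \<psi>' v = 0" for v using \<psi>(3) by (simp add: \<psi>'_def)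
  have P': "downset ?P" "?P \<subseteq> G" using P w by (auto simp: downset_def)
  have b1: "\<forall>v\<in>?P. \<psi>' v \<in> supp (cell ?Y 1 (dg v - 1))" and b0: "\<forall>v. v \<notin> ?P \<longrightarrow> \<psi>' v = 0"
    using \<psi>'1 \<psi>'0 by blast+
  note od = stage_odd_der[OF P'(1) b1 b0]
  have cl: "\<And>x. x \<in> gens G \<Longrightarrow> diff_on_gens \<psi>' x \<in> supp (mons (gens G))"
    using od(2) supp_mono[OF cell_mons] by blast
  have dY: "\<And>x. x \<in> ?Y \<Longrightarrow> diff_on_gens \<psi>' x \<in> supp (cell ?Y (gen_length x + 1) (gen_weight x))"
    by (rule diff_on_gens_cell[OF P'(1) b1])
  have DY: "?D a \<in> supp (cell ?Y (k + 1) n)" if "a \<in> supp (cell ?Y k n)" for a k n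
    by (rule supp_cell_der[OF dY that])
  have Dw: "?D (gen (Base w)) = d0 w" "?D (gen (Bar w)) = gen (Base w) - \<Phi>"
  proof -
    have "\<psi>' w = gen (Base w) - \<Phi>" by (simp add: \<psi>'_def)
    thus "?D (gen (Base w)) = d0 w" "?D (gen (Bar w)) = gen (Base w) - \<Phi>"
      using der_gen[OF od(1) wY(3)] der_gen[OF od(1) wY(4)] unfolding diff_on_gens_simps by simp_all
  qed
  have D\<psi>: "?D (\<psi>' v) = 0" if "v \<in> ?P" for v
  proof (cases "v = w")
    case True
    thus ?thesis using Dw \<Phi> agree[OF cX[OF \<Phi>(1)]] by (simp add: \<psi>'_def glinear_diff[OF glinear_der])
  next
    case False
    hence "v \<in> P" using that by simp
    thus ?thesis using False agree[OF cX[OF \<psi>(1)]] \<psi>(2) by (simp add: \<psi>'_def)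
  qed
  have Dsq: "?D (?D a) = 0" if "a \<in> supp (mons ?Y)" for a
  proof (rule der_sq[OF od(1) cl XY(2) _ that])
    fix x assume "x \<in> ?Y"
    thus "?D (diff_on_gens \<psi>' x) = 0" using D\<psi> d0base P' by (cases x) (auto simp: gens_def)
  qed
  define \<sigma> where "\<sigma> = (\<lambda>x. if x = Base w then gen (Bar w) else 0)"
  let ?s = "der (gens G) \<sigma>"
  have \<sigma>c: "\<sigma> x \<in> supp (cell ?Y 0 (gen_weight x))" for x
    using gw(2) by (auto simp: \<sigma>_def supp_0)
  have \<sigma>o: "odd_der (gens G) \<sigma>"
  proof (rule odd_derI)
    fix x assume "x \<in> gens G"
    thus "\<sigma> x \<in> supp (parity_mons (deg x + 1))" using dg2[OF w(1)]
      by (auto simp: \<sigma>_def supp_0 parity_mons_def valid_add_mset)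
  qed
  have \<sigma>cl: "\<And>x. x \<in> gens G \<Longrightarrow> \<sigma> x \<in> supp (mons (gens G))"
    using wY by (auto simp: \<sigma>_def supp_0 mons_def valid_add_mset)
  have sX: "?s a = 0" if "a \<in> supp (mons ?X)" for a
  proof -
    have "?s a = der (gens G) (\<lambda>_. 0) a"
    proof (rule der_cong_supp)
      fix m x assume "m \<in> keys a" "x \<in># m"
      thus "\<sigma> x = 0" using that wX by (auto simp: supp_def mons_def \<sigma>_def)
    qed
    thus ?thesis by (simp add: der_def)
  qed
  have sY: "?s a \<in> supp (cell ?Y (k - 1) n)" if "a \<in> supp (cell ?Y k n)" for a k n
  proof (rule supp_der[OF that])
    fix m v h assume a: "m \<in> cell ?Y k n" "v \<in># m" "v \<in> gens G" "h \<in> keys (\<sigma> v)" "\<not> common_odd h (m - {#v#})"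
    have v: "v = Base w" and h: "h = {#Bar w#}" using a(4) by (auto simp: \<sigma>_def split: if_splits)
    obtain r where r: "m = add_mset v r" using a(2) by (meson multi_member_split)
    show "h + (m - {#v#}) \<in> cell ?Y (k - 1) n" using a r h v valid_add[of h r] wY
      by (auto simp: cell_def mons_def valid_add_mset)
  qed
  have s0: "?s a = 0" if "a \<in> supp (cell ?Y 0 n)" for a n
  proof -
    have "?s a = der (gens G) (\<lambda>_. 0) a"
    proof (rule der_cong_supp)
      fix m x assume "m \<in> keys a" "x \<in># m"
      hence "base_length m = 0" using that by (auto simp: supp_def cell_def)
      hence "gen_length x = 0" using \<open>x \<in># m\<close> by (metis add_is_0 multi_member_split base_length_simps(3))
      thus "\<sigma> x = 0" by (auto simp: \<sigma>_def)
    qed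
    thus ?thesis by (simp add: der_def)
  qed
  \<comment> \<open>counting operator of the pair, up to lower terms\<close>
  define L where "L a = ?D (?s a) + ?s (?D a)" for a
  have glL: "glinear L" unfolding L_def
    by (intro glinear_plus glinear_compose[OF glinear_der glinear_der])
  define cw where "cw m = count m (Base w) + count m (Bar w)" for m
  have cw_simps: "cw {#} = 0" "cw (m + n) = cw m + cw n"
    "cw (add_mset x m) = (if x = Base w \<or> x = Bar w then 1 else 0) + cw m" for m n x
    by (auto simp: cw_def)
  have cwX: "cw m = 0" if "set_mset m \<subseteq> ?X" for m
    using that wX by (auto simp: cw_def count_eq_zero_iff)
  let ?low = "\<lambda>q. {m \<in> mons ?Y. cw m < q}"
  \<comment> \<open>the anticommutator on generators; the summand \<open>\<Phi>\<close> is what makes L only triangular\<close>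
  have Lgen: "?D (\<sigma> u) + ?s (diff_on_gens \<psi>' u) =
      (if u = Base w \<or> u = Bar w then gen u else 0) - (if u = Base w then \<Phi> else 0)" if u: "u \<in> ?Y" for u
  proof -
    consider "u = Base w" | "u = Bar w" | "u \<in> ?X" using u by (auto simp: gens_def)
    thus ?thesis
    proof cases
      case 1
      thus ?thesis using Dw sX[OF cX[OF d0w]] by (simp add: \<sigma>_def)
    next
      case 2
      have "?s (gen (Base w)) = gen (Bar w)" using der_gen[OF \<sigma>o wY(3)] by (simp add: \<sigma>_def)
      thus ?thesis using 2 sX[OF cX[OF \<Phi>(1)]]
        by (simp add: \<sigma>_def \<psi>'_def glinear_0[OF glinear_der] glinear_diff[OF glinear_der])
    next
      case 3
      have "diff_on_gens \<psi>' u = diff_on_gens \<psi> u" using 3 wX by (cases u) (auto simp: \<psi>'_def)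
      moreover have "diff_on_gens \<psi> u \<in> supp (mons ?X)" using diff_on_gens_cell[OF P0 _ 3] \<psi>(1) cX by blast
      ultimately show ?thesis using 3 wX sX by (auto simp: \<sigma>_def glinear_0[OF glinear_der])
    qed
  qed
  have Lmon: "set_mset m \<subseteq> ?Y \<Longrightarrow> L (mon m) - gpoly_scale (of_nat (cw m)) (mon m) \<in> supp (?low (cw m))"
    if "valid m" for m
    using that
  proof (induction m rule: mono_induct)
    case one thus ?case by (simp add: L_def glinear_0[OF glinear_der] cw_simps supp_0)
  next
    case (gen u m)
    have u: "u \<in> ?Y" "u \<in> gens G" and m: "m \<in> mons ?Y" using gen XY by (auto simp: mons_def valid_add_mset)
    define r where "r = L (mon m) - gpoly_scale (of_nat (cw m)) (mon m)"
    have r: "r \<in> supp (?low (cw m))" using gen unfolding r_def by auto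
    let ?c = "if u = Base w \<or> u = Bar w then 1 else (0::nat)"
    have mG: "mon m \<in> supp (mons (gens G))" using m XY by (auto simp: mons_def)
    have "L (mon (add_mset u m)) = (?D (\<sigma> u) + ?s (diff_on_gens \<psi>' u)) \<star> mon m + gen u \<star> L (mon m)"
      unfolding L_def gen.hyps(2) by (rule anticommutator_gen_mult[OF od(1) \<sigma>o cl \<sigma>cl u(2) mG])
    also have "L (mon m) = gpoly_scale (of_nat (cw m)) (mon m) + r" by (simp add: r_def)
    also have "gen u \<star> \<dots> = gpoly_scale (of_nat (cw m)) (mon (add_mset u m)) + gen u \<star> r"
      by (simp add: mult_add_right mult_scale_right gen.hyps(2))
    also have "(?D (\<sigma> u) + ?s (diff_on_gens \<psi>' u)) \<star> mon m =
        gpoly_scale (of_nat ?c) (mon (add_mset u m)) - (if u = Base w then \<Phi> else 0) \<star> mon m"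
      unfolding Lgen[OF u(1)] by (simp add: mult_diff_left gen.hyps(2))
    finally have e: "L (mon (add_mset u m)) - gpoly_scale (of_nat (cw (add_mset u m))) (mon (add_mset u m))
        = gen u \<star> r - (if u = Base w then \<Phi> else 0) \<star> mon m"
      by (simp add: cw_simps gp.scale_left_distrib)
    have "gen u \<star> r \<in> supp (?low (cw (add_mset u m)))"
      by (rule supp_mult[where A = "{{#u#}}", OF _ r]) (use u(1) in \<open>auto simp: cw_simps mons_def valid_add_mset common_odd_def\<close>)
    moreover have "(if u = Base w then \<Phi> else 0) \<star> mon m \<in> supp (?low (cw (add_mset u m)))"
    proof (cases "u = Base w")
      case True
      have "\<Phi> \<star> mon m \<in> supp (?low (cw (add_mset u m)))"
      proof (rule supp_mult[OF cX[OF \<Phi>(1)], where B = "{m}"])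
        fix h n assume a: "h \<in> mons ?X" "n \<in> {m}" "\<not> common_odd h n"
        have "valid (h + m)" using a m valid_add by (auto simp: mons_def)
        thus "h + n \<in> ?low (cw (add_mset u m))" using a m True XY cwX[of h]
          by (auto simp: mons_def cw_simps)
      qed simp
      thus ?thesis using True by simp
    qed (simp add: supp_0)
    ultimately show ?case unfolding e by (rule supp_diff)
  qed
  \<comment> \<open>induction on the number of factors \<open>w\<close> and \<open>Bar w\<close>\<close>
  have acY: "\<And>z. z \<in> supp (cell ?Y k n \<inter> {m. cw m \<le> q}) \<Longrightarrow> ?D z = 0 \<Longrightarrow>
      (k = 0 \<longrightarrow> z \<in> supp {{#}}) \<and> (k > 0 \<longrightarrow> (\<exists>y\<in>supp (cell ?Y (k - 1) n). ?D y = z))" for k n q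
  proof (induction q)
    case 0
    have "z \<in> supp (cell ?X k n)"
    proof -
      have "m \<in> cell ?X k n" if "m \<in> cell ?Y k n" "cw m = 0" for m
      proof -
        have "Base w \<notin># m" "Bar w \<notin># m" using that(2) by (auto simp: cw_def count_eq_zero_iff)
        thus ?thesis using that(1) by (auto simp: cell_def mons_def gens_def)
      qed
      thus ?thesis using 0(1) by (auto simp: supp_def)
    qed
    moreover have "diffl \<psi> z = 0" using agree[OF cX[OF calculation]] 0(2) by simp
    ultimately have "(k = 0 \<longrightarrow> z \<in> supp {{#}}) \<and> (k > 0 \<longrightarrow> (\<exists>y\<in>supp (cell ?X (k - 1) n). diffl \<psi> y = z))"
      using ac by blast
    thus ?case using agree[OF cX] cY by metis
  next
    case (Suc q)
    have zc: "z \<in> supp (cell ?Y k n)" using Suc.prems(1) by (auto simp: supp_def)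
    let ?c = "1 / of_nat (Suc q) :: rat"
    define y where "y = gpoly_scale ?c (?s z)"
    have Dy: "?D y = gpoly_scale ?c (L z)"
      unfolding y_def L_def using Suc.prems(2) by (simp add: glinear_scale[OF glinear_der] glinear_0[OF glinear_der])
    have low: "L z - gpoly_scale (of_nat (Suc q)) z \<in> supp (?low (Suc q))"
    proof (rule glinear_suppI[where f = "\<lambda>z. L z - gpoly_scale (of_nat (Suc q)) z", OF _ _ Suc.prems(1)])
      show "glinear (\<lambda>z. L z - gpoly_scale (of_nat (Suc q)) z)"
        by (intro glinear_minus glL glinear_scaled glinear_id)
      fix m assume "m \<in> cell ?Y k n \<inter> {m. cw m \<le> Suc q}"
      hence m: "m \<in> mons ?Y" "valid m" "set_mset m \<subseteq> ?Y" "cw m \<le> Suc q" by (auto simp: cell_def mons_def)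
      have "L (mon m) - gpoly_scale (of_nat (cw m)) (mon m) \<in> supp (?low (Suc q))"
        using Lmon[OF m(2,3)] supp_mono[of "?low (cw m)" "?low (Suc q)"] m(4) by fastforce
      moreover have "gpoly_scale (of_nat (Suc q) - of_nat (cw m)) (mon m) \<in> supp (?low (Suc q))"
        using m by (cases "cw m = Suc q") (auto intro!: supp_scale simp: supp_0)
      ultimately have "(L (mon m) - gpoly_scale (of_nat (cw m)) (mon m))
          - gpoly_scale (of_nat (Suc q) - of_nat (cw m)) (mon m) \<in> supp (?low (Suc q))" by (rule supp_diff)
      thus "L (mon m) - gpoly_scale (of_nat (Suc q)) (mon m) \<in> supp (?low (Suc q))"
        by (simp add: gp.scale_left_diff_distrib del: of_nat_Suc)
    qed
    have z': "z - ?D y = gpoly_scale (- ?c) (L z - gpoly_scale (of_nat (Suc q)) z)"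
      unfolding Dy by (simp add: gp.scale_right_diff_distrib gp.scale_minus_left del: of_nat_Suc)
    have yc: "y \<in> supp (cell ?Y (k - 1) n)" unfolding y_def by (intro supp_scale sY zc)
    \<comment> \<open>in length zero there is no \<open>w\<close> to contract, so \<open>z\<close> is unchanged by the correction\<close>
    have y0: "y = 0" if "k = 0" using s0 zc that by (simp add: y_def)
    have Dyc: "?D y \<in> supp (cell ?Y k n)"
      using DY[OF yc] y0 by (cases "k = 0") (auto simp: glinear_0[OF glinear_der] supp_0)
    have "z - ?D y \<in> supp (cell ?Y k n \<inter> {m. cw m \<le> q})"
      using supp_diff[OF zc Dyc] supp_scale[OF low, of "- ?c"] unfolding z' by (auto simp: supp_def)
    moreover have "?D (z - ?D y) = 0"
    proof -
      have "y \<in> supp (mons ?Y)" using yc supp_mono[OF cell_mons] by blast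
      thus ?thesis using Suc.prems(2) by (simp add: glinear_diff[OF glinear_der] Dsq)
    qed
    ultimately have IH: "(k = 0 \<longrightarrow> z - ?D y \<in> supp {{#}}) \<and> (k > 0 \<longrightarrow> (\<exists>y'\<in>supp (cell ?Y (k - 1) n). ?D y' = z - ?D y))"
      by (rule Suc.IH)
    show ?case
    proof (intro conjI impI)
      assume "k = 0" thus "z \<in> supp {{#}}" using IH y0 by (simp add: glinear_0[OF glinear_der])
    next
      assume "k > 0"
      then obtain y' where "y' \<in> supp (cell ?Y (k - 1) n)" "?D y' = z - ?D y" using IH by blast
      thus "\<exists>y\<in>supp (cell ?Y (k - 1) n). ?D y = z"
        using yc by (intro bexI[of _ "y' + y"]) (auto intro: supp_add simp: glinear_add[OF glinear_der])
    qed
  qed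
  have "stage \<psi>' ?P"
    unfolding stage_def
  proof (intro conjI allI ballI)
    show "v \<notin> ?P \<longrightarrow> \<psi>' v = 0" for v using \<psi>'0 by blast
    show "\<psi>' v \<in> supp (cell ?Y 1 (dg v - 1))" "?D (\<psi>' v) = 0" if "v \<in> ?P" for v
      using \<psi>'1[OF that] D\<psi>[OF that] .
    show "?D z = 0 \<longrightarrow> (k = 0 \<longrightarrow> z \<in> supp {{#}}) \<and> (k > 0 \<longrightarrow> (\<exists>y\<in>supp (cell ?Y (k - 1) n). ?D y = z))"
      if z: "z \<in> supp (cell ?Y k n)" for k n z
    proof
      assume Dz: "?D z = 0"
      \<comment> \<open>0 is inserted because the set of keys may be empty\<close>
      define q where "q = Max (insert 0 (cw ` keys z))"
      have "cw m \<le> q" if "m \<in> keys z" for m unfolding q_def using that by (intro Max_ge) auto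
      hence "z \<in> supp (cell ?Y k n \<inter> {m. cw m \<le> q})" using z by (auto simp: supp_def)
      thus "(k = 0 \<longrightarrow> z \<in> supp {{#}}) \<and> (k > 0 \<longrightarrow> (\<exists>y\<in>supp (cell ?Y (k - 1) n). ?D y = z))"
        using acY Dz by blast
    qed
  qed
  thus ?thesis by blast
qed

text \<open>
  The generators are added in the order of their degrees, so that \<open>dw\<close> is already defined over the
  earlier ones.
\<close>

lemma stage_exists: "downset P \<Longrightarrow> \<exists>\<psi>. stage \<psi> P"
proof (induction "card P" arbitrary: P)
  case 0
  have "finite P" using 0 finG finite_subset by (auto simp: downset_def)
  hence P: "P = {}" using 0 by simp
  have m: "mons (gens {}) \<subseteq> {{#}}" by (auto simp: mons_def gens_def)
  have c: "cell (gens {}) k n = {}" if "k > 0" for k n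
    using m that by (auto simp: cell_def)
  have "stage (\<lambda>_. 0) {}"
    unfolding stage_def
  proof (intro conjI allI ballI impI)
    fix k n z assume z: "z \<in> supp (cell (gens {}) k n)"
    show "z \<in> supp {{#}}" using z m supp_mono[OF subset_trans[OF cell_mons m]] by blast
    assume "k > 0"
    hence "z = 0" using z c by (simp add: supp_def)
    thus "\<exists>y\<in>supp (cell (gens {}) (k - 1) n). diffl (\<lambda>_. 0) y = z"
      by (intro bexI[of _ 0]) (simp_all add: glinear_0[OF glinear_der] supp_0)
  qed simp_all
  thus ?case using P by blast
next
  case (Suc c)
  have fP: "finite P" "P \<noteq> {}" using Suc(2,3) finG finite_subset by (auto simp: downset_def)
  have "Max (dg ` P) \<in> dg ` P" using fP by (intro Max_in) auto
  then obtain w where w: "w \<in> P" "dg w = Max (dg ` P)" by auto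
  have wm: "dg v \<le> dg w" if "v \<in> P" for v using that w fP by simp
  let ?Q = "P - {w}"
  have Q: "downset ?Q" using Suc(3) wm w(1) unfolding downset_def by (auto simp flip: not_le)
  have "card ?Q = c" using Suc(2) w(1) fP by simp
  then obtain \<psi> where "stage \<psi> ?Q" using Suc(1)[of ?Q] Q by blast
  moreover have "w \<in> G" "w \<notin> ?Q" "\<And>u. u \<in> G \<Longrightarrow> dg u < dg w \<Longrightarrow> u \<in> ?Q"
    using Suc(3) w(1) unfolding downset_def by auto
  ultimately have "\<exists>\<psi>'. stage \<psi>' (insert w ?Q)" by (intro stage_step[OF Q])
  thus ?case using w(1) by (simp add: insert_absorb)
qed

end

section \<open>Hilbert series and growth\<close>

lemma size_le_weight:
  "(\<And>x. x \<in># m \<Longrightarrow> 1 \<le> w x) \<Longrightarrow> size m \<le> (\<Sum>x\<in>#m. (w x :: nat))"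
proof (induction m)
  case (add x m)
  have "1 \<le> w x" "size m \<le> (\<Sum>x\<in>#m. w x)" using add by auto
  thus ?case by simp
qed simp

lemma finite_weight_multisets:
  fixes w :: "'a \<Rightarrow> nat"
  assumes X: "finite X" and w: "\<And>x. x \<in> X \<Longrightarrow> 1 \<le> w x"
  shows "finite {m. set_mset m \<subseteq> X \<and> (\<Sum>x\<in>#m. w x) = n}" (is "finite ?A")
    and "card {m. set_mset m \<subseteq> X \<and> (\<Sum>x\<in>#m. w x) = n} \<le> (n + 1) ^ card X"
proof -
  let ?P = "PiE X (\<lambda>_. {..n})"
  let ?f = "\<lambda>m. restrict (count m) X"
  have inj: "inj_on ?f ?A"
  proof (rule inj_onI)
    fix m m' assume a: "m \<in> ?A" "m' \<in> ?A" "?f m = ?f m'"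
    show "m = m'"
    proof (rule multiset_eqI)
      fix x show "count m x = count m' x"
      proof (cases "x \<in> X")
        case True thus ?thesis using fun_cong[OF a(3), of x] by simp
      next
        case False
        hence "x \<notin># m" "x \<notin># m'" using a by auto
        thus ?thesis by (simp add: not_in_iff)
      qed
    qed
  qed
  have im: "?f ` ?A \<subseteq> ?P"
  proof (intro image_subsetI)
    fix m assume m: "m \<in> ?A"
    have "size m \<le> n" using size_le_weight[of m w] m w by auto
    thus "?f m \<in> ?P" using count_le_size order_trans by fastforce
  qed
  have fP: "finite ?P" using X by (intro finite_PiE) auto
  show "finite ?A" using finite_subset[OF im fP] finite_imageD inj by blast
  have "card ?A \<le> card ?P" using card_inj_on_le[OF inj im fP] .
  also have "card ?P = (n + 1) ^ card X" using X by (simp add: card_PiE)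
  finally show "card ?A \<le> (n + 1) ^ card X" .
qed

text \<open>
  With \<open>u\<^sup>c\<^sup>+\<^sup>1 = t\<close>, the terms are \<open>((n + 1) u\<^sup>n)\<^sup>c u\<^sup>n\<close>, where the first factor is bounded.
\<close>

lemma summable_poly_powser:
  assumes t: "0 \<le> t" "(t::real) < 1"
  shows "summable (\<lambda>n. real ((n + 1) ^ c) * t ^ n)"
proof -
  define u where "u = root (Suc c) t"
  have u: "0 \<le> u" "u < 1" "u ^ Suc c = t" using t unfolding u_def by (simp, simp, intro real_root_pow_pos2) auto
  have "(\<lambda>n. real n * u ^ n + u ^ n) \<longlonglongrightarrow> 0 + 0"
    using u powser_times_n_limit_0[of u] by (intro tendsto_add LIMSEQ_power_zero) auto
  hence "Bseq (\<lambda>n. real n * u ^ n + u ^ n)" by (intro convergent_imp_Bseq) (auto simp: convergent_def)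
  then obtain B where B: "\<And>n. norm (real n * u ^ n + u ^ n) \<le> B" by (elim BseqE) blast
  have "norm (real ((n + 1) ^ c) * t ^ n) \<le> B ^ c * u ^ n" for n
  proof -
    have "t ^ n = (u ^ n) ^ c * u ^ n" unfolding u(3)[symmetric] by (simp add: power_mult_distrib mult.commute flip: power_mult)
    hence "real ((n + 1) ^ c) * t ^ n = (real n * u ^ n + u ^ n) ^ c * u ^ n"
      by (simp add: power_mult_distrib[symmetric] algebra_simps)
    moreover have "0 \<le> real n * u ^ n + u ^ n" using u by simp
    ultimately show ?thesis using B[of n] u
      by (auto intro!: mult_right_mono power_mono simp: abs_mult power_abs)
  qed
  moreover have "summable (\<lambda>n. B ^ c * u ^ n)" using u by (intro summable_mult summable_geometric) auto
  ultimately show ?thesis by (rule summable_comparison_test'[where N = 0, rotated])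
qed

text \<open>
  Hilbert series are used as functions on \<open>(0,1)\<close>: ranks are read off from their growth at \<open>1\<close>.
\<close>

definition hilbert :: "(nat \<Rightarrow> nat) \<Rightarrow> real \<Rightarrow> real" where
  "hilbert a t = suminf (\<lambda>n. real (a n) * t ^ n)"

definition hilbert_summable :: "(nat \<Rightarrow> nat) \<Rightarrow> bool" where
  "hilbert_summable a \<longleftrightarrow> (\<forall>t. 0 < t \<and> t < 1 \<longrightarrow> summable (\<lambda>n. real (a n) * t ^ n))"

definition shift :: "(nat \<Rightarrow> nat) \<Rightarrow> nat \<Rightarrow> nat \<Rightarrow> nat" where
  "shift a w n = (if w \<le> n then a (n - w) else 0)"

lemma hilbert_summable_mono: "hilbert_summable b \<Longrightarrow> (\<And>n. a n \<le> b n) \<Longrightarrow> hilbert_summable a"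
  unfolding hilbert_summable_def
proof (intro allI impI)
  fix t :: real
  assume b: "\<forall>t. 0 < t \<and> t < 1 \<longrightarrow> summable (\<lambda>n. real (b n) * t ^ n)" and ab: "\<And>n. a n \<le> b n"
    and t: "0 < t \<and> t < 1"
  have "norm (real (a n) * t ^ n) \<le> real (b n) * t ^ n" for n using ab t by (auto intro!: mult_right_mono)
  thus "summable (\<lambda>n. real (a n) * t ^ n)"
    using b t summable_comparison_test'[of "\<lambda>n. real (b n) * t ^ n" 0 "\<lambda>n. real (a n) * t ^ n"] by blast
qed

lemma hilbert_summable_poly: "(\<And>n. a n \<le> (n + 1) ^ c) \<Longrightarrow> hilbert_summable a"
  by (rule hilbert_summable_mono[of "\<lambda>n. (n + 1) ^ c"], unfold hilbert_summable_def, intro allI impI summable_poly_powser) auto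

lemma hilbert_mono: "hilbert_summable b \<Longrightarrow> (\<And>n. a n \<le> b n) \<Longrightarrow> 0 < t \<Longrightarrow> t < 1 \<Longrightarrow> hilbert a t \<le> hilbert b t"
  unfolding hilbert_def using hilbert_summable_mono[of b a]
  by (intro suminf_le) (auto simp: hilbert_summable_def intro!: mult_right_mono)

lemma hilbert_summable_add: "hilbert_summable a \<Longrightarrow> hilbert_summable b \<Longrightarrow> hilbert_summable (\<lambda>n. a n + b n)"
  by (auto simp: hilbert_summable_def algebra_simps intro: summable_add)

lemma hilbert_add: "hilbert_summable a \<Longrightarrow> hilbert_summable b \<Longrightarrow> 0 < t \<Longrightarrow> t < 1 \<Longrightarrow> hilbert (\<lambda>n. a n + b n) t = hilbert a t + hilbert b t"
  by (simp add: hilbert_def hilbert_summable_def distrib_right flip: suminf_add)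

lemma hilbert_summable_0: "hilbert_summable (\<lambda>n. 0)" by (simp add: hilbert_summable_def)
lemma hilbert_0: "hilbert (\<lambda>n. 0) t = 0" by (simp add: hilbert_def)

lemma hilbert_summable_sum: "finite I \<Longrightarrow> (\<And>i. i \<in> I \<Longrightarrow> hilbert_summable (a i)) \<Longrightarrow> hilbert_summable (\<lambda>n. \<Sum>i\<in>I. a i n)"
  by (induction I rule: finite_induct) (auto intro: hilbert_summable_0 hilbert_summable_add)

lemma hilbert_sum: "finite I \<Longrightarrow> (\<And>i. i \<in> I \<Longrightarrow> hilbert_summable (a i)) \<Longrightarrow> 0 < t \<Longrightarrow> t < 1 \<Longrightarrow>
   hilbert (\<lambda>n. \<Sum>i\<in>I. a i n) t = (\<Sum>i\<in>I. hilbert (a i) t)"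
  by (induction I rule: finite_induct) (auto simp: hilbert_0 hilbert_add hilbert_summable_sum)

lemma hilbert_shift_sums:
  assumes "hilbert_summable a" "0 < t" "t < 1"
  shows "(\<lambda>n. real (shift a w n) * t ^ n) sums (t ^ w * hilbert a t)"
proof -
  have "(\<lambda>n. t ^ w * (real (a n) * t ^ n)) sums (t ^ w * hilbert a t)"
    unfolding hilbert_def using assms by (intro sums_mult summable_sums) (auto simp: hilbert_summable_def)
  hence "(\<lambda>n. real (shift a w (n + w)) * t ^ (n + w)) sums (t ^ w * hilbert a t)"
    by (simp add: shift_def power_add mult_ac)
  moreover have "(\<Sum>n<w. real (shift a w n) * t ^ n) = 0" by (simp add: shift_def)
  ultimately show ?thesis using sums_iff_shift[of "\<lambda>n. real (shift a w n) * t ^ n" w] by simp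
qed

lemma hilbert_summable_shift: "hilbert_summable a \<Longrightarrow> hilbert_summable (shift a w)"
  unfolding hilbert_summable_def using hilbert_shift_sums[unfolded hilbert_summable_def] by (meson sums_summable)

lemma hilbert_shift: "hilbert_summable a \<Longrightarrow> 0 < t \<Longrightarrow> t < 1 \<Longrightarrow> hilbert (shift a w) t = t ^ w * hilbert a t"
  unfolding hilbert_def[of "shift a w"] by (rule sums_unique[OF hilbert_shift_sums, symmetric])

lemma hilbert_tail:
  assumes "hilbert_summable a" "0 < t" "t < 1"
  shows "hilbert_summable (\<lambda>n. a (n + w))" "t ^ w * hilbert (\<lambda>n. a (n + w)) t \<le> hilbert a t"
proof -
  have s: "summable (\<lambda>n. real (a (n + w)) * t ^ n)" if t: "0 < t" "t < 1" for t
  proof -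
    have "summable (\<lambda>n. real (a (n + w)) * t ^ (n + w))"
      using assms(1) t summable_iff_shift[of "\<lambda>n. real (a n) * t ^ n" w] by (simp add: hilbert_summable_def)
    hence "summable (\<lambda>n. t ^ w * (real (a (n + w)) * t ^ n))" by (simp add: power_add mult_ac)
    thus ?thesis using t by (simp add: summable_cmult_iff)
  qed
  thus tail: "hilbert_summable (\<lambda>n. a (n + w))" by (simp add: hilbert_summable_def)
  have "t ^ w * hilbert (\<lambda>n. a (n + w)) t = hilbert (shift (\<lambda>n. a (n + w)) w) t"
    using hilbert_shift[OF tail] assms by simp
  also have "\<dots> \<le> hilbert a t" by (rule hilbert_mono[OF assms(1) _ assms(2,3)]) (auto simp: shift_def)
  finally show "t ^ w * hilbert (\<lambda>n. a (n + w)) t \<le> hilbert a t" .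
qed

lemma hilbert_nonneg: "hilbert_summable a \<Longrightarrow> 0 < t \<Longrightarrow> t < 1 \<Longrightarrow> 0 \<le> hilbert a t"
  unfolding hilbert_def hilbert_summable_def by (intro suminf_nonneg) auto

lemma dim_image_le':
  assumes "gp.subspace V" "fin_dim V" "glinear f" shows "gp.dim (f ` V) \<le> gp.dim V"
  using rank_nullity[OF assms] by simp

lemma glinear_times: "glinear (\<lambda>a. a * c)" for c :: "'v::linorder gpoly"
proof (rule glinearI)
  have e: "gpoly_scale r a = Poly_Mapping.single 0 r * a" for r and a :: "'v gpoly"
    unfolding gpoly_scale_def by (rule mult_map_scale_conv_mult)
  show "gpoly_scale r a * c = gpoly_scale r (a * c)" for r a by (simp add: e mult.assoc)
qed (simp add: distrib_right)

context coformal_model begin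

notation gmul (infixl "\<star>" 70)

text \<open>
  \<open>E\<close> is \<open>\<Lambda>V \<otimes> A\<close>, and \<open>C k n\<close> is its part of word length \<open>k\<close> in \<open>V\<close> and weight \<open>n\<close>.
\<close>

abbreviation "UG \<equiv> gens G"
abbreviation "E \<equiv> supp (mons UG)"
abbreviation "C k n \<equiv> supp (cell UG k n)"

text \<open>
  The even generators of \<open>A = \<Lambda>(sV)\<close>. They are central and generate a polynomial algebra over which \<open>\<Lambda>V \<otimes> A\<close> is free.
\<close>

definition even_bars :: "'v dbl set" where "even_bars = Bar ` {v \<in> G. odd (dg v)}"

lemma gen_weight_pos: "x \<in> UG \<Longrightarrow> 1 \<le> gen_weight x"
  using dg2 by (auto simp: gens_def dest!: dg2)

lemma even_bars_UG: "even_bars \<subseteq> UG" by (auto simp: even_bars_def gens_def)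
lemma even_bars_even: "x \<in> even_bars \<Longrightarrow> even (deg x)" by (auto simp: even_bars_def dest: dg2)
lemma even_bars_gen_length: "x \<in> even_bars \<Longrightarrow> gen_length x = 0" by (auto simp: even_bars_def)

definition wmons :: "'v dbl set \<Rightarrow> nat \<Rightarrow> 'v dbl multiset set" where
  "wmons X n = {m \<in> mons X. weight m = n}"

lemma finite_wmons: "X \<subseteq> UG \<Longrightarrow> finite (wmons X n)"
  and card_wmons: "X \<subseteq> UG \<Longrightarrow> card (wmons X n) \<le> (n + 1) ^ card X"
proof -
  assume X: "X \<subseteq> UG"
  let ?A = "{m. set_mset m \<subseteq> X \<and> (\<Sum>x\<in>#m. gen_weight x) = n}"
  have fX: "finite X" using X fin_gens finite_subset by blast
  have A: "finite ?A" "card ?A \<le> (n + 1) ^ card X"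
    using X gen_weight_pos by (intro finite_weight_multisets[OF fX]; blast)+
  have sub: "wmons X n \<subseteq> ?A" by (auto simp: wmons_def mons_def weight_def)
  show "finite (wmons X n)" using finite_subset[OF sub A(1)] .
  show "card (wmons X n) \<le> (n + 1) ^ card X" using card_mono[OF A(1) sub] A(2) by linarith
qed

lemma finite_cell: "finite (cell UG k n)"
proof (rule finite_subset)
  show "cell UG k n \<subseteq> wmons UG n" by (auto simp: cell_def wmons_def)
qed (rule finite_wmons[OF subset_refl])

definition bar_count :: "nat \<Rightarrow> nat" where "bar_count n = card (wmons (Bar ` G) n)"
definition ring_count :: "nat \<Rightarrow> nat" where "ring_count n = card (wmons even_bars n)"
definition cell_count :: "nat \<Rightarrow> nat \<Rightarrow> nat" where "cell_count k n = card (cell UG k n)"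

lemma hilbert_summable_bar_count: "hilbert_summable bar_count"
  unfolding bar_count_def by (rule hilbert_summable_poly, rule card_wmons) (auto simp: gens_def)
lemma hilbert_summable_ring_count: "hilbert_summable ring_count"
  unfolding ring_count_def by (rule hilbert_summable_poly, rule card_wmons[OF even_bars_UG])
lemma hilbert_summable_cell_count: "hilbert_summable (cell_count k)"
proof (rule hilbert_summable_poly)
  fix n
  have "cell_count k n \<le> card (wmons UG n)"
    unfolding cell_count_def by (rule card_mono[OF finite_wmons[OF subset_refl]]) (auto simp: cell_def wmons_def)
  thus "cell_count k n \<le> (n + 1) ^ card UG" using card_wmons[OF subset_refl] order_trans by blast
qed

lemma fin_dim_C: "fin_dim (C k n)" by (rule fin_dim_supp[OF finite_cell])

lemma dim_C: "gp.dim (C k n) = cell_count k n" by (simp add: dim_supp cell_count_def)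

lemma mons_even_bars: "mons even_bars = {m. set_mset m \<subseteq> even_bars}"
proof -
  have "valid m" if "set_mset m \<subseteq> even_bars" for m
    unfolding valid_def
  proof (intro allI impI)
    fix v assume "odd (deg v)"
    hence "v \<notin># m" using that even_bars_even by auto
    thus "count m v \<le> 1" by (simp add: not_in_iff)
  qed
  thus ?thesis by (auto simp: mons_def)
qed

text \<open>
  \<open>A\<close> is free of finite rank over the polynomial algebra, with basis the monomials in the odd generators.
\<close>

lemma bar_count_le_ring_count: "\<exists>K>0. \<forall>t. 0 < t \<and> t < 1 \<longrightarrow> hilbert bar_count t \<le> K * hilbert ring_count t"
proof -
  \<comment> \<open>the monomials in the odd generators of A\<close>
  define T where "T = {m \<in> mons (Bar ` G). set_mset m \<inter> even_bars = {}}"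
  have oddT: "odd (deg x)" if "m \<in> T" "x \<in># m" for m x
  proof -
    have "x \<in> Bar ` G" "x \<notin> even_bars" using that by (auto simp: T_def mons_def)
    then obtain v where "x = Bar v" "v \<in> G" "even (dg v)" by (auto simp: even_bars_def)
    thus ?thesis using dg2[of v] by auto
  qed
  have finT: "finite T"
  proof (rule finite_imageD)
    show "finite (set_mset ` T)"
      by (rule finite_subset[of _ "Pow (Bar ` G)"]) (use finG in \<open>auto simp: T_def mons_def\<close>)
    show "inj_on set_mset T"
    proof (rule inj_onI)
      fix m m' assume a: "m \<in> T" "m' \<in> T" "set_mset m = set_mset m'"
      show "m = m'"
      proof (rule multiset_eqI)
        fix x
        have c: "count n x = (if x \<in># n then 1 else 0)" if n: "n \<in> T" for n
        proof (cases "x \<in># n")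
          case True
          have "count n x \<le> 1" using oddT[OF n True] n by (auto simp: T_def mons_def valid_def)
          moreover have "count n x > 0" using True by simp
          ultimately have "count n x = 1" by linarith
          thus ?thesis using True by simp
        qed (simp add: not_in_iff)
        show "count m x = count m' x" using c[OF a(1)] c[OF a(2)] a(3) by simp
      qed
    qed
  qed
  have T0: "{#} \<in> T" by (simp add: T_def)
  have le: "bar_count n \<le> (\<Sum>m\<in>T. shift ring_count (weight m) n)" for n
  proof -
    have "wmons (Bar ` G) n \<subseteq> (\<Union>m\<in>T. {m + r | r. r \<in> wmons even_bars (n - weight m) \<and> weight m \<le> n})"
    proof
      fix m assume m: "m \<in> wmons (Bar ` G) n"
      define a where "a = filter_mset (\<lambda>x. x \<notin> even_bars) m"
      define r where "r = filter_mset (\<lambda>x. x \<in> even_bars) m"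
      have mr: "m = a + r" unfolding a_def r_def using multiset_partition[of m "\<lambda>x. x \<notin> even_bars"] by simp
      have "a \<in> T" using m valid_subset[of m a] unfolding T_def a_def by (auto simp: wmons_def mons_def)
      moreover have "r \<in> wmons even_bars (n - weight a)" "weight a \<le> n"
      proof -
        have "weight m = weight a + weight r" by (subst mr) simp
        moreover have "weight m = n" using m by (simp add: wmons_def)
        moreover have "r \<in> mons even_bars" by (auto simp: mons_even_bars r_def)
        ultimately show "r \<in> wmons even_bars (n - weight a)" "weight a \<le> n" by (simp_all add: wmons_def)
      qed
      ultimately show "m \<in> (\<Union>m\<in>T. {m + r | r. r \<in> wmons even_bars (n - weight m) \<and> weight m \<le> n})" using mr by blast
    qed
    moreover have fin: "finite {m + r | r. r \<in> wmons even_bars (n - weight m) \<and> weight m \<le> n}"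
      and cd: "card {m + r | r. r \<in> wmons even_bars (n - weight m) \<and> weight m \<le> n} \<le> shift ring_count (weight m) n" for m
    proof -
      have e: "{m + r | r. r \<in> wmons even_bars (n - weight m) \<and> weight m \<le> n} =
        (if weight m \<le> n then (\<lambda>r. m + r) ` wmons even_bars (n - weight m) else {})" by auto
      show "finite {m + r | r. r \<in> wmons even_bars (n - weight m) \<and> weight m \<le> n}"
        unfolding e using finite_wmons[OF even_bars_UG] by simp
      show "card {m + r | r. r \<in> wmons even_bars (n - weight m) \<and> weight m \<le> n} \<le> shift ring_count (weight m) n"
        unfolding e shift_def ring_count_def by (auto intro!: card_image_le finite_wmons even_bars_UG)
    qed
    ultimately have "bar_count n \<le> card (\<Union>m\<in>T. {m + r | r. r \<in> wmons even_bars (n - weight m) \<and> weight m \<le> n})"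
      unfolding bar_count_def using finT by (intro card_mono) auto
    also have "\<dots> \<le> (\<Sum>m\<in>T. card {m + r | r. r \<in> wmons even_bars (n - weight m) \<and> weight m \<le> n})"
      by (rule card_UN_le[OF finT])
    also have "\<dots> \<le> (\<Sum>m\<in>T. shift ring_count (weight m) n)" by (rule sum_mono) (rule cd)
    finally show ?thesis .
  qed
  have "hilbert bar_count t \<le> real (card T) * hilbert ring_count t" if t: "0 < t" "t < 1" for t
  proof -
    have "hilbert bar_count t \<le> hilbert (\<lambda>n. \<Sum>m\<in>T. shift ring_count (weight m) n) t"
      by (rule hilbert_mono[OF _ le t]) (intro hilbert_summable_sum finT hilbert_summable_shift hilbert_summable_ring_count)
    also have "\<dots> = (\<Sum>m\<in>T. t ^ weight m * hilbert ring_count t)"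
      using hilbert_sum[OF finT hilbert_summable_shift[OF hilbert_summable_ring_count] t] hilbert_shift[OF hilbert_summable_ring_count t] by simp
    also have "\<dots> \<le> (\<Sum>m\<in>T. hilbert ring_count t)"
      using t hilbert_nonneg[OF hilbert_summable_ring_count t] by (intro sum_mono mult_left_le_one_le) (auto simp: power_le_one)
    finally show ?thesis by simp
  qed
  moreover have "real (card T) > 0" using finT T0 by (auto simp: card_gt_0_iff)
  ultimately show ?thesis by blast
qed

subsection \<open>Operators of finite order over the polynomial subalgebra\<close>

definition comm :: "'v dbl \<Rightarrow> ('v dbl gpoly \<Rightarrow> 'v dbl gpoly) \<Rightarrow> 'v dbl gpoly \<Rightarrow> 'v dbl gpoly" where
  "comm x f b = f (gen x \<star> b) - gen x \<star> f b"

text \<open>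
  Grothendieck's definition of a differential operator over the polynomial algebra, with the order shifted by one:
  operators of order \<open>0\<close> vanish, those of order \<open>1\<close> are linear. The shift makes the order of a
  composition at most the sum of the orders, with a uniform induction.
\<close>

primrec diff_order :: "nat \<Rightarrow> ('v dbl gpoly \<Rightarrow> 'v dbl gpoly) \<Rightarrow> bool" where
  "diff_order 0 f \<longleftrightarrow> (\<forall>b\<in>E. f b = 0)"
| "diff_order (Suc r) f \<longleftrightarrow> (\<forall>x\<in>even_bars. diff_order r (comm x f))"

lemma gen_even_bars_E: "x \<in> even_bars \<Longrightarrow> b \<in> E \<Longrightarrow> gen x \<star> b \<in> E"
  by (rule supp_mons_mult) (use even_bars_UG in \<open>auto simp: mons_def valid_add_mset\<close>)

lemma glinear_comm: "glinear f \<Longrightarrow> glinear (comm x f)"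
  unfolding comm_def
  by (intro glinear_minus glinear_compose[OF glinear_mult_right] glinear_compose[OF _ glinear_mult_right])

lemma comm_E: "x \<in> even_bars \<Longrightarrow> (\<And>b. b \<in> E \<Longrightarrow> f b \<in> E) \<Longrightarrow> b \<in> E \<Longrightarrow> comm x f b \<in> E"
  unfolding comm_def by (intro supp_diff) (auto intro: gen_even_bars_E)

lemma diff_order_Suc: "diff_order r f \<Longrightarrow> diff_order (Suc r) f"
proof (induction r arbitrary: f)
  case 0 thus ?case using gen_even_bars_E by (auto simp: comm_def)
qed simp

lemma diff_order_le: "diff_order r f \<Longrightarrow> r \<le> s \<Longrightarrow> diff_order s f"
  by (induction s) (auto simp: le_Suc_eq simp del: diff_order.simps intro: diff_order_Suc)

lemma diff_order_zero: "diff_order r (\<lambda>b. 0)" using diff_order_le[of 0 "\<lambda>b. 0" r] by simp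

lemma diff_order_add: "diff_order r f \<Longrightarrow> diff_order r g \<Longrightarrow> diff_order r (\<lambda>b. f b + g b)"
proof (induction r arbitrary: f g)
  case (Suc r)
  have "comm x (\<lambda>b. f b + g b) = (\<lambda>b. comm x f b + comm x g b)" for x
    by (auto simp: comm_def mult_add_right)
  thus ?case using Suc by simp
qed simp

lemma diff_order_scale: "diff_order r f \<Longrightarrow> diff_order r (\<lambda>b. gpoly_scale c (f b))"
proof (induction r arbitrary: f)
  case (Suc r)
  have "comm x (\<lambda>b. gpoly_scale c (f b)) = (\<lambda>b. gpoly_scale c (comm x f b))" for x
    by (auto simp: comm_def mult_scale_right gp.scale_right_diff_distrib)
  thus ?case using Suc by simp
qed simp

lemma diff_order_comp:
  assumes "diff_order m f" "diff_order n g" "glinear f" "glinear g" "\<And>b. b \<in> E \<Longrightarrow> g b \<in> E"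
  shows "diff_order (m + n) (\<lambda>b. f (g b))"
  using assms
proof (induction "m + n" arbitrary: m n f g)
  case 0 thus ?case by (auto simp: glinear_0)
next
  case (Suc k)
  show ?case
  proof (cases "m = 0 \<or> n = 0")
    case True
    hence "diff_order 0 (\<lambda>b. f (g b))" using Suc.prems by (auto simp: glinear_0)
    thus ?thesis by (rule diff_order_le) simp
  next
    case False
    then obtain a c where ac: "m = Suc a" "n = Suc c" by (meson not0_implies_Suc)
    have "diff_order (a + n) (comm x (\<lambda>b. f (g b)))" if x: "x \<in> even_bars" for x
    proof -
      have e: "comm x (\<lambda>b. f (g b)) = (\<lambda>b. f (comm x g b) + comm x f (g b))"
        using Suc.prems(3) by (auto simp: comm_def glinear_diff)
      have "diff_order (m + c) (\<lambda>b. f (comm x g b))"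
        using Suc ac x by (intro Suc.hyps) (auto intro!: glinear_comm comm_E)
      moreover have "diff_order (a + n) (\<lambda>b. comm x f (g b))"
        using Suc ac x by (intro Suc.hyps) (auto intro!: glinear_comm)
      ultimately show ?thesis unfolding e using ac by (intro diff_order_add) simp_all
    qed
    thus ?thesis using ac by simp
  qed
qed

lemma gen_even_bars_cell: "x \<in> even_bars \<Longrightarrow> b \<in> C k n \<Longrightarrow> gen x \<star> b \<in> C k (n + gen_weight x)"
  by (rule supp_mult[where A = "{{#x#}}" and B = "cell UG k n"])
     (use even_bars_UG even_bars_even even_bars_gen_length in \<open>auto simp: cell_def mons_def valid_add_mset\<close>)

definition image_dim :: "('v dbl gpoly \<Rightarrow> 'v dbl gpoly) \<Rightarrow> nat \<Rightarrow> nat \<Rightarrow> nat" where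
  "image_dim f k n = gp.dim (f ` C k n)"

lemma fin_dim_im: "glinear f \<Longrightarrow> fin_dim (f ` C k n)"
  by (rule fin_dim_image[OF fin_dim_C])

lemma subspace_im: "glinear f \<Longrightarrow> gp.subspace (f ` C k n)"
  by (rule gpp.linear_subspace_image[OF _ subspace_supp])

lemma image_dim_le: "glinear f \<Longrightarrow> image_dim f k n \<le> cell_count k n"
  unfolding image_dim_def dim_C[symmetric] by (rule dim_image_le'[OF subspace_supp fin_dim_C])

lemma hilbert_summable_image_dim: "glinear f \<Longrightarrow> hilbert_summable (image_dim f k)"
  by (rule hilbert_summable_mono[OF hilbert_summable_cell_count image_dim_le])

text \<open>
  No sign arises from even generators. The commutative product of \<open>\<Rightarrow>\<^sub>0\<close>, to which the graded product
  is compared here, is known to have no zero divisors.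
\<close>

lemma even_bars_mult_eq_times: "a \<in> supp (mons even_bars) \<Longrightarrow> a \<star> c = a * c"
proof -
  have k: "koszul m n = 1" if "m \<in> mons even_bars" for m n
  proof -
    have "\<not> odd (deg v)" if "v \<in># m" for v using that \<open>m \<in> mons even_bars\<close> even_bars_even by (auto simp: mons_def)
    hence "inversions m n = {}" "\<not> common_odd m n" by (auto simp: common_odd_def inversions_def)
    thus ?thesis by (simp add: koszul_def)
  qed
  have 1: "mon m \<star> mon n = mon m * mon n" if "m \<in> mons even_bars" for m n
    using k[OF that] by (simp add: mon_mult_mon mult_single)
  have "glinear (\<lambda>c. a * c)" for a :: "'v dbl gpoly" using glinear_times[of a] by (simp add: mult.commute)
  hence 2: "mon m \<star> c = mon m * c" if "m \<in> mons even_bars" for m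
    using 1[OF that] by (intro glinear_eqI[where a = c and f = "\<lambda>c. mon m \<star> c"] glinear_mult_right) auto
  assume "a \<in> supp (mons even_bars)"
  thus ?thesis using 2
    by (intro glinear_eqI[where a = a and f = "\<lambda>a. a \<star> c"] glinear_mult_left glinear_times) (auto simp: supp_def)
qed

text \<open>
  The image contains the free module of rank one generated by \<open>f b\<close>.
\<close>

lemma growth_linear:
  assumes f: "glinear f" and c: "\<And>x n b. x \<in> even_bars \<Longrightarrow> b \<in> C k n \<Longrightarrow> f (gen x \<star> b) = gen x \<star> f b"
    and b: "b \<in> C k n0" "f b \<noteq> 0"
  shows "ring_count n \<le> image_dim f k (n + n0)"
proof -
  have mr: "mon r \<star> b \<in> C k (weight r + n0) \<and> f (mon r \<star> b) = mon r \<star> f b" if "set_mset r \<subseteq> even_bars" for r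
    using that
  proof (induction r)
    case empty thus ?case using b by simp
  next
    case (add x r)
    have x: "x \<in> even_bars" and IH: "mon r \<star> b \<in> C k (weight r + n0)" "f (mon r \<star> b) = mon r \<star> f b" using add by auto
    have "mon (add_mset x r) = gen x \<star> mon r" using even_bars_even[OF x] by (simp add: gen_mult_mon koszul_gen)
    hence e: "mon (add_mset x r) \<star> a = gen x \<star> (mon r \<star> a)" for a by (simp add: gmult_assoc)
    show ?case unfolding e using c[OF x IH(1)] IH gen_even_bars_cell[OF x IH(1)] by (simp add: add_ac)
  qed
  let ?W = "supp (wmons even_bars n)" and ?h = "\<lambda>a. a \<star> f b"
  have ww: "wmons even_bars n \<subseteq> mons even_bars" by (auto simp: wmons_def)
  have inj: "{a \<in> ?W. ?h a = 0} = {0}"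
  proof -
    have "a = 0" if "a \<in> ?W" "?h a = 0" for a
      using that even_bars_mult_eq_times[of a "f b"] supp_mono[OF ww] b(2) by auto
    thus ?thesis by (auto simp: supp_0)
  qed
  have z: "gp.dim {0 :: 'v dbl gpoly} = 0" using gp.dim_le_card[of "{0}" "{}"] by simp
  have "ring_count n = gp.dim ?W" by (simp add: dim_supp ring_count_def)
  also have "\<dots> = gp.dim (?h ` ?W)"
    using rank_nullity[OF subspace_supp fin_dim_supp[OF finite_wmons[OF even_bars_UG]] glinear_mult_left[of "f b"], of n]
    unfolding inj z by simp
  also have "\<dots> \<le> gp.dim (f ` C k (n + n0))"
  proof (rule gdim_mono[OF _ fin_dim_im[OF f]], rule image_subsetI)
    fix a assume a: "a \<in> ?W"
    have "f (a \<star> b) = a \<star> f b"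
    proof (rule glinear_eqI[where a = a and f = "\<lambda>a. f (a \<star> b)"])
      show "glinear (\<lambda>a. f (a \<star> b))" by (rule glinear_compose[OF glinear_mult_left f])
      show "glinear (\<lambda>a. a \<star> f b)" by (rule glinear_mult_left)
      fix m assume "m \<in> keys a"
      hence "set_mset m \<subseteq> even_bars" using a by (auto simp: supp_def wmons_def mons_def)
      thus "f (mon m \<star> b) = mon m \<star> f b" using mr by blast
    qed
    moreover have "a \<star> b \<in> C k (n + n0)"
    proof (rule glinear_suppI[OF glinear_mult_left _ a])
      fix m assume "m \<in> wmons even_bars n"
      thus "mon m \<star> b \<in> C k (n + n0)" using mr[of m] by (auto simp: wmons_def mons_def)
    qed
    ultimately show "a \<star> f b \<in> f ` C k (n + n0)" by (metis imageI)
  qed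
  finally show ?thesis by (simp add: image_dim_def)
qed

text \<open>
  If \<open>f\<close> commutes with all \<open>x\<close>, this is \<open>growth_linear\<close>. Otherwise some commutator \<open>[f,x]\<close> is nonzero, of smaller
  order, and its image is contained in \<open>im f + x im f\<close>, so the Hilbert series of the image of \<open>f\<close> is at
  least a fixed multiple of that of the commutator.
\<close>

lemma growth:
  assumes "glinear f" "diff_order r f" "b \<in> C k n" "f b \<noteq> 0"
  shows "\<exists>N K. K > 0 \<and> (\<forall>t. 0 < t \<and> t < 1 \<longrightarrow> t ^ N * hilbert bar_count t \<le> K * hilbert (image_dim f k) t)"
  using assms
proof (induction r arbitrary: f n b)
  case 0
  have "b \<in> E" using 0(3) supp_mono[OF cell_mons] by blast
  thus ?case using 0 by simp
next
  case (Suc r)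
  show ?case
  proof (cases "\<forall>x\<in>even_bars. \<forall>n. \<forall>b\<in>C k n. comm x f b = 0")
    case True
    hence c: "\<And>x n b. x \<in> even_bars \<Longrightarrow> b \<in> C k n \<Longrightarrow> f (gen x \<star> b) = gen x \<star> f b" by (simp add: comm_def)
    have le: "ring_count m \<le> image_dim f k (m + n)" for m by (rule growth_linear[OF Suc.prems(1) c Suc.prems(3,4)])
    obtain K where K: "K > 0" "\<And>t. 0 < t \<Longrightarrow> t < 1 \<Longrightarrow> hilbert bar_count t \<le> K * hilbert ring_count t" using bar_count_le_ring_count by blast
    have "t ^ n * hilbert bar_count t \<le> K * hilbert (image_dim f k) t" if t: "0 < t" "t < 1" for t
    proof -
      note tail = hilbert_tail[OF hilbert_summable_image_dim[OF Suc.prems(1)] t]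
      have "t ^ n * hilbert bar_count t \<le> t ^ n * (K * hilbert ring_count t)" using K t by (intro mult_left_mono) auto
      also have "\<dots> \<le> t ^ n * (K * hilbert (\<lambda>m. image_dim f k (m + n)) t)"
        using K t by (intro mult_left_mono hilbert_mono[OF tail(1) le]) auto
      also have "\<dots> = K * (t ^ n * hilbert (\<lambda>m. image_dim f k (m + n)) t)" by simp
      also have "\<dots> \<le> K * hilbert (image_dim f k) t" using K tail(2) by (intro mult_left_mono) auto
      finally show ?thesis .
    qed
    thus ?thesis using K by blast
  next
    case False
    then obtain x n' b' where x: "x \<in> even_bars" "b' \<in> C k n'" "comm x f b' \<noteq> 0" by blast
    have lin: "glinear (comm x f)" by (rule glinear_comm[OF Suc.prems(1)])
    have "diff_order r (comm x f)" using Suc.prems(2) x by simp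
    then obtain N K where NK: "K > 0" "\<And>t. 0 < t \<Longrightarrow> t < 1 \<Longrightarrow> t ^ N * hilbert bar_count t \<le> K * hilbert (image_dim (comm x f) k) t"
      using Suc.IH[OF lin _ x(2,3)] by blast
    let ?w = "gen_weight x"
    have le: "image_dim (comm x f) k m \<le> image_dim f k (m + ?w) + image_dim f k m" for m
    proof -
      let ?V = "f ` C k (m + ?w)" and ?U = "(\<lambda>a. gen x \<star> a) ` f ` C k m"
      have "gp.dim (comm x f ` C k m) \<le> gp.dim ?V + gp.dim ?U"
      proof (rule gdim_le_sum[OF _ fin_dim_im[OF Suc.prems(1)] fin_dim_image[OF fin_dim_im[OF Suc.prems(1)] glinear_mult_right]])
        show "comm x f ` C k m \<subseteq> {a + b |a b. a \<in> ?V \<and> b \<in> ?U}"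
        proof (rule image_subsetI)
          fix a assume a: "a \<in> C k m"
          have "- a \<in> C k m" using supp_scale[OF a, of "-1"] by (simp add: gp.scale_minus_left)
          hence "gen x \<star> f (- a) \<in> ?U" by blast
          moreover have "gen x \<star> f (- a) = - (gen x \<star> f a)"
            by (simp add: glinear_neg[OF Suc.prems(1)] glinear_neg[OF glinear_mult_right])
          moreover have "f (gen x \<star> a) \<in> ?V" using gen_even_bars_cell[OF x(1) a] by blast
          ultimately show "comm x f a \<in> {a + b |a b. a \<in> ?V \<and> b \<in> ?U}"
            unfolding comm_def by (metis (mono_tags, lifting) add_uminus_conv_diff mem_Collect_eq)
        qed
      qed
      moreover have "gp.dim ?U \<le> gp.dim (f ` C k m)"
        by (rule dim_image_le'[OF subspace_im fin_dim_im glinear_mult_right]) (rule Suc.prems(1))+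
      ultimately show ?thesis by (simp add: image_dim_def)
    qed
    have "t ^ (N + ?w) * hilbert bar_count t \<le> (2 * K) * hilbert (image_dim f k) t" if t: "0 < t" "t < 1" for t
    proof -
      have s: "hilbert_summable (image_dim f k)" by (rule hilbert_summable_image_dim[OF Suc.prems(1)])
      note tail = hilbert_tail[OF s t]
      have "t ^ ?w * hilbert (image_dim (comm x f) k) t \<le> t ^ ?w * hilbert (\<lambda>m. image_dim f k (m + ?w) + image_dim f k m) t"
        using t by (intro mult_left_mono hilbert_mono[OF hilbert_summable_add[OF tail(1) s] le]) auto
      also have "\<dots> = t ^ ?w * hilbert (\<lambda>m. image_dim f k (m + ?w)) t + t ^ ?w * hilbert (image_dim f k) t"
        using hilbert_add[OF tail(1) s t] by (simp add: distrib_left)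
      also have "\<dots> \<le> hilbert (image_dim f k) t + hilbert (image_dim f k) t"
        using tail(2) t hilbert_nonneg[OF s t]
        by (intro add_mono mult_left_le_one_le) (auto simp: power_le_one)
      finally have 1: "t ^ ?w * hilbert (image_dim (comm x f) k) t \<le> 2 * hilbert (image_dim f k) t" by simp
      have "t ^ (N + ?w) * hilbert bar_count t = t ^ ?w * (t ^ N * hilbert bar_count t)" by (simp add: power_add mult_ac)
      also have "\<dots> \<le> t ^ ?w * (K * hilbert (image_dim (comm x f) k) t)" using NK t by (intro mult_left_mono) auto
      also have "\<dots> = K * (t ^ ?w * hilbert (image_dim (comm x f) k) t)" by simp
      also have "\<dots> \<le> K * (2 * hilbert (image_dim f k) t)" using NK 1 by (intro mult_left_mono) auto
      finally show ?thesis by simp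
    qed
    moreover have "2 * K > 0" using NK by simp
    ultimately show ?thesis by blast
  qed
qed

end

section \<open>Splitting the differential of the base\<close>

text \<open>
  Composition with such a \<open>q\<close> is used in place of the passage to the quotient by \<open>W\<close>.
\<close>

lemma exists_kernel:
  assumes "gp.subspace W"
  shows "\<exists>q :: 'v gpoly \<Rightarrow> 'v gpoly. glinear q \<and> (\<forall>x. q x = 0 \<longleftrightarrow> x \<in> W)"
proof -
  obtain B where B: "B \<subseteq> W" "gp.independent B" "W \<subseteq> gp.span B" "card B = gp.dim W"
    using gp.basis_exists[of W] by metis
  have spB: "gp.span B = W" using B assms by (meson gp.span_minimal subset_antisym)
  define C where "C = gp.extend_basis B"
  have C: "B \<subseteq> C" "gp.independent C" "gp.span C = UNIV"
    unfolding C_def using gp.extend_basis_superset gp.independent_extend_basis gp.span_extend_basis B(2) by auto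
  obtain q :: "'v gpoly \<Rightarrow> 'v gpoly" where q: "glinear q" "\<forall>x\<in>C. q x = (if x \<in> B then 0 else x)"
    using gpp.linear_independent_extend[OF C(2), of "\<lambda>x. if x \<in> B then 0 else x"] by blast
  have qB: "q x = 0" if "x \<in> gp.span B" for x
    by (rule gpp.linear_eq_0_on_span[OF q(1) _ that]) (use q(2) C(1) in auto)
  have qC: "q x = x" if "x \<in> gp.span (C - B)" for x
    by (rule gpp.linear_eq_on_span[OF q(1) glinear_id _ that]) (use q(2) in auto)
  have "q x = 0 \<longleftrightarrow> x \<in> W" for x
  proof
    assume x0: "q x = 0"
    have "x \<in> gp.span (B \<union> (C - B))" using C by (simp add: Un_absorb1)
    then obtain b c where bc: "x = b + c" "b \<in> gp.span B" "c \<in> gp.span (C - B)"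
      unfolding gp.span_Un by auto
    hence "c = 0" using x0 qB qC glinear_add[OF q(1)] by auto
    thus "x \<in> W" using bc spB by simp
  qed (use qB spB in auto)
  thus ?thesis using q(1) by blast
qed

text \<open>
  A greedy choice: \<open>x\<close> is added to the set if and only if \<open>f x\<close> is independent of the previous images.
\<close>

lemma exists_monomial_section:
  assumes "finite X" "glinear f"
  shows "\<exists>S\<subseteq>X. (\<forall>s\<in>supp S. f s = 0 \<longrightarrow> s = 0) \<and> f ` supp X \<subseteq> f ` supp S"
  using assms(1)
proof (induction X rule: finite_induct)
  case empty thus ?case by (auto simp: supp_def)
next
  case (insert x X)
  then obtain S where S: "S \<subseteq> X" "\<And>s. s \<in> supp S \<Longrightarrow> f s = 0 \<Longrightarrow> s = 0" "f ` supp X \<subseteq> f ` supp S" by blast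
  have split: "\<exists>c b. a = gpoly_scale c (mon x) + b \<and> b \<in> supp Z \<and> x \<notin> keys b"
    if "a \<in> supp (insert x Z)" for a :: "'a gpoly" and Z
  proof (intro exI conjI)
    let ?b = "a - gpoly_scale (coef a x) (mon x)"
    show "a = gpoly_scale (coef a x) (mon x) + ?b" by simp
    show x: "x \<notin> keys ?b" by (simp add: in_keys_iff lookup_minus)
    have "?b \<in> supp (insert x Z)" using that by (intro supp_diff supp_scale) auto
    thus "?b \<in> supp Z" using x by (auto simp: supp_def)
  qed
  show ?case
  proof (cases "f (mon x) \<in> f ` supp S")
    case True
    then obtain s0 where s0: "s0 \<in> supp S" "f (mon x) = f s0" by auto
    have "f ` supp (insert x X) \<subseteq> f ` supp S"
    proof (rule image_subsetI)
      fix a assume "a \<in> supp (insert x X)"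
      then obtain c b where a: "a = gpoly_scale c (mon x) + b" "b \<in> supp X" using split by metis
      obtain s1 where s1: "s1 \<in> supp S" "f b = f s1" using S(3) a(2) by blast
      have "f a = f (gpoly_scale c s0 + s1)"
        using a s0 s1 assms(2) by (simp add: glinear_add glinear_scale)
      thus "f a \<in> f ` supp S" using s0 s1 by (auto intro!: imageI supp_add supp_scale)
    qed
    thus ?thesis using S by blast
  next
    case False
    have "s = 0" if s: "s \<in> supp (insert x S)" "f s = 0" for s
    proof -
      obtain c b where a: "s = gpoly_scale c (mon x) + b" "b \<in> supp S" using split[OF s(1)] by metis
      have "c = 0"
      proof (rule ccontr)
        assume c: "c \<noteq> 0"
        have "gpoly_scale c (f (mon x)) = - f b"
          using s(2) a(1) assms(2) by (simp add: glinear_add glinear_scale eq_neg_iff_add_eq_0)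
        hence "gpoly_scale (1 / c) (gpoly_scale c (f (mon x))) = gpoly_scale (1 / c) (- f b)" by simp
        hence "f (mon x) = f (gpoly_scale (- 1 / c) b)"
          using c assms(2) by (simp add: glinear_scale gp.scale_minus_left glinear_neg)
        thus False using False a(2) supp_scale by blast
      qed
      thus ?thesis using S(2) a s(2) by simp
    qed
    moreover have "f ` supp (insert x X) \<subseteq> f ` supp (insert x S)"
    proof (rule image_subsetI)
      fix a assume "a \<in> supp (insert x X)"
      then obtain c b where a: "a = gpoly_scale c (mon x) + b" "b \<in> supp X" using split by metis
      obtain s1 where s1: "s1 \<in> supp S" "f b = f s1" using S(3) a(2) by blast
      have "f a = f (gpoly_scale c (mon x) + s1)"
        using a s1 assms(2) by (simp add: glinear_add glinear_scale)
      moreover have "s1 \<in> supp (insert x S)" using s1 supp_mono[of S "insert x S"] by auto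
      ultimately show "f a \<in> f ` supp (insert x S)" by (auto intro!: imageI supp_add supp_scale)
    qed
    moreover have "insert x S \<subseteq> insert x X" using S(1) by auto
    ultimately show ?thesis by blast
  qed
qed

locale acyclic_closure = coformal_model G dg d0
  for G :: "'v::linorder set" and dg :: "'v \<Rightarrow> nat" and d0 :: "'v \<Rightarrow> 'v dbl gpoly" +
  fixes \<psi> :: "'v \<Rightarrow> 'v dbl gpoly"
  assumes st: "stage \<psi> G"
begin

notation gmul (infixl "\<star>" 70)

definition D :: "'v dbl gpoly \<Rightarrow> 'v dbl gpoly" where "D = diffl \<psi>"

lemma glinear_D: "glinear D" unfolding D_def by (rule glinear_der)

lemma downG: "downset G" by (simp add: downset_def)

lemma psi_cell: "\<forall>w\<in>G. \<psi> w \<in> supp (cell (gens G) 1 (dg w - 1))"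
  and psi_0: "\<forall>w. w \<notin> G \<longrightarrow> \<psi> w = 0"
  using st unfolding stage_def by auto

lemmas diff_gens_odd = stage_odd_der[OF downG psi_cell psi_0]

lemma dgenE: "x \<in> UG \<Longrightarrow> diff_on_gens \<psi> x \<in> E"
  using diff_gens_odd(2) supp_mono[OF cell_mons] by blast

lemma CE: "a \<in> C k n \<Longrightarrow> a \<in> E" using supp_mono[OF cell_mons] by blast

lemma D_C: "a \<in> C k n \<Longrightarrow> D a \<in> C (Suc k) n"
  unfolding D_def using supp_cell_der[OF diff_gens_odd(2), of UG a k n] by simp

lemma D_E: "a \<in> E \<Longrightarrow> D a \<in> E"
  unfolding D_def by (rule supp_mons_der[OF dgenE])

lemma D_base_cong:
  assumes "a \<in> supp (mons (Base ` G))" shows "diffl \<rho> a = diffl \<rho>' a"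
proof (rule der_cong_supp)
  fix m x assume "m \<in> keys a" "x \<in># m"
  hence "x \<in> Base ` G" using assms by (auto simp: supp_def mons_def)
  thus "diff_on_gens \<rho> x = diff_on_gens \<rho>' x" by auto
qed

lemma D_squared: "a \<in> E \<Longrightarrow> D (D a) = 0"
  unfolding D_def
proof (rule der_sq[OF diff_gens_odd(1) dgenE subset_refl])
  fix x assume "x \<in> gens G"
  moreover have "diffl \<psi> (d0 v) = 0" if "v \<in> G" for v
  proof -
    have "cell (Base ` {u \<in> G. dg u < dg v}) 2 (dg v - 1) \<subseteq> mons (Base ` G)" by (auto simp: cell_def mons_def)
    hence "d0 v \<in> supp (mons (Base ` G))" using quad[OF that] supp_mono by blast
    thus ?thesis using closed[OF that] D_base_cong[of "d0 v" \<psi> "\<lambda>_. 0"] by simp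
  qed
  moreover have "diffl \<psi> (\<psi> v) = 0" if "v \<in> G" for v using st that by (simp add: stage_def)
  ultimately show "diffl \<psi> (diff_on_gens \<psi> x) = 0" by (auto simp: gens_def)
qed

lemma exact: "z \<in> C (Suc k) n \<Longrightarrow> D z = 0 \<Longrightarrow> \<exists>y\<in>C k n. D y = z"
  using st unfolding stage_def D_def by force

lemma exact0: "z \<in> C 0 n \<Longrightarrow> D z = 0 \<Longrightarrow> z \<in> supp {{#}}"
  using st unfolding stage_def D_def by blast

lemma D_one: "D (mon {#}) = 0" by (simp add: D_def)

subsection \<open>Base monomials\<close>

text \<open>
  The monomials that span \<open>\<Lambda>\<^sup>kV\<close>, which is \<open>LV k\<close>. Likewise \<open>AM\<close> is a basis of \<open>A\<close>.
\<close>

definition BM :: "nat \<Rightarrow> 'v dbl multiset set" where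
  "BM k = {m \<in> mons (Base ` G). base_length m = k}"

abbreviation "LV k \<equiv> supp (BM k)"
abbreviation "AM \<equiv> mons (Bar ` G)"

definition base_part :: "'v dbl multiset \<Rightarrow> 'v dbl multiset" where "base_part m = filter_mset (\<lambda>x. x \<in> range Base) m"
definition bar_part :: "'v dbl multiset \<Rightarrow> 'v dbl multiset" where "bar_part m = filter_mset (\<lambda>x. x \<notin> range Base) m"

lemma base_part_bar_part: "base_part m + bar_part m = m" unfolding base_part_def bar_part_def by (rule multiset_partition[symmetric])

lemma base_part_add [simp]: "base_part (m + n) = base_part m + base_part n" and bar_part_add [simp]: "bar_part (m + n) = bar_part m + bar_part n"
  by (simp_all add: base_part_def bar_part_def)

lemma base_part_base: "set_mset m \<subseteq> range Base \<Longrightarrow> base_part m = m \<and> bar_part m = {#}"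
  by (induction m) (auto simp: base_part_def bar_part_def)

lemma base_part_bar: "set_mset m \<inter> range Base = {} \<Longrightarrow> base_part m = {#} \<and> bar_part m = m"
  by (induction m) (auto simp: base_part_def bar_part_def)

lemma BM_base_part: "m \<in> BM k \<Longrightarrow> base_part m = m \<and> bar_part m = {#}"
  by (rule base_part_base) (auto simp: BM_def mons_def)

lemma AM_base_part: "m \<in> AM \<Longrightarrow> base_part m = {#} \<and> bar_part m = m"
  by (rule base_part_bar) (auto simp: mons_def)

lemma base_length_bar: "set_mset m \<inter> range Base = {} \<Longrightarrow> base_length m = 0"
proof (induction m)
  case (add x m) thus ?case by (cases x) auto
qed simp

lemma base_length_base_part: "base_length (base_part m) = base_length m"
proof -
  have "base_length (bar_part m) = 0" by (rule base_length_bar) (auto simp: bar_part_def)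
  thus ?thesis using base_length_simps(2)[of "base_part m" "bar_part m"] by (simp add: base_part_bar_part)
qed

lemma mons_base_part: "m \<in> mons UG \<Longrightarrow> base_part m \<in> mons (Base ` G)" "m \<in> mons UG \<Longrightarrow> bar_part m \<in> AM"
  using valid_subset[of m "base_part m"] valid_subset[of m "bar_part m"]
  by (auto simp: mons_def gens_def base_part_def bar_part_def)

lemma cell_base_part: "m \<in> cell UG k n \<Longrightarrow> base_part m \<in> BM k"
  using mons_base_part(1)[of m] by (auto simp: cell_def BM_def base_length_base_part)

lemma koszul_base_bar:
  assumes "set_mset m \<subseteq> range Base" "set_mset a \<inter> range Base = {}"
  shows "koszul m a = 1" "\<not> common_odd m a"
proof -
  have "\<not> y < x" if xy: "x \<in># m" "y \<in># a" for x y
  proof -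
    obtain u where "x = Base u" using xy(1) assms(1) by blast
    moreover have "y \<notin> range Base" using xy(2) assms(2) by blast
    ultimately show ?thesis by (cases y) (auto simp: less_dbl_def)
  qed
  hence "inversions m a = {}" by (auto simp: inversions_def)
  moreover show "\<not> common_odd m a" using assms by (auto simp: common_odd_def)
  ultimately show "koszul m a = 1" by (simp add: koszul_def)
qed

lemma mon_split: "m \<in> mons (Base ` G) \<Longrightarrow> a \<in> AM \<Longrightarrow> mon m \<star> mon a = mon (m + a)"
proof -
  assume "m \<in> mons (Base ` G)" "a \<in> AM"
  hence "koszul m a = 1" by (intro koszul_base_bar) (auto simp: mons_def)
  thus ?thesis by (simp add: mon_mult_mon)
qed

lemma mon_base_part_bar_part: "m \<in> mons UG \<Longrightarrow> mon (base_part m) \<star> mon (bar_part m) = mon m"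
  using mon_split[OF mons_base_part] by (simp add: base_part_bar_part)

lemma add_mons: "m \<in> mons (Base ` G) \<Longrightarrow> a \<in> AM \<Longrightarrow> m + a \<in> mons UG"
  using koszul_base_bar(2)[of m a] valid_add[of m a] by (auto simp: mons_def gens_def)

lemma base_length_AM: "a \<in> AM \<Longrightarrow> base_length a = 0" by (rule base_length_bar) (auto simp: mons_def)

lemma add_cell: "m \<in> BM k \<Longrightarrow> a \<in> AM \<Longrightarrow> m + a \<in> cell UG k (weight m + weight a)"
  using add_mons[of m a] by (auto simp: BM_def cell_def base_length_AM)

definition maxw :: nat where "maxw = (\<Sum>v\<in>G. dg v)"

lemma weight_le: "set_mset m \<subseteq> Base ` G \<Longrightarrow> weight m \<le> base_length m * maxw"
proof (induction m)
  case (add x m)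
  then obtain v where v: "x = Base v" "v \<in> G" by auto
  have "dg v \<le> maxw" unfolding maxw_def using v finG by (intro member_le_sum) auto
  thus ?case using add v by auto
qed simp

lemma weight_BM: "m \<in> BM k \<Longrightarrow> weight m \<le> k * maxw"
  using weight_le[of m] by (auto simp: BM_def mons_def)

lemma base_UG: "Base ` G \<subseteq> UG" by (auto simp: gens_def)

lemma BM_mons: "BM k \<subseteq> mons UG" using mons_mono[OF base_UG] by (auto simp: BM_def)

lemma finite_BM: "finite (BM k)"
proof (rule finite_subset)
  show "BM k \<subseteq> (\<Union>n\<le>k * maxw. wmons UG n)" using weight_BM BM_mons by (fastforce simp: wmons_def)
  show "finite (\<Union>n\<le>k * maxw. wmons UG n)" using finite_wmons by auto
qed

definition BMw :: "nat \<Rightarrow> nat \<Rightarrow> 'v dbl multiset set" where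
  "BMw k w = {m \<in> BM k. weight m = w}"

lemma BMw_cell: "BMw k w = cell (Base ` G) k w" by (auto simp: BMw_def BM_def cell_def)

lemma D_BMw: "a \<in> supp (BMw k w) \<Longrightarrow> D a \<in> supp (BMw (Suc k) w)"
proof -
  assume a: "a \<in> supp (BMw k w)"
  have "diff_on_gens \<psi> x \<in> supp (cell (Base ` G) (gen_length x + 1) (gen_weight x))" if x: "x \<in> Base ` G" for x
  proof -
    obtain v where v: "x = Base v" "v \<in> G" using x by auto
    have "Base ` {u \<in> G. dg u < dg v} \<subseteq> Base ` G" by auto
    hence "d0 v \<in> supp (cell (Base ` G) 2 (dg v - 1))" using quad[OF v(2)] supp_mono[OF cell_mono] by blast
    thus ?thesis using v by (simp add: numeral_2_eq_2)
  qed
  thus ?thesis using a unfolding D_def BMw_cell using supp_cell_der[of "Base ` G" UG "diff_on_gens \<psi>" a k w] by simp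
qed

lemma BMw_LV: "a \<in> supp (BMw k w) \<Longrightarrow> a \<in> LV k"
  using supp_mono[of "BMw k w" "BM k"] by (auto simp: BMw_def)

lemma mon_BMw: "m \<in> BM k \<Longrightarrow> mon m \<in> supp (BMw k (weight m))" by (simp add: BMw_def)

lemma D_LV: "a \<in> LV k \<Longrightarrow> D a \<in> LV (Suc k)"
  by (rule glinear_suppI[OF glinear_D]) (auto intro: BMw_LV D_BMw mon_BMw)

lemma LV_E: "a \<in> LV k \<Longrightarrow> a \<in> E" using supp_mono[OF BM_mons] by blast

lemma BMw_C: "a \<in> supp (BMw k w) \<Longrightarrow> a \<in> C k w"
  using supp_mono[of "BMw k w" "cell UG k w"] BM_mons by (auto simp: BMw_def BM_def cell_def)

definition proj :: "nat \<Rightarrow> 'v dbl gpoly \<Rightarrow> 'v dbl gpoly" where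
  "proj w = gextend (\<lambda>m. if weight m = w then mon m else 0)"

lemma glinear_proj: "glinear (proj w)" unfolding proj_def by (rule glinear_gextend)

lemma proj_mon: "proj w (mon m) = (if weight m = w then mon m else 0)" by (simp add: proj_def)

lemma proj_supp: "a \<in> supp X \<Longrightarrow> proj w a \<in> supp {m \<in> X. weight m = w}"
  by (rule glinear_suppI[OF glinear_proj]) (auto simp: proj_mon supp_0)

lemma proj_same: "a \<in> supp {m. weight m = w} \<Longrightarrow> proj w a = a"
  by (rule glinear_eqI[OF glinear_proj glinear_id]) (auto simp: proj_mon supp_def)

lemma proj_other: "a \<in> supp {m. weight m = v} \<Longrightarrow> v \<noteq> w \<Longrightarrow> proj w a = 0"
  by (rule glinear_eqI[OF glinear_proj glinear_zero]) (auto simp: proj_mon supp_def)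

lemma BMw_weight: "a \<in> supp (BMw k w) \<Longrightarrow> a \<in> supp {m. weight m = w}"
  using supp_mono[of "BMw k w" "{m. weight m = w}"] by (auto simp: BMw_def)

lemma proj_LV: "a \<in> LV k \<Longrightarrow> proj w a \<in> supp (BMw k w)"
  unfolding BMw_def by (rule proj_supp)

lemma D_proj:
  assumes "a \<in> LV k" shows "D (proj w a) = proj w (D a)"
proof (rule glinear_eqI[where a = a and f = "\<lambda>a. D (proj w a)"])
  show "glinear (\<lambda>a. D (proj w a))" "glinear (\<lambda>a. proj w (D a))"
    by (rule glinear_compose[OF glinear_proj glinear_D] glinear_compose[OF glinear_D glinear_proj])+
  fix m assume "m \<in> keys a"
  hence "D (mon m) \<in> supp {m'. weight m' = weight m}" using assms BMw_weight[OF D_BMw[OF mon_BMw]] by (auto simp: supp_def)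
  thus "D (proj w (mon m)) = proj w (D (mon m))"
    by (cases "weight m = w") (auto simp: proj_mon proj_same proj_other glinear_0[OF glinear_D])
qed

lemma sum_proj:
  assumes "a \<in> LV k" shows "a = (\<Sum>w\<le>k * maxw. proj w a)"
proof (rule glinear_eqI[where a = a and f = "\<lambda>a. a" and g = "\<lambda>a. \<Sum>w\<le>k * maxw. proj w a"])
  show "glinear (\<lambda>a. \<Sum>w\<le>k * maxw. proj w a)" by (intro glinear_setsum glinear_proj)
  fix m assume "m \<in> keys a"
  hence "weight m \<le> k * maxw" using assms weight_BM by (auto simp: supp_def)
  thus "mon m = (\<Sum>w\<le>k * maxw. proj w (mon m))" by (simp add: proj_mon)
qed (rule glinear_id)

subsection \<open>Extension of scalars to the closure\<close>

text \<open>
  The \<open>A\<close>-linear extension of a linear map on \<open>\<Lambda>V\<close>.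
\<close>

definition ext :: "('v dbl gpoly \<Rightarrow> 'v dbl gpoly) \<Rightarrow> 'v dbl gpoly \<Rightarrow> 'v dbl gpoly" where
  "ext g = gextend (\<lambda>m. g (mon (base_part m)) \<star> mon (bar_part m))"

lemma glinear_ext: "glinear (ext g)" unfolding ext_def by (rule glinear_gextend)

lemma ext_mon: "ext g (mon m) = g (mon (base_part m)) \<star> mon (bar_part m)" by (simp add: ext_def)

lemma ext_mult:
  assumes "glinear g" "c \<in> supp (mons (Base ` G))" "a \<in> AM"
  shows "ext g (c \<star> mon a) = g c \<star> mon a"
proof (rule glinear_eqI[where a = c and f = "\<lambda>c. ext g (c \<star> mon a)"])
  show "glinear (\<lambda>c. ext g (c \<star> mon a))" by (rule glinear_compose[OF glinear_mult_left glinear_ext])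
  show "glinear (\<lambda>c. g c \<star> mon a)" by (rule glinear_compose[OF assms(1) glinear_mult_left])
  fix m assume "m \<in> keys c"
  hence m: "m \<in> mons (Base ` G)" using assms(2) by (auto simp: supp_def)
  moreover have "base_part m = m" "bar_part m = {#}" using base_part_base[of m] m by (auto simp: mons_def)
  ultimately show "ext g (mon m \<star> mon a) = g (mon m) \<star> mon a"
    using AM_base_part[OF assms(3)] by (simp add: mon_split[OF _ assms(3)] ext_mon)
qed

lemma LV_base: "a \<in> LV k \<Longrightarrow> a \<in> supp (mons (Base ` G))"
  using supp_mono[of "BM k" "mons (Base ` G)"] by (auto simp: BM_def)

lemma ext_comp:
  assumes "glinear g'" "a \<in> C k n" "\<And>m. m \<in> BM k \<Longrightarrow> g (mon m) \<in> supp (mons (Base ` G))"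
  shows "ext g' (ext g a) = ext (\<lambda>c. g' (g c)) a"
proof (rule glinear_eqI[where a = a and f = "\<lambda>a. ext g' (ext g a)"])
  fix m assume "m \<in> keys a"
  hence m: "m \<in> cell UG k n" using assms(2) by (auto simp: supp_def)
  hence "bar_part m \<in> AM" using mons_base_part by (auto simp: cell_def)
  thus "ext g' (ext g (mon m)) = ext (\<lambda>c. g' (g c)) (mon m)"
    unfolding ext_mon by (intro ext_mult assms(1) assms(3) cell_base_part[OF m])
qed (rule glinear_compose[OF glinear_ext glinear_ext] glinear_ext)+

lemma ext_id: "a \<in> E \<Longrightarrow> ext (\<lambda>c. c) a = a"
  by (rule glinear_eqI[OF glinear_ext glinear_id]) (auto simp: ext_mon mon_base_part_bar_part supp_def)

lemma ext_LV: "a \<in> LV k \<Longrightarrow> glinear g \<Longrightarrow> ext g a = g a"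
  using ext_mult[of g a "{#}"] LV_base by simp

lemma ext_diff: "ext (\<lambda>c. g c - g' c) a = ext g a - ext g' a"
  by (rule glinear_eqI[OF glinear_ext glinear_minus[OF glinear_ext glinear_ext]]) (simp add: ext_mon mult_diff_left)

text \<open>The span \<open>S \<otimes> A\<close> for a set \<open>S\<close> of base monomials, in a given weight.\<close>

definition tensor_bar :: "'v dbl multiset set \<Rightarrow> nat \<Rightarrow> 'v dbl multiset set" where
  "tensor_bar S n = {m + a | m a. m \<in> S \<and> a \<in> AM \<and> weight m + weight a = n}"

lemma cell_eq_tensor_bar: "cell UG k n = tensor_bar (BM k) n"
proof
  show "cell UG k n \<subseteq> tensor_bar (BM k) n"
  proof
    fix m assume m: "m \<in> cell UG k n"
    have "base_part m \<in> BM k" "bar_part m \<in> AM" "m = base_part m + bar_part m" "weight (base_part m) + weight (bar_part m) = n"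
      using cell_base_part[OF m] m mons_base_part weight_simps(2)[of "base_part m" "bar_part m"] by (auto simp: cell_def base_part_bar_part)
    thus "m \<in> tensor_bar (BM k) n" unfolding tensor_bar_def by blast
  qed
  show "tensor_bar (BM k) n \<subseteq> cell UG k n" using add_cell by (auto simp: tensor_bar_def)
qed

lemma tensor_bar_mono: "S \<subseteq> T \<Longrightarrow> tensor_bar S n \<subseteq> tensor_bar T n" by (auto simp: tensor_bar_def)

lemma tensor_bar_C: "S \<subseteq> BM k \<Longrightarrow> a \<in> supp (tensor_bar S n) \<Longrightarrow> a \<in> C k n"
  using supp_mono[OF tensor_bar_mono[of S "BM k" n]] cell_eq_tensor_bar by auto

lemma card_tensor_bar:
  assumes S: "S \<subseteq> BM k" shows "card (tensor_bar S n) = (\<Sum>m\<in>S. shift bar_count (weight m) n)"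
proof -
  let ?F = "\<lambda>m. if weight m \<le> n then (\<lambda>a. m + a) ` wmons (Bar ` G) (n - weight m) else {}"
  have fS: "finite S" using S finite_BM finite_subset by blast
  have barUG: "Bar ` G \<subseteq> UG" by (auto simp: gens_def)
  have e: "tensor_bar S n = (\<Union>m\<in>S. ?F m)" by (force simp: tensor_bar_def wmons_def)
  have dis: "?F m \<inter> ?F m' = {}" if "m \<in> S" "m' \<in> S" "m \<noteq> m'" for m m'
  proof -
    have "x = m'" if "x \<in> S" "a \<in> AM" "a' \<in> AM" "x + a = m' + a'" for x a a'
    proof -
      have "base_part (x + a) = base_part (m' + a')" using that by simp
      moreover have "base_part x = x" "base_part m' = m'" using BM_base_part that(1) \<open>m' \<in> S\<close> S by blast+
      moreover have "base_part a = {#}" "base_part a' = {#}" using AM_base_part that by blast+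
      ultimately show ?thesis by simp
    qed
    note eq = this
    show ?thesis
    proof (rule equals0I)
      fix z assume "z \<in> ?F m \<inter> ?F m'"
      hence "z \<in> ?F m" "z \<in> ?F m'" by blast+
      hence "\<exists>a\<in>AM. z = m + a" "\<exists>a\<in>AM. z = m' + a"
        by (auto simp: wmons_def split: if_splits)
      thus False using eq[of m] that by auto
    qed
  qed
  have "card (tensor_bar S n) = (\<Sum>m\<in>S. card (?F m))"
    unfolding e using dis finite_wmons[OF barUG] by (intro card_UN_disjoint fS) auto
  also have "\<dots> = (\<Sum>m\<in>S. shift bar_count (weight m) n)"
    by (intro sum.cong refl) (auto simp: shift_def bar_count_def card_image)
  finally show ?thesis .
qed

lemma ext_tensor_bar:
  assumes "a \<in> C k n" "\<And>m. m \<in> BM k \<Longrightarrow> g (mon m) \<in> supp {m' \<in> S. weight m' = weight m}" "S \<subseteq> mons (Base ` G)"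
  shows "ext g a \<in> supp (tensor_bar S n)"
proof (rule glinear_suppI[OF glinear_ext _ assms(1)])
  fix m assume m: "m \<in> cell UG k n"
  hence am: "bar_part m \<in> AM" using mons_base_part by (auto simp: cell_def)
  have w: "weight (base_part m) + weight (bar_part m) = n" using m weight_simps(2)[of "base_part m" "bar_part m"] by (auto simp: cell_def base_part_bar_part)
  show "ext g (mon m) \<in> supp (tensor_bar S n)" unfolding ext_mon
  proof (rule supp_mult[OF assms(2)[OF cell_base_part[OF m]], where B = "{bar_part m}"])
    fix h a assume "h \<in> {m' \<in> S. weight m' = weight (base_part m)}" "a \<in> {bar_part m}"
    thus "h + a \<in> tensor_bar S n" unfolding tensor_bar_def using am w
      by (intro CollectI exI[of _ h] exI[of _ "bar_part m"]) auto
  qed simp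
qed

definition base_weight :: "'v dbl multiset \<Rightarrow> nat" where "base_weight m = weight (base_part m)"

lemma ext_base_weight:
  assumes "a \<in> supp {m \<in> cell UG k n. i \<le> base_weight m}"
    and "\<And>m. m \<in> BM k \<Longrightarrow> g (mon m) \<in> supp (BMw l (weight m))"
  shows "ext g a \<in> supp {m \<in> cell UG l n. i \<le> base_weight m}"
proof (rule glinear_suppI[OF glinear_ext _ assms(1)])
  fix m assume "m \<in> {m \<in> cell UG k n. i \<le> base_weight m}"
  hence m: "m \<in> cell UG k n" "i \<le> weight (base_part m)" by (auto simp: base_weight_def)
  hence am: "bar_part m \<in> AM" using mons_base_part by (auto simp: cell_def)
  have w: "weight (base_part m) + weight (bar_part m) = n" using m weight_simps(2)[of "base_part m" "bar_part m"] by (auto simp: cell_def base_part_bar_part)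
  show "ext g (mon m) \<in> supp {m \<in> cell UG l n. i \<le> base_weight m}" unfolding ext_mon
  proof (rule supp_mult[OF assms(2)[OF cell_base_part[OF m(1)]], where B = "{bar_part m}"])
    fix h a assume h: "h \<in> BMw l (weight (base_part m))" "a \<in> {bar_part m}"
    have hb: "h \<in> BM l" "weight h = weight (base_part m)" using h(1) by (auto simp: BMw_def)
    have "base_weight (h + a) = weight h" using BM_base_part[OF hb(1)] AM_base_part[OF am] h(2) by (simp add: base_weight_def)
    thus "h + a \<in> {m \<in> cell UG l n. i \<le> base_weight m}" using add_cell[OF hb(1) am] h(2) w hb(2) m(2) by simp
  qed simp
qed

subsection \<open>The perturbation\<close>

text \<open>
  The part of \<open>D\<close> that differentiates \<open>A\<close>. It takes \<open>sv\<close> to an element of \<open>V \<otimes> A\<close>, so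
  it moves weight from \<open>A\<close> to \<open>V\<close>, and on \<open>\<Lambda>\<^sup>kV\<close> the weight is bounded. This makes the series below finite.
\<close>

definition perturbation :: "'v dbl gpoly \<Rightarrow> 'v dbl gpoly" where "perturbation a = D a - ext D a"

lemma glinear_perturbation: "glinear perturbation" unfolding perturbation_def by (intro glinear_minus glinear_D glinear_ext)

lemma perturbation_base_weight:
  assumes "a \<in> supp {m \<in> cell UG k n. i \<le> base_weight m}"
  shows "perturbation a \<in> supp {m \<in> cell UG (Suc k) n. Suc i \<le> base_weight m}"
proof (rule glinear_suppI[OF glinear_perturbation _ assms])
  fix m assume "m \<in> {m \<in> cell UG k n. i \<le> base_weight m}"
  hence m: "m \<in> cell UG k n" "i \<le> weight (base_part m)" "m \<in> mons UG" by (auto simp: base_weight_def cell_def)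
  have am: "bar_part m \<in> AM" "bar_part m \<in> cell UG 0 (weight (bar_part m))" and bm: "base_part m \<in> BM k" "base_part m \<in> mons UG"
    using mons_base_part[OF m(3)] cell_base_part[OF m(1)] BM_mons base_length_AM mons_mono[of "Bar ` G" UG]
    by (auto simp: cell_def gens_def)
  have w: "weight (base_part m) + weight (bar_part m) = n" using m weight_simps(2)[of "base_part m" "bar_part m"] by (auto simp: cell_def base_part_bar_part)
  obtain j where j: "base_part m \<in> parity_mons j" using bm(2) by (auto simp: mons_def parity_mons_def intro: that[of "odd_count (base_part m)"])
  have "D (mon (base_part m) \<star> mon (bar_part m)) = D (mon (base_part m)) \<star> mon (bar_part m)
      + gpoly_scale ((-1) ^ j) (mon (base_part m) \<star> D (mon (bar_part m)))"
    unfolding D_def using j bm am by (intro der_mult[OF diff_gens_odd(1)]) (auto simp: cell_def)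
  hence e: "perturbation (mon m) = gpoly_scale ((-1) ^ j) (mon (base_part m) \<star> D (mon (bar_part m)))"
    by (simp add: perturbation_def ext_mon mon_base_part_bar_part[OF m(3)])
  have D1: "D (mon (bar_part m)) \<in> C 1 (weight (bar_part m))" using D_C[of "mon (bar_part m)" 0] am(2) by simp
  have "mon (base_part m) \<star> D (mon (bar_part m)) \<in> supp {m \<in> cell UG (Suc k) n. Suc i \<le> base_weight m}"
  proof (rule supp_mult[OF _ D1, where A = "{base_part m}"])
    fix b h assume a: "b \<in> {base_part m}" "h \<in> cell UG 1 (weight (bar_part m))" "\<not> common_odd b h"
    have "b \<in> cell UG k (weight (base_part m))" using a(1) bm by (auto simp: cell_def BM_def)
    hence c: "b + h \<in> cell UG (Suc k) n" using a valid_add[of b h] w by (auto simp: cell_def mons_def)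
    have "base_part h \<noteq> {#}" using cell_base_part[OF a(2)] by (auto simp: BM_def)
    then obtain x r where x: "base_part h = add_mset x r" by (meson multiset_cases)
    have "x \<in># h" using x by (metis base_part_def multiset_filter_subset mset_subset_eqD union_single_eq_member)
    hence "1 \<le> gen_weight x" using a(2) gen_weight_pos by (auto simp: cell_def mons_def)
    hence "1 \<le> weight (base_part h)" using x by simp
    thus "b + h \<in> {m \<in> cell UG (Suc k) n. Suc i \<le> base_weight m}" using c a(1) m(2) BM_base_part[OF bm(1)] by (simp add: base_weight_def)
  qed simp
  thus "perturbation (mon m) \<in> supp {m \<in> cell UG (Suc k) n. Suc i \<le> base_weight m}" unfolding e by (rule supp_scale)
qed

lemma perturbation_LV: "a \<in> LV k \<Longrightarrow> perturbation a = 0"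
  unfolding perturbation_def using ext_LV[OF _ glinear_D] by simp

lemma base_weight_le: "m \<in> cell UG k n \<Longrightarrow> base_weight m \<le> k * maxw"
  using weight_BM[OF cell_base_part] by (simp add: base_weight_def)

subsection \<open>Complements of the cocycles\<close>

text \<open>
  The complement \<open>S\<^sub>k\<close> of the cocycles in \<open>\<Lambda>\<^sup>kV\<close> is spanned by monomials, so that the dimensions of \<open>S\<^sub>k \<otimes> A\<close> are
  obtained by counting.
\<close>

definition section_mons :: "nat \<Rightarrow> 'v dbl multiset set" where
  "section_mons k = (SOME S. S \<subseteq> BM k \<and> (\<forall>s\<in>supp S. D s = 0 \<longrightarrow> s = 0) \<and> D ` LV k \<subseteq> D ` supp S)"

lemma section_mons: "section_mons k \<subseteq> BM k" "\<And>s. s \<in> supp (section_mons k) \<Longrightarrow> D s = 0 \<Longrightarrow> s = 0" "D ` LV k \<subseteq> D ` supp (section_mons k)"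
proof -
  have "\<exists>S. S \<subseteq> BM k \<and> (\<forall>s\<in>supp S. D s = 0 \<longrightarrow> s = 0) \<and> D ` LV k \<subseteq> D ` supp S"
    using exists_monomial_section[OF finite_BM glinear_D, of k] by blast
  hence "section_mons k \<subseteq> BM k \<and> (\<forall>s\<in>supp (section_mons k). D s = 0 \<longrightarrow> s = 0) \<and> D ` LV k \<subseteq> D ` supp (section_mons k)"
    unfolding section_mons_def by (rule someI_ex)
  thus "section_mons k \<subseteq> BM k" "\<And>s. s \<in> supp (section_mons k) \<Longrightarrow> D s = 0 \<Longrightarrow> s = 0" "D ` LV k \<subseteq> D ` supp (section_mons k)" by blast+
qed

lemma section_mons_LV: "s \<in> supp (section_mons k) \<Longrightarrow> s \<in> LV k" using supp_mono[OF section_mons(1)] by blast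

text \<open>
  A left inverse of \<open>d\<close> on \<open>S\<^sub>k\<close> that preserves weights.
\<close>

definition splitting :: "nat \<Rightarrow> ('v dbl gpoly \<Rightarrow> 'v dbl gpoly) \<Rightarrow> bool" where
  "splitting k h \<longleftrightarrow> glinear h \<and> (\<forall>m. h (mon m) \<in> supp {m' \<in> section_mons k. weight m' = weight m}) \<and>
     (\<forall>s\<in>supp (section_mons k). h (D s) = s)"

text \<open>
  \<open>W\<close> is the subspace on which the splitting has to vanish. A left inverse exists modulo \<open>W\<close>; taking its
  component of weight \<open>weight m\<close> on each monomial \<open>m\<close> makes it preserve weights.
\<close>

lemma splitting_exists:
  assumes W: "gp.subspace W" "\<And>s. s \<in> supp (section_mons k) \<Longrightarrow> D s \<in> W \<Longrightarrow> s = 0"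
  shows "\<exists>h. splitting k h \<and> (\<forall>w. \<forall>a\<in>supp (BMw (Suc k) w) \<inter> W. h a = 0)"
proof -
  obtain q :: "'v dbl gpoly \<Rightarrow> 'v dbl gpoly" where q: "glinear q" "\<And>x. q x = 0 \<longleftrightarrow> x \<in> W"
    using exists_kernel[OF W(1)] by blast
  have lin: "glinear (\<lambda>a. q (D a))" by (rule glinear_compose[OF glinear_D q(1)])
  have inj: "inj_on (\<lambda>a. q (D a)) (supp (section_mons k))"
    using gpp.linear_inj_on_iff_eq_0[OF lin subspace_supp] W(2) q(2) by blast
  obtain g :: "'v dbl gpoly \<Rightarrow> 'v dbl gpoly" where g: "g ` UNIV \<subseteq> supp (section_mons k)" "glinear g" "\<And>v. v \<in> supp (section_mons k) \<Longrightarrow> g (q (D v)) = v"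
    using gpp.linear_exists_left_inverse_on[OF lin subspace_supp inj] by blast
  define h where "h = gextend (\<lambda>m. proj (weight m) (g (q (mon m))))"
  have linh: "glinear h" unfolding h_def by (rule glinear_gextend)
  have hw: "h a = proj w (g (q a))" if "a \<in> supp {m. weight m = w}" for a w
  proof (rule glinear_eqI[OF linh])
    show "glinear (\<lambda>a. proj w (g (q a)))" by (intro glinear_compose[OF glinear_compose[OF q(1) g(2)] glinear_proj])
    fix m assume "m \<in> keys a"
    thus "h (mon m) = proj w (g (q (mon m)))" using that by (auto simp: h_def supp_def)
  qed
  have "h (mon m) \<in> supp {m' \<in> section_mons k. weight m' = weight m}" for m
    unfolding h_def gextend_mon by (rule proj_supp) (use g(1) in auto)
  moreover have "h (D s) = s" if s: "s \<in> supp (section_mons k)" for s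
  proof (rule glinear_eqI[where a = s and f = "\<lambda>s. h (D s)"])
    show "glinear (\<lambda>s. h (D s))" by (rule glinear_compose[OF glinear_D linh])
    fix m assume "m \<in> keys s"
    hence m: "m \<in> section_mons k" using s by (auto simp: supp_def)
    hence "D (mon m) \<in> supp {m'. weight m' = weight m}" using section_mons(1) BMw_weight[OF D_BMw[OF mon_BMw]] by blast
    thus "h (D (mon m)) = mon m" using hw g(3)[of "mon m"] m by (simp add: proj_mon)
  qed (rule glinear_id)
  moreover have "h a = 0" if "a \<in> supp (BMw (Suc k) w)" "a \<in> W" for a w
  proof -
    have "q a = 0" using q(2) that(2) by blast
    thus ?thesis using hw[OF BMw_weight[OF that(1)]] by (simp add: glinear_0[OF g(2)] glinear_0[OF glinear_proj])
  qed
  ultimately show ?thesis unfolding splitting_def using linh by blast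
qed

end

lemma alternating_telescope:
  fixes x :: "nat \<Rightarrow> 'v gpoly"
  shows "(\<Sum>i\<le>J. gpoly_scale ((-1) ^ i) (x i)) + (\<Sum>i\<le>J. gpoly_scale ((-1) ^ i) (x (Suc i)))
    = x 0 + gpoly_scale ((-1) ^ J) (x (Suc J))"
proof (induction J)
  case (Suc J)
  let ?p = "gpoly_scale ((-1) ^ J) (x (Suc J))"
  let ?q = "gpoly_scale ((-1) ^ Suc J) (x (Suc (Suc J)))"
  have "(\<Sum>i\<le>Suc J. gpoly_scale ((-1) ^ i) (x i)) + (\<Sum>i\<le>Suc J. gpoly_scale ((-1) ^ i) (x (Suc i)))
    = ((\<Sum>i\<le>J. gpoly_scale ((-1) ^ i) (x i)) + (\<Sum>i\<le>J. gpoly_scale ((-1) ^ i) (x (Suc i)))) + (- ?p) + ?q"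
    by (simp add: gp.scale_minus_left)
  also have "\<dots> = x 0 + ?q" unfolding Suc by simp
  finally show ?case .
qed simp

lemma zero_if_dim_0:
  assumes "gp.dim V = 0" "fin_dim V" "v \<in> V" shows "v = 0"
proof -
  obtain B where B: "B \<subseteq> V" "gp.independent B" "V \<subseteq> gp.span B" "card B = gp.dim V"
    using gp.basis_exists[of V] by metis
  have "finite B" using finite_independent assms(2) B by blast
  hence "B = {}" using B(4) assms(1) by simp
  thus ?thesis using B(3) assms(3) by auto
qed

context acyclic_closure begin

subsection \<open>Finite order\<close>

lemma central: "x \<in> even_bars \<Longrightarrow> c \<in> E \<Longrightarrow> c \<star> gen x = gen x \<star> c"
proof (rule glinear_eqI[OF glinear_mult_left glinear_mult_right])
  fix m assume x: "x \<in> even_bars" and "c \<in> E" "m \<in> keys c"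
  hence "valid m" by (auto simp: supp_def mons_def)
  hence "mon m \<in> supp (parity_mons (odd_count m))" by (simp add: parity_mons_def)
  moreover have "gen x \<in> supp (parity_mons 0)" using even_bars_even[OF x] by (simp add: parity_mons_def valid_add_mset)
  ultimately have "mon m \<star> gen x = gpoly_scale ((-1) ^ (odd_count m * 0)) (gen x \<star> mon m)" by (rule graded_commute)
  thus "mon m \<star> gen x = gen x \<star> mon m" by simp
qed

lemma gen_even_bars_mon: "x \<in> even_bars \<Longrightarrow> gen x \<star> mon m = mon (add_mset x m)"
  using even_bars_even by (simp add: gen_mult_mon koszul_gen)

lemma ext_E: "(\<And>m. m \<in> mons (Base ` G) \<Longrightarrow> g (mon m) \<in> E) \<Longrightarrow> b \<in> E \<Longrightarrow> ext g b \<in> E"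
proof (rule glinear_suppI[OF glinear_ext])
  fix m assume g: "\<And>m. m \<in> mons (Base ` G) \<Longrightarrow> g (mon m) \<in> E" and m: "m \<in> mons UG"
  have "bar_part m \<in> mons UG" using mons_base_part(2)[OF m] mons_mono[of "Bar ` G" UG] by (auto simp: gens_def)
  thus "ext g (mon m) \<in> E" unfolding ext_mon by (intro supp_mons_mult g mons_base_part m) simp
qed

lemma diff_order_ext:
  assumes "\<And>m. m \<in> mons (Base ` G) \<Longrightarrow> g (mon m) \<in> E" shows "diff_order 1 (ext g)"
proof -
  have "comm x (ext g) b = 0" if x: "x \<in> even_bars" and b: "b \<in> E" for x b
  proof (rule glinear_eqI[OF glinear_comm[OF glinear_ext] glinear_zero])
    fix m assume "m \<in> keys b"
    hence m: "m \<in> mons UG" using b by (auto simp: supp_def)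
    have xb: "x \<notin> range Base" using x by (auto simp: even_bars_def)
    have "base_part (add_mset x m) = base_part m" "bar_part (add_mset x m) = add_mset x (bar_part m)"
      using xb by (simp_all add: base_part_def bar_part_def)
    hence "ext g (gen x \<star> mon m) = g (mon (base_part m)) \<star> (gen x \<star> mon (bar_part m))"
      using gen_even_bars_mon[OF x] by (simp add: ext_mon)
    also have "\<dots> = gen x \<star> (g (mon (base_part m)) \<star> mon (bar_part m))"
      using central[OF x assms[OF mons_base_part(1)[OF m]]] by (simp flip: gmult_assoc)
    finally show "comm x (ext g) (mon m) = 0" by (simp add: comm_def ext_mon)
  qed
  thus ?thesis by simp
qed

text \<open>
  As \<open>x\<close> is even, the commutator of \<open>D\<close> with \<open>x\<close> is multiplication by \<open>D x\<close>, which is linear over the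
  polynomial algebra.
\<close>

lemma diff_order_D: "diff_order 2 D"
proof -
  have c1: "comm x D b = diff_on_gens \<psi> x \<star> b" if x: "x \<in> even_bars" and b: "b \<in> E" for x b
    using der_gen_mult[OF diff_gens_odd(1), of x b] even_bars_UG x supp_mons_valid[OF b] even_bars_even[OF x]
    by (auto simp: comm_def D_def)
  have "comm y (comm x D) b = 0" if "x \<in> even_bars" "y \<in> even_bars" "b \<in> E" for x y b
  proof -
    have "comm y (comm x D) b = diff_on_gens \<psi> x \<star> (gen y \<star> b) - gen y \<star> (diff_on_gens \<psi> x \<star> b)"
      unfolding comm_def[of y] using c1[OF that(1)] that gen_even_bars_E by simp
    also have "\<dots> = 0" using central[OF that(2) dgenE] that(1) even_bars_UG by (auto simp flip: gmult_assoc)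
    finally show ?thesis .
  qed
  thus ?thesis by (simp add: numeral_2_eq_2)
qed

definition finite_order :: "('v dbl gpoly \<Rightarrow> 'v dbl gpoly) \<Rightarrow> bool" where
  "finite_order f \<longleftrightarrow> glinear f \<and> (\<forall>b\<in>E. f b \<in> E) \<and> (\<exists>r. diff_order r f)"

lemma finite_order_comp: "finite_order f \<Longrightarrow> finite_order g \<Longrightarrow> finite_order (\<lambda>b. f (g b))"
  unfolding finite_order_def using diff_order_comp glinear_compose by metis

lemma finite_order_add: "finite_order f \<Longrightarrow> finite_order g \<Longrightarrow> finite_order (\<lambda>b. f b + g b)"
proof -
  assume f: "finite_order f" and g: "finite_order g"
  then obtain r s where "diff_order r f" "diff_order s g" by (auto simp: finite_order_def)
  hence "diff_order (max r s) f" "diff_order (max r s) g" by (auto intro: diff_order_le)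
  hence "diff_order (max r s) (\<lambda>b. f b + g b)" by (rule diff_order_add)
  thus ?thesis using f g by (auto simp: finite_order_def intro: glinear_plus supp_add)
qed

lemma finite_order_scale: "finite_order f \<Longrightarrow> finite_order (\<lambda>b. gpoly_scale c (f b))"
  unfolding finite_order_def using diff_order_scale glinear_scaled supp_scale by metis

lemma finite_order_zero: "finite_order (\<lambda>b. 0)"
  unfolding finite_order_def using diff_order_zero glinear_zero supp_0 by blast

lemma finite_order_id: "finite_order (\<lambda>b. b)"
proof -
  have "diff_order 1 (\<lambda>b. b)" by (simp add: comm_def)
  thus ?thesis unfolding finite_order_def using glinear_id by blast
qed

lemma finite_order_sum: "finite I \<Longrightarrow> (\<And>i. i \<in> I \<Longrightarrow> finite_order (f i)) \<Longrightarrow> finite_order (\<lambda>b. \<Sum>i\<in>I. f i b)"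
  by (induction I rule: finite_induct) (auto intro: finite_order_zero finite_order_add)

lemma finite_order_D: "finite_order D" unfolding finite_order_def using glinear_D D_E diff_order_D by blast

lemma finite_order_ext: "(\<And>m. m \<in> mons (Base ` G) \<Longrightarrow> g (mon m) \<in> E) \<Longrightarrow> finite_order (ext g)"
  unfolding finite_order_def using glinear_ext ext_E diff_order_ext by blast

lemma base_E: "m \<in> mons (Base ` G) \<Longrightarrow> mon m \<in> E"
  using mons_mono[OF base_UG] by auto

section \<open>The projection along the complements\<close>

text \<open>
  With \<open>\<delta>\<close> the perturbation and \<open>h\<close> a splitting, \<open>N = h\<delta>\<close> is nilpotent and \<open>T = (1 + N)\<^sup>-\<^sup>1 h\<close>. On
  \<open>S\<^sub>k \<otimes> A\<close> we have \<open>h D = 1 + N\<close>, so \<open>T\<close> is a left inverse of \<open>D\<close> there, and \<open>Q = 1 - D T\<close> is a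
  projection with kernel \<open>D(S\<^sub>k \<otimes> A)\<close>. The series for \<open>T\<close> has a length that depends only on \<open>k\<close>, so \<open>T\<close> and \<open>Q\<close>
  are again differential operators.
\<close>

definition N :: "('v dbl gpoly \<Rightarrow> 'v dbl gpoly) \<Rightarrow> 'v dbl gpoly \<Rightarrow> 'v dbl gpoly" where
  "N h a = ext h (perturbation a)"

definition T :: "nat \<Rightarrow> ('v dbl gpoly \<Rightarrow> 'v dbl gpoly) \<Rightarrow> 'v dbl gpoly \<Rightarrow> 'v dbl gpoly" where
  "T k h c = (\<Sum>i\<le>k * maxw. gpoly_scale ((-1) ^ i) ((N h ^^ i) (ext h c)))"

definition Q :: "nat \<Rightarrow> ('v dbl gpoly \<Rightarrow> 'v dbl gpoly) \<Rightarrow> 'v dbl gpoly \<Rightarrow> 'v dbl gpoly" where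
  "Q k h c = c - D (T k h c)"

lemma glinear_N: "glinear (N h)" unfolding N_def by (rule glinear_compose[OF glinear_perturbation glinear_ext])

lemma glinear_N_pow: "glinear (N h ^^ i)"
proof (induction i)
  case 0 thus ?case using glinear_id by (simp add: id_def)
next
  case (Suc i) thus ?case using glinear_compose[OF Suc glinear_N] by (simp add: o_def)
qed

lemma glinear_T: "glinear (T k h)"
  unfolding T_def by (intro glinear_setsum glinear_scaled glinear_compose[OF glinear_ext glinear_N_pow])

lemma glinear_Q: "glinear (Q k h)"
  unfolding Q_def by (intro glinear_minus glinear_id glinear_compose[OF glinear_T glinear_D])

lemma section_mons_mons: "section_mons k \<subseteq> mons (Base ` G)" using section_mons(1) by (auto simp: BM_def)

context
  fixes k h assumes h: "splitting k h"
begin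

lemma h_lin: "glinear h" and h_mon: "h (mon m) \<in> supp {m' \<in> section_mons k. weight m' = weight m}"
  and h_D: "s \<in> supp (section_mons k) \<Longrightarrow> h (D s) = s"
  using h by (auto simp: splitting_def)

lemma h_BMw: "h (mon m) \<in> supp (BMw k (weight m))"
  using h_mon[of m] supp_mono[of "{m' \<in> section_mons k. weight m' = weight m}" "BMw k (weight m)"] section_mons(1) by (auto simp: BMw_def)

lemma h_base: "h (mon m) \<in> supp (mons (Base ` G))"
  using LV_base[OF BMw_LV[OF h_BMw]] .

lemma h_LV: "h c \<in> LV k"
proof -
  have "h c \<in> supp (BM k)" if "c \<in> supp UNIV"
    by (rule glinear_suppI[OF h_lin _ that]) (rule BMw_LV[OF h_BMw])
  thus ?thesis by (simp add: supp_def)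
qed

abbreviation "SA n \<equiv> supp (tensor_bar (section_mons k) n)"

lemma SA_C: "s \<in> SA n \<Longrightarrow> s \<in> C k n" by (rule tensor_bar_C[OF section_mons(1)])

lemma ext_h_SA: "c \<in> C (Suc k) n \<Longrightarrow> ext h c \<in> SA n"
  by (rule ext_tensor_bar[OF _ _ section_mons_mons]) (auto intro: h_mon)

lemma perturbation_C: "c \<in> C k n \<Longrightarrow> perturbation c \<in> C (Suc k) n"
  using perturbation_base_weight[of c k n 0] supp_mono[of "{m \<in> cell UG (Suc k) n. Suc 0 \<le> base_weight m}" "cell UG (Suc k) n"] by auto

lemma N_SA: "c \<in> C k n \<Longrightarrow> N h c \<in> SA n"
  unfolding N_def by (intro ext_h_SA perturbation_C)

lemma N_pow_base_weight: "c \<in> C k n \<Longrightarrow> (N h ^^ i) c \<in> supp {m \<in> cell UG k n. i \<le> base_weight m}"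
proof (induction i)
  case (Suc i)
  hence "perturbation ((N h ^^ i) c) \<in> supp {m \<in> cell UG (Suc k) n. Suc i \<le> base_weight m}" by (intro perturbation_base_weight) simp
  hence "ext h (perturbation ((N h ^^ i) c)) \<in> supp {m \<in> cell UG k n. Suc i \<le> base_weight m}"
    by (rule ext_base_weight) (rule h_BMw)
  moreover have "(N h ^^ Suc i) c = ext h (perturbation ((N h ^^ i) c))" by (simp add: N_def[of h "(N h ^^ i) c"])
  ultimately show ?case by metis
qed simp

lemma N_pow_SA: "s \<in> SA n \<Longrightarrow> (N h ^^ i) s \<in> SA n"
  by (induction i) (auto intro: N_SA SA_C)

lemma N_nilpotent: "c \<in> C k n \<Longrightarrow> (N h ^^ Suc (k * maxw)) c = 0"
proof -
  assume c: "c \<in> C k n"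
  have e: "{m \<in> cell UG k n. Suc (k * maxw) \<le> base_weight m} = {}" using base_weight_le by fastforce
  show ?thesis using N_pow_base_weight[OF c, of "Suc (k * maxw)"] unfolding e supp_def by simp
qed

lemma T_SA: "c \<in> C (Suc k) n \<Longrightarrow> T k h c \<in> SA n"
  unfolding T_def by (intro supp_sum supp_scale N_pow_SA ext_h_SA)

lemma T_eq:
  assumes c: "c \<in> C (Suc k) n" shows "T k h c + N h (T k h c) = ext h c"
proof -
  have 1: "N h (T k h c) = (\<Sum>i\<le>k * maxw. gpoly_scale ((-1) ^ i) ((N h ^^ Suc i) (ext h c)))"
    unfolding T_def by (simp add: glinear_sum[OF glinear_N] glinear_scale[OF glinear_N])
  have "T k h c + N h (T k h c) = (N h ^^ 0) (ext h c) + gpoly_scale ((-1) ^ (k * maxw)) ((N h ^^ Suc (k * maxw)) (ext h c))"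
    unfolding 1 unfolding T_def by (rule alternating_telescope)
  thus ?thesis using N_nilpotent[OF SA_C[OF ext_h_SA[OF c]]] by simp
qed

lemma ext_h_D:
  assumes s: "s \<in> SA n" shows "ext h (ext D s) = s"
proof (rule glinear_eqI[where a = s and f = "\<lambda>s. ext h (ext D s)"])
  fix m assume "m \<in> keys s"
  hence m: "m \<in> tensor_bar (section_mons k) n" using s by (auto simp: supp_def)
  hence mc: "m \<in> cell UG k n" using cell_eq_tensor_bar tensor_bar_mono[OF section_mons(1)] by blast
  obtain u a where ua: "m = u + a" "u \<in> section_mons k" "a \<in> AM" using m by (auto simp: tensor_bar_def)
  have "base_part m = u" using ua BM_base_part[of u k] AM_base_part[of a] section_mons(1) by auto
  hence b: "base_part m \<in> section_mons k" using ua by simp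
  have am: "bar_part m \<in> AM" using mc mons_base_part by (auto simp: cell_def)
  have "ext h (ext D (mon m)) = h (D (mon (base_part m))) \<star> mon (bar_part m)"
    unfolding ext_mon by (rule ext_mult[OF h_lin _ am]) (rule LV_base[OF D_LV], use b section_mons(1) in auto)
  also have "\<dots> = mon m" using h_D[of "mon (base_part m)"] b mon_base_part_bar_part mc by (simp add: cell_def)
  finally show "ext h (ext D (mon m)) = mon m" .
qed (rule glinear_compose[OF glinear_ext glinear_ext] glinear_id)+

lemma T_D:
  assumes s: "s \<in> SA n" shows "T k h (D s) = s"
proof -
  have "ext h (D s) = s + N h s"
    unfolding N_def perturbation_def glinear_diff[OF glinear_ext] ext_h_D[OF s] by simp
  hence "T k h (D s) = (\<Sum>i\<le>k * maxw. gpoly_scale ((-1) ^ i) ((N h ^^ i) s))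
      + (\<Sum>i\<le>k * maxw. gpoly_scale ((-1) ^ i) ((N h ^^ Suc i) s))"
    unfolding T_def by (simp add: glinear_add[OF glinear_N_pow] gp.scale_right_distrib sum.distrib funpow_swap1)
  also have "\<dots> = s + gpoly_scale ((-1) ^ (k * maxw)) ((N h ^^ Suc (k * maxw)) s)"
    using alternating_telescope[of "\<lambda>i. (N h ^^ i) s" "k * maxw"] by simp
  also have "\<dots> = s" using N_nilpotent[OF SA_C[OF s]] by simp
  finally show ?thesis .
qed

lemma Q_D: "s \<in> SA n \<Longrightarrow> Q k h (D s) = 0"
  by (simp add: Q_def T_D)

lemma Q_C: "c \<in> C (Suc k) n \<Longrightarrow> Q k h c \<in> C (Suc k) n"
  unfolding Q_def by (intro supp_diff D_C SA_C T_SA)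

text \<open>
  This identifies the image of \<open>Q\<close> with the kernel of \<open>h\<close>, which for a suitable \<open>h\<close> is spanned over \<open>A\<close> by
  \<open>S\<^sub>k\<^sub>+\<^sub>1\<close> and by cocycles representing a basis of \<open>H\<^sub>k\<^sub>+\<^sub>1\<close>.
\<close>

lemma ext_h_Q: "c \<in> C (Suc k) n \<Longrightarrow> ext h (Q k h c) = 0"
proof -
  assume c: "c \<in> C (Suc k) n"
  have "ext h (D (T k h c)) = T k h c + N h (T k h c)"
    unfolding N_def perturbation_def glinear_diff[OF glinear_ext] ext_h_D[OF T_SA[OF c]] by simp
  thus ?thesis unfolding Q_def glinear_diff[OF glinear_ext] T_eq[OF c] by simp
qed

lemma N_LV: "c \<in> LV k \<Longrightarrow> N h c = 0"
  by (simp add: N_def perturbation_LV glinear_0[OF glinear_ext])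

text \<open>
  On elements without a factor from \<open>A\<close> the perturbation vanishes. This is what brings a statement about \<open>Q D\<close>
  back to \<open>\<Lambda>V\<close>: a cocycle \<open>c\<close> of \<open>\<Lambda>V\<close> with \<open>Q c = 0\<close> is the coboundary of \<open>h c\<close>, see \<open>Q_LV\<close>.
\<close>

lemma T_LV: "c \<in> LV (Suc k) \<Longrightarrow> T k h c = h c"
proof -
  assume c: "c \<in> LV (Suc k)"
  have z: "(N h ^^ Suc i) (h c) = 0" for i
    by (induction i) (simp_all add: N_LV[OF h_LV] glinear_0[OF glinear_N])
  have "(\<Sum>i\<in>{..k * maxw}. gpoly_scale ((-1) ^ i) ((N h ^^ i) (h c))) = (\<Sum>i\<in>{0}. gpoly_scale ((-1) ^ i) ((N h ^^ i) (h c)))"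
  proof (rule sum.mono_neutral_right)
    show "\<forall>i\<in>{..k * maxw} - {0}. gpoly_scale ((- 1) ^ i) ((N h ^^ i) (h c)) = 0"
    proof
      fix i assume "i \<in> {..k * maxw} - {0}"
      then obtain j where "i = Suc j" by (cases i) auto
      thus "gpoly_scale ((- 1) ^ i) ((N h ^^ i) (h c)) = 0" using z by simp
    qed
  qed auto
  thus ?thesis unfolding T_def ext_LV[OF c h_lin] by simp
qed

lemma Q_LV: "c \<in> LV (Suc k) \<Longrightarrow> Q k h c = c - D (h c)"
  by (simp add: Q_def T_LV)

lemma finite_order_N: "finite_order (N h)"
proof -
  have 1: "finite_order (ext h)" by (rule finite_order_ext) (rule LV_E[OF h_LV])
  have "finite_order (ext D)" by (rule finite_order_ext) (intro D_E base_E)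
  hence "finite_order (\<lambda>b. D b + gpoly_scale (-1) (ext D b))" by (intro finite_order_add finite_order_scale finite_order_D)
  hence "finite_order perturbation" by (simp add: perturbation_def[abs_def] gp.scale_minus_left)
  thus ?thesis unfolding N_def[abs_def] by (rule finite_order_comp[OF 1])
qed

lemma finite_order_N_pow: "finite_order (N h ^^ i)"
proof (induction i)
  case 0 thus ?case using finite_order_id by (simp add: id_def)
next
  case (Suc i) thus ?case using finite_order_comp[OF finite_order_N Suc] by (simp add: o_def)
qed

lemma finite_order_T: "finite_order (T k h)"
  unfolding T_def[abs_def]
  by (intro finite_order_sum finite_order_scale finite_order_comp[OF finite_order_N_pow] finite_order_ext LV_E[OF h_LV]) simp

lemma finite_order_QD: "finite_order (\<lambda>c. Q k h (D c))"
proof -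
  have "finite_order (\<lambda>c. c + gpoly_scale (-1) (D (T k h c)))"
    by (intro finite_order_add finite_order_scale finite_order_id finite_order_comp[OF finite_order_D finite_order_T])
  hence "finite_order (Q k h)" by (simp add: Q_def[abs_def] gp.scale_minus_left)
  thus ?thesis by (rule finite_order_comp[OF _ finite_order_D])
qed

subsection \<open>Dimensions\<close>

text \<open>
  The kernel of \<open>Q\<close> on the image of \<open>D\<close> is \<open>D(S\<^sub>k \<otimes> A)\<close>, and \<open>D\<close> is injective on \<open>S\<^sub>k \<otimes> A\<close>.
\<close>

lemma image_dim_D_split:
  "image_dim D k n = card (tensor_bar (section_mons k) n) + image_dim (\<lambda>c. Q k h (D c)) k n"
proof -
  let ?V = "D ` C k n"
  have sV: "gp.subspace ?V" "fin_dim ?V" using subspace_im[OF glinear_D] fin_dim_im[OF glinear_D] by blast+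
  have ker: "{v \<in> ?V. Q k h v = 0} = D ` SA n"
  proof
    show "D ` SA n \<subseteq> {v \<in> ?V. Q k h v = 0}" using SA_C Q_D by auto
    show "{v \<in> ?V. Q k h v = 0} \<subseteq> D ` SA n"
    proof
      fix v assume "v \<in> {v \<in> ?V. Q k h v = 0}"
      then obtain c where c: "c \<in> C k n" "v = D c" "Q k h v = 0" by auto
      hence "v = D (T k h v)" by (simp add: Q_def)
      moreover have "T k h v \<in> SA n" using c D_C T_SA by blast
      ultimately show "v \<in> D ` SA n" by blast
    qed
  qed
  have fS: "fin_dim (SA n)"
    by (rule fin_dim_subset[OF fin_dim_C]) (use SA_C in blast)
  have "{s \<in> SA n. D s = 0} = {0}"
  proof -
    have "s = 0" if "s \<in> SA n" "D s = 0" for s using T_D[OF that(1)] that(2) by (simp add: glinear_0[OF glinear_T])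
    thus ?thesis by (auto simp: supp_0 glinear_0[OF glinear_D])
  qed
  moreover have "gp.dim {0 :: 'v dbl gpoly} = 0" using gp.dim_le_card[of "{0}" "{}"] by simp
  ultimately have "gp.dim (D ` SA n) = gp.dim (SA n)"
    using rank_nullity[OF subspace_supp fS glinear_D] by simp
  moreover have "Q k h ` ?V = (\<lambda>c. Q k h (D c)) ` C k n" by auto
  ultimately show ?thesis
    using rank_nullity[OF sV glinear_Q, of k h] unfolding image_dim_def ker by (simp add: dim_supp)
qed

end

definition cocycle_dim :: "nat \<Rightarrow> nat \<Rightarrow> nat" where "cocycle_dim k n = gp.dim {z \<in> C k n. D z = 0}"

lemma image_dim_D: "image_dim D k n = cocycle_dim (Suc k) n"
proof -
  have "D ` C k n = {z \<in> C (Suc k) n. D z = 0}"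
    using D_C D_squared[OF CE] exact by (auto simp: image_iff) metis
  thus ?thesis by (simp add: image_dim_def cocycle_dim_def)
qed

text \<open>
  By exactness the cocycles of length \<open>k + 1\<close> are the image of \<open>\<Lambda>\<^sup>kV \<otimes> A\<close>.
\<close>

lemma cell_count_eq: "cell_count k n = cocycle_dim (Suc k) n + cocycle_dim k n"
  using rank_nullity[OF subspace_supp fin_dim_C glinear_D, of k n]
  by (simp add: dim_C flip: image_dim_D) (simp add: image_dim_def cocycle_dim_def)

lemma cocycle_dim_0: "cocycle_dim 0 n = (if n = 0 then 1 else 0)"
proof -
  have one: "{#} \<in> cell UG 0 0" by (simp add: cell_def)
  have "{z \<in> C 0 n. D z = 0} = supp (if n = 0 then {{#}} else {})"
  proof (intro equalityI subsetI)
    fix z assume z: "z \<in> {z \<in> C 0 n. D z = 0}"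
    hence "z \<in> supp {{#}}" using exact0 by blast
    hence "z \<in> supp ({{#}} \<inter> cell UG 0 n)" using z by (auto simp: supp_def)
    moreover have "{{#}} \<inter> cell UG 0 n \<subseteq> (if n = 0 then {{#}} else {})" by (auto simp: cell_def)
    ultimately show "z \<in> supp (if n = 0 then {{#}} else {})" using supp_mono by blast
  next
    fix z assume z: "z \<in> supp (if n = 0 then {{#}} else {} :: 'v dbl multiset set)"
    have "(if n = 0 then {{#}} else {}) \<subseteq> cell UG 0 n" using one by auto
    hence "z \<in> C 0 n" using z supp_mono by blast
    moreover have "D z = 0"
      by (rule glinear_eqI[OF glinear_D glinear_zero]) (use z in \<open>auto simp: D_one supp_def split: if_splits\<close>)
    ultimately show "z \<in> {z \<in> C 0 n. D z = 0}" by simp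
  qed
  thus ?thesis by (simp add: cocycle_dim_def dim_supp)
qed

text \<open>
  Suppose \<open>H\<^sub>j\<^sub>+\<^sub>1\<close> is spanned by the class of \<open>a\<close>, where \<open>a = 0\<close> is allowed. Then the image of \<open>Q\<close> in
  \<open>\<Lambda>\<^sup>j\<^sup>+\<^sup>1V \<otimes> A\<close> lies in \<open>Z = aA + S\<^sub>j\<^sub>+\<^sub>1 \<otimes> A\<close>. The kernel of \<open>D\<close> on \<open>Z\<close> contains the image of the incoming map
  \<open>Q D\<close>, and \<open>D\<close> has the same image on \<open>Z\<close> as on \<open>\<Lambda>\<^sup>j\<^sup>+\<^sup>1V \<otimes> A\<close>; the dimension of that
  image is the one of \<open>S\<^sub>j\<^sub>+\<^sub>1 \<otimes> A\<close> plus the one of the image of the outgoing map. Rank and nullity of \<open>D\<close> on \<open>Z\<close>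
  add up to the claim.
\<close>

lemma key_inequality:
  assumes h: "splitting j h" and h': "splitting (Suc j) h'"
    and a: "a \<in> supp (BMw (Suc j) wa)" "h a = 0"
    and hs0: "\<And>s. s \<in> supp (section_mons (Suc j)) \<Longrightarrow> h s = 0"
    and dec: "\<And>c. c \<in> LV (Suc j) \<Longrightarrow> \<exists>s r t. s \<in> supp (section_mons j) \<and> t \<in> supp (section_mons (Suc j)) \<and> c = D s + gpoly_scale r a + t"
  shows "image_dim (\<lambda>c. Q j h (D c)) j n + image_dim (\<lambda>c. Q (Suc j) h' (D c)) (Suc j) n
    \<le> (if a = 0 then 0 else shift bar_count wa n)"
proof -
  let ?S = "section_mons (Suc j)"
  let ?A = "if a = 0 \<or> n < wa then {} else (\<lambda>b. a \<star> mon b) ` wmons (Bar ` G) (n - wa)"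
  let ?Z = "gp.span (?A \<union> mon ` tensor_bar ?S n)"
  have barUG: "Bar ` G \<subseteq> UG" by (auto simp: gens_def)
  have finsp: "finite (tensor_bar ?S n)"
    using finite_subset[OF tensor_bar_mono[OF section_mons(1)]] cell_eq_tensor_bar finite_cell by metis
  have finA: "finite ?A" using finite_wmons[OF barUG] by simp
  have cardA: "card ?A \<le> (if a = 0 then 0 else shift bar_count wa n)"
    using card_image_le[OF finite_wmons[OF barUG]] by (auto simp: shift_def bar_count_def)
  have dimZ: "gp.dim ?Z \<le> (if a = 0 then 0 else shift bar_count wa n) + card (tensor_bar ?S n)"
  proof -
    have "gp.dim ?Z \<le> card (?A \<union> mon ` tensor_bar ?S n)" using finA finsp by (intro gp.dim_le_card) auto
    also have "\<dots> \<le> card ?A + card (mon ` tensor_bar ?S n)" by (rule card_Un_le)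
    also have "card (mon ` tensor_bar ?S n) = card (tensor_bar ?S n)" by (rule card_image[OF inj_mon])
    finally show ?thesis using cardA by linarith
  qed
  have fZ: "fin_dim ?Z" unfolding fin_dim_def
    by (rule exI[of _ "?A \<union> mon ` tensor_bar ?S n"], rule conjI[OF _ subset_refl]) (simp add: finA finsp del: Un_iff)
  have spZ: "supp (tensor_bar ?S n) \<subseteq> ?Z" unfolding supp_eq_span by (rule gp.span_mono) auto
  \<comment> \<open>\<open>m - d(h m)\<close> has no component in \<open>d S\<^sub>j\<close>; its weight decides whether \<open>a\<close> can occur\<close>
  have pim: "\<exists>r t. mon m - D (h (mon m)) = (if wa = weight m then gpoly_scale r a else 0) + t \<and> t \<in> supp {m' \<in> ?S. weight m' = weight m}"
    if m: "m \<in> BM (Suc j)" for m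
  proof -
    have "mon m \<in> LV (Suc j)" using m by simp
    then obtain s r t where srt: "s \<in> supp (section_mons j)" "t \<in> supp ?S" "mon m = D s + gpoly_scale r a + t" using dec by metis
    have "h (mon m) = s" unfolding srt(3) using h_D[OF h srt(1)] a(2) hs0[OF srt(2)]
      by (simp add: glinear_add[OF h_lin[OF h]] glinear_scale[OF h_lin[OF h]])
    hence e: "mon m - D (h (mon m)) = gpoly_scale r a + t" using srt(3) by simp
    have "mon m - D (h (mon m)) \<in> supp (BMw (Suc j) (weight m))"
      by (intro supp_diff mon_BMw m D_BMw h_BMw[OF h])
    hence "proj (weight m) (mon m - D (h (mon m))) = mon m - D (h (mon m))" by (intro proj_same BMw_weight)
    moreover have "proj (weight m) (gpoly_scale r a + t) = gpoly_scale r (proj (weight m) a) + proj (weight m) t"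
      by (simp add: glinear_add[OF glinear_proj] glinear_scale[OF glinear_proj])
    moreover have "proj (weight m) a = (if wa = weight m then a else 0)"
      using proj_same proj_other BMw_weight[OF a(1)] by auto
    ultimately have "mon m - D (h (mon m)) = (if wa = weight m then gpoly_scale r a else 0) + proj (weight m) t"
      unfolding e by (simp split: if_splits)
    thus ?thesis using proj_supp[OF srt(2), of "weight m"] by blast
  qed
  have extZ: "ext (\<lambda>c. c - D (h c)) y \<in> ?Z" if y: "y \<in> C (Suc j) n" for y
  proof -
    have m: "ext (\<lambda>c. c - D (h c)) (mon m) \<in> ?Z" if m: "m \<in> cell UG (Suc j) n" for m
    proof -
      have am: "bar_part m \<in> AM" using m mons_base_part by (auto simp: cell_def)
      have w: "weight (base_part m) + weight (bar_part m) = n" using m weight_simps(2)[of "base_part m" "bar_part m"] by (auto simp: cell_def base_part_bar_part)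
      obtain r t where rt: "mon (base_part m) - D (h (mon (base_part m))) = (if wa = weight (base_part m) then gpoly_scale r a else 0) + t"
        "t \<in> supp {m' \<in> ?S. weight m' = weight (base_part m)}" using pim[OF cell_base_part[OF m]] by blast
      have "t \<star> mon (bar_part m) \<in> supp (tensor_bar ?S n)"
      proof (rule supp_mult[OF rt(2), where B = "{bar_part m}"])
        fix h a assume "h \<in> {m' \<in> ?S. weight m' = weight (base_part m)}" "a \<in> {bar_part m}"
        thus "h + a \<in> tensor_bar ?S n" unfolding tensor_bar_def using am w
          by (intro CollectI exI[of _ h] exI[of _ "bar_part m"]) auto
      qed simp
      hence 1: "t \<star> mon (bar_part m) \<in> ?Z" using spZ by blast
      have 2: "(if wa = weight (base_part m) then gpoly_scale r a else 0) \<star> mon (bar_part m) \<in> ?Z"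
      proof (cases "wa = weight (base_part m) \<and> a \<noteq> 0")
        case True
        hence "bar_part m \<in> wmons (Bar ` G) (n - wa)" "\<not> n < wa" using w am by (auto simp: wmons_def)
        hence "a \<star> mon (bar_part m) \<in> ?A" using True by auto
        hence "a \<star> mon (bar_part m) \<in> ?Z" by (intro gp.span_base) blast
        thus ?thesis using True by (simp add: mult_scale_left gp.span_scale)
      next
        case False thus ?thesis by (auto simp: gp.span_zero)
      qed
      show ?thesis unfolding ext_mon rt(1) mult_add_left by (rule gp.span_add[OF 2 1])
    qed
    have "ext (\<lambda>c. c - D (h c)) y = (\<Sum>m\<in>keys y. gpoly_scale (coef y m) (ext (\<lambda>c. c - D (h c)) (mon m)))"
      by (rule glinear_expand[OF glinear_ext])
    also have "\<dots> \<in> ?Z" using y m by (intro gp.span_sum gp.span_scale) (auto simp: supp_def)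
    finally show ?thesis .
  qed
  \<comment> \<open>\<open>y = d h y + (1 - d h) y\<close> with \<open>h\<close> and \<open>d\<close> extended linearly over \<open>A\<close>, and \<open>h y = 0\<close>\<close>
  have QZ: "Q j h c \<in> ?Z" if c: "c \<in> C (Suc j) n" for c
  proof -
    let ?y = "Q j h c"
    have y: "?y \<in> C (Suc j) n" by (rule Q_C[OF h c])
    have "ext (\<lambda>c. D (h c)) ?y = ext D (ext h ?y)"
      by (rule ext_comp[symmetric, OF glinear_D y]) (rule h_base[OF h])
    hence "ext (\<lambda>c. c - D (h c)) ?y = ?y"
      unfolding ext_diff ext_h_Q[OF h c] by (simp add: glinear_0[OF glinear_ext] ext_id[OF CE[OF y]])
    thus ?thesis using extZ[OF y] by simp
  qed
  have DQ: "D (Q j h c) = D c" if c: "c \<in> C (Suc j) n" for c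
    unfolding Q_def using D_squared[OF CE[OF SA_C[OF h T_SA[OF h c]]]] by (simp add: glinear_diff[OF glinear_D])
  have "gp.dim ?Z = gp.dim (D ` ?Z) + gp.dim {y \<in> ?Z. D y = 0}"
    by (rule rank_nullity[OF gp.subspace_span fZ glinear_D])
  moreover have "image_dim D (Suc j) n \<le> gp.dim (D ` ?Z)"
    unfolding image_dim_def
  proof (rule gdim_mono[OF _ fin_dim_image[OF fZ glinear_D]], rule image_subsetI)
    fix c assume "c \<in> C (Suc j) n"
    thus "D c \<in> D ` ?Z" using QZ DQ by (metis imageI)
  qed
  moreover have "image_dim (\<lambda>c. Q j h (D c)) j n \<le> gp.dim {y \<in> ?Z. D y = 0}"
    unfolding image_dim_def
  proof (rule gdim_mono)
    show "fin_dim {y \<in> ?Z. D y = 0}" by (rule fin_dim_subset[OF fZ]) auto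
    show "(\<lambda>c. Q j h (D c)) ` C j n \<subseteq> {y \<in> ?Z. D y = 0}"
      using QZ[OF D_C] DQ[OF D_C] D_squared[OF CE] by auto
  qed
  ultimately show ?thesis using dimZ image_dim_D_split[OF h', of n] by linarith
qed

section \<open>Ranks are integers\<close>

lemma near_one: "eventually (\<lambda>t::real. 0 < t \<and> t < 1) (at_left 1)"
  using eventually_at_left_real[of 0 1] by (auto elim: eventually_mono)

text \<open>
  Already the powers of one even generator of \<open>A\<close> contribute a geometric series, so the Hilbert series of \<open>A\<close>
  tends to infinity at \<open>1\<close>.
\<close>

lemma bar_count_lower:
  assumes v: "v \<in> G" "odd (dg v)" and t: "0 < t" "t < 1"
  shows "(\<Sum>i<M. t ^ (i * gen_weight (Bar v))) \<le> hilbert bar_count t"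
proof -
  let ?w = "gen_weight (Bar v)"
  have w: "1 \<le> ?w" using dg2[OF v(1)] by simp
  have barUG: "Bar ` G \<subseteq> UG" by (auto simp: gens_def)
  have ge: "1 \<le> bar_count (i * ?w)" for i
  proof -
    have x: "Bar v \<in> even_bars" using v by (auto simp: even_bars_def)
    have wr: "weight (replicate_mset i (Bar v)) = i * ?w" by (induction i) auto
    have "replicate_mset i (Bar v) \<in> mons even_bars" using x by (simp add: mons_even_bars subset_iff)
    hence "replicate_mset i (Bar v) \<in> wmons (Bar ` G) (i * ?w)"
      using mons_mono[of even_bars "Bar ` G"] wr by (auto simp: wmons_def even_bars_def)
    hence "0 < card (wmons (Bar ` G) (i * ?w))" using finite_wmons[OF barUG] by (auto simp: card_gt_0_iff)
    thus ?thesis by (simp add: bar_count_def Suc_le_eq)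
  qed
  have inj: "inj_on (\<lambda>i. i * ?w) {..<M}" using w by (auto simp: inj_on_def)
  have "(\<Sum>i<M. t ^ (i * ?w)) = (\<Sum>n\<in>(\<lambda>i. i * ?w) ` {..<M}. t ^ n)" unfolding sum.reindex[OF inj] by (simp add: o_def)
  also have "\<dots> \<le> (\<Sum>n\<in>(\<lambda>i. i * ?w) ` {..<M}. real (bar_count n) * t ^ n)"
  proof (rule sum_mono)
    fix n assume "n \<in> (\<lambda>i. i * ?w) ` {..<M}"
    then obtain i where "n = i * ?w" by auto
    hence "1 \<le> real (bar_count n)" using ge[of i] by simp
    thus "t ^ n \<le> real (bar_count n) * t ^ n" using t by simp
  qed
  also have "\<dots> \<le> hilbert bar_count t" unfolding hilbert_def
    using hilbert_summable_bar_count t by (intro sum_le_suminf) (auto simp: hilbert_summable_def)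
  finally show ?thesis .
qed

lemma bar_count_ge_1:
  assumes "\<exists>v\<in>G. odd (dg v)" "0 < t" "t < 1" shows "1 \<le> hilbert bar_count t"
  using assms(1) bar_count_lower[OF _ _ assms(2,3), of _ 1] by fastforce

lemma bar_count_at_top:
  assumes "\<exists>v\<in>G. odd (dg v)" shows "filterlim (hilbert bar_count) at_top (at_left 1)"
proof -
  obtain v where v: "v \<in> G" "odd (dg v)" using assms by auto
  show ?thesis unfolding filterlim_at_top
  proof
    fix Z :: real
    obtain M :: nat where M: "Z < real M" using reals_Archimedean2 by blast
    have "((\<lambda>t::real. \<Sum>i<M. t ^ (i * gen_weight (Bar v))) \<longlongrightarrow> (\<Sum>i<M. 1 ^ (i * gen_weight (Bar v)))) (at_left 1)"
      by (intro tendsto_sum tendsto_power tendsto_ident_at)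
    hence "eventually (\<lambda>t::real. Z < (\<Sum>i<M. t ^ (i * gen_weight (Bar v)))) (at_left 1)"
      using M by (intro order_tendstoD(1)) auto
    with near_one show "eventually (\<lambda>t. Z \<le> hilbert bar_count t) (at_left 1)"
    proof eventually_elim
      case (elim t) thus ?case using bar_count_lower[OF v, of t M] by linarith
    qed
  qed
qed

lemma hilbert_cell_count: "0 < t \<Longrightarrow> t < 1 \<Longrightarrow> hilbert (cell_count k) t = (\<Sum>m\<in>BM k. t ^ weight m) * hilbert bar_count t"
proof -
  assume t: "0 < t" "t < 1"
  have "cell_count k = (\<lambda>n. \<Sum>m\<in>BM k. shift bar_count (weight m) n)"
    using card_tensor_bar[OF subset_refl] by (simp add: cell_count_def cell_eq_tensor_bar fun_eq_iff)
  hence "hilbert (cell_count k) t = (\<Sum>m\<in>BM k. t ^ weight m * hilbert bar_count t)"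
    using hilbert_sum[OF finite_BM hilbert_summable_shift[OF hilbert_summable_bar_count] t] hilbert_shift[OF hilbert_summable_bar_count t] by simp
  thus ?thesis by (simp add: sum_distrib_right)
qed

lemma hilbert_summable_cocycle_dim: "hilbert_summable (cocycle_dim k)"
  by (rule hilbert_summable_mono[OF hilbert_summable_cell_count[of k]]) (simp add: cell_count_eq)

text \<open>
  Exactness expresses the Hilbert series of the cocycles as an alternating sum of polynomial multiples of the
  Hilbert series of \<open>A\<close>, up to the constants, which have rank zero. At \<open>t = 1\<close> the polynomials take
  integral values.
\<close>

lemma rank_cocycle_dim:
  assumes odd: "\<exists>v\<in>G. odd (dg v)"
  shows "\<exists>z::int. ((\<lambda>t. hilbert (cocycle_dim k) t / hilbert bar_count t) \<longlongrightarrow> of_int z) (at_left 1)"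
proof (induction k)
  case 0
  have "hilbert (cocycle_dim 0) t = 1" for t
  proof -
    have "hilbert (cocycle_dim 0) t = (\<Sum>n\<in>{0}. real (cocycle_dim 0 n) * t ^ n)"
      unfolding hilbert_def by (rule suminf_finite) (auto simp: cocycle_dim_0)
    thus ?thesis by (simp add: cocycle_dim_0)
  qed
  moreover have "((\<lambda>t. 1 / hilbert bar_count t) \<longlongrightarrow> 0) (at_left 1)"
    using tendsto_inverse_0_at_top[OF bar_count_at_top[OF odd]] by (simp add: divide_inverse)
  ultimately show ?case by (intro exI[of _ 0]) simp
next
  case (Suc k)
  then obtain z :: int where z: "((\<lambda>t. hilbert (cocycle_dim k) t / hilbert bar_count t) \<longlongrightarrow> of_int z) (at_left 1)" by blast
  have "((\<lambda>t. (\<Sum>m\<in>BM k. t ^ weight m) - hilbert (cocycle_dim k) t / hilbert bar_count t) \<longlongrightarrow> (\<Sum>m\<in>BM k. 1 ^ weight m) - of_int z) (at_left 1)"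
    by (intro tendsto_diff z tendsto_sum tendsto_power tendsto_ident_at)
  moreover have "eventually (\<lambda>t. (\<Sum>m\<in>BM k. t ^ weight m) - hilbert (cocycle_dim k) t / hilbert bar_count t = hilbert (cocycle_dim (Suc k)) t / hilbert bar_count t) (at_left 1)"
    using near_one
  proof eventually_elim
    case (elim t)
    hence t: "0 < t" "t < 1" by auto
    have "hilbert (cell_count k) t = hilbert (cocycle_dim (Suc k)) t + hilbert (cocycle_dim k) t"
    proof -
      have "cell_count k = (\<lambda>n. cocycle_dim (Suc k) n + cocycle_dim k n)" by (intro HOL.ext cell_count_eq)
      thus ?thesis by (simp only: hilbert_add[OF hilbert_summable_cocycle_dim hilbert_summable_cocycle_dim t])
    qed
    thus ?case using hilbert_cell_count[OF t, of k] bar_count_ge_1[OF odd t] by (simp add: field_simps)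
  qed
  ultimately have "((\<lambda>t. hilbert (cocycle_dim (Suc k)) t / hilbert bar_count t) \<longlongrightarrow> (\<Sum>m\<in>BM k. 1 ^ weight m) - of_int z) (at_left 1)"
    by (rule Lim_transform_eventually)
  thus ?case by (intro exI[of _ "int (card (BM k)) - z"]) simp
qed

lemma rank_Q:
  assumes odd: "\<exists>v\<in>G. odd (dg v)" and h: "splitting k h"
  shows "\<exists>z::int. ((\<lambda>t. hilbert (image_dim (\<lambda>c. Q k h (D c)) k) t / hilbert bar_count t) \<longlongrightarrow> of_int z) (at_left 1)"
proof -
  let ?f = "\<lambda>c. Q k h (D c)"
  obtain z :: int where z: "((\<lambda>t. hilbert (cocycle_dim (Suc k)) t / hilbert bar_count t) \<longlongrightarrow> of_int z) (at_left 1)"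
    using rank_cocycle_dim[OF odd] by blast
  have fS: "finite (section_mons k)" using section_mons(1) finite_BM finite_subset by blast
  have sQ: "hilbert_summable (image_dim ?f k)" by (rule hilbert_summable_image_dim[OF glinear_compose[OF glinear_D glinear_Q]])
  have "((\<lambda>t. hilbert (cocycle_dim (Suc k)) t / hilbert bar_count t - (\<Sum>m\<in>section_mons k. t ^ weight m)) \<longlongrightarrow> of_int z - (\<Sum>m\<in>section_mons k. 1 ^ weight m)) (at_left 1)"
    by (intro tendsto_diff z tendsto_sum tendsto_power tendsto_ident_at)
  moreover have "eventually (\<lambda>t. hilbert (cocycle_dim (Suc k)) t / hilbert bar_count t - (\<Sum>m\<in>section_mons k. t ^ weight m) = hilbert (image_dim ?f k) t / hilbert bar_count t) (at_left 1)"
    using near_one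
  proof eventually_elim
    case (elim t)
    hence t: "0 < t" "t < 1" by auto
    have s: "hilbert_summable (\<lambda>n. \<Sum>m\<in>section_mons k. shift bar_count (weight m) n)" by (intro hilbert_summable_sum fS hilbert_summable_shift hilbert_summable_bar_count)
    have "cocycle_dim (Suc k) = (\<lambda>n. (\<Sum>m\<in>section_mons k. shift bar_count (weight m) n) + image_dim ?f k n)"
      using image_dim_D_split[OF h] card_tensor_bar[OF section_mons(1)] by (simp add: fun_eq_iff flip: image_dim_D)
    hence "hilbert (cocycle_dim (Suc k)) t = (\<Sum>m\<in>section_mons k. t ^ weight m * hilbert bar_count t) + hilbert (image_dim ?f k) t"
      using hilbert_add[OF s sQ t] hilbert_sum[OF fS hilbert_summable_shift[OF hilbert_summable_bar_count] t] hilbert_shift[OF hilbert_summable_bar_count t] by simp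
    thus ?case using bar_count_ge_1[OF odd t] by (simp add: field_simps sum_distrib_left sum_distrib_right)
  qed
  ultimately have "((\<lambda>t. hilbert (image_dim ?f k) t / hilbert bar_count t) \<longlongrightarrow> of_int z - (\<Sum>m\<in>section_mons k. 1 ^ weight m)) (at_left 1)"
    by (rule Lim_transform_eventually)
  thus ?thesis by (intro exI[of _ "z - int (card (section_mons k))"]) simp
qed

text \<open>
  This combines \<open>growth\<close> with integrality.
\<close>

lemma rank_Q_pos:
  assumes odd: "\<exists>v\<in>G. odd (dg v)" and h: "splitting k h"
    and b: "b \<in> C k n" "Q k h (D b) \<noteq> 0"
    and z: "((\<lambda>t. hilbert (image_dim (\<lambda>c. Q k h (D c)) k) t / hilbert bar_count t) \<longlongrightarrow> of_int z) (at_left 1)"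
  shows "1 \<le> z"
proof -
  let ?f = "\<lambda>c. Q k h (D c)"
  have lin: "glinear ?f" by (rule glinear_compose[OF glinear_D glinear_Q])
  obtain r where "diff_order r ?f" using finite_order_QD[OF h] by (auto simp: finite_order_def)
  then obtain N K where NK: "K > 0" "\<And>t. 0 < t \<Longrightarrow> t < 1 \<Longrightarrow> t ^ N * hilbert bar_count t \<le> K * hilbert (image_dim ?f k) t"
    using growth[OF lin _ b] by blast
  have "((\<lambda>t::real. t ^ N / K) \<longlongrightarrow> 1 ^ N / K) (at_left 1)"
    using NK(1) by (intro tendsto_divide tendsto_power tendsto_ident_at tendsto_const) auto
  moreover have "eventually (\<lambda>t. t ^ N / K \<le> hilbert (image_dim ?f k) t / hilbert bar_count t) (at_left 1)"
    using near_one
  proof eventually_elim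
    case (elim t)
    thus ?case using NK(1) NK(2)[of t] bar_count_ge_1[OF odd, of t] by (simp add: field_simps)
  qed
  ultimately have "1 ^ N / K \<le> real_of_int z"
    using tendsto_le[OF _ z] by (simp add: trivial_limit_at_left_real)
  moreover have "0 < 1 ^ N / K" using NK(1) by simp
  ultimately have "0 < real_of_int z" by linarith
  thus ?thesis by simp
qed

text \<open>
  For \<open>a \<noteq> 0\<close> the incoming map \<open>Q D\<close> is nonzero: by exactness \<open>a = D y\<close>, and \<open>Q a = a\<close>. Hence it has rank at
  least \<open>1\<close>, by \<open>key_inequality\<close> the outgoing map has rank at most \<open>0\<close>, and therefore it vanishes. For
  \<open>a = 0\<close> it vanishes by \<open>key_inequality\<close> alone. A cocycle of length \<open>j + 2\<close> is \<open>D y\<close> in the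
  closure, so \<open>Q\<close> kills it, which makes it exact in \<open>\<Lambda>V\<close>.
\<close>

lemma vanish_homogeneous:
  assumes odd: "\<exists>v\<in>G. odd (dg v)"
    and a: "a \<in> supp (BMw (Suc j) wa)" "D a = 0" "a \<noteq> 0 \<Longrightarrow> \<not> (\<exists>y\<in>LV j. D y = a)"
    and span: "\<And>c. c \<in> LV (Suc j) \<Longrightarrow> D c = 0 \<Longrightarrow> \<exists>r. \<exists>y\<in>LV j. c = gpoly_scale r a + D y"
    and c: "c \<in> LV (Suc (Suc j))" "D c = 0"
  shows "\<exists>y\<in>LV (Suc j). D y = c"
proof -
  have aLV: "a \<in> LV (Suc j)" by (rule BMw_LV[OF a(1)])
  \<comment> \<open>the splitting has to vanish on \<open>a\<close> and on \<open>S\<^sub>j\<^sub>+\<^sub>1\<close>\<close>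
  define W where "W = {gpoly_scale r a + t | r t. t \<in> supp (section_mons (Suc j))}"
  have "gp.subspace W"
    unfolding gp.subspace_def
  proof (intro conjI ballI allI)
    have "0 = gpoly_scale 0 a + 0" by simp
    thus "0 \<in> W" unfolding W_def using supp_0 by blast
    fix x assume "x \<in> W"
    then obtain r t where x: "x = gpoly_scale r a + t" "t \<in> supp (section_mons (Suc j))" by (auto simp: W_def)
    show "gpoly_scale q x \<in> W" for q
    proof -
      have "gpoly_scale q x = gpoly_scale (q * r) a + gpoly_scale q t" unfolding x by (simp add: gp.scale_right_distrib)
      thus ?thesis unfolding W_def using supp_scale[OF x(2)] by blast
    qed
    fix y assume "y \<in> W"
    then obtain r' t' where y: "y = gpoly_scale r' a + t'" "t' \<in> supp (section_mons (Suc j))" by (auto simp: W_def)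
    have "x + y = gpoly_scale (r + r') a + (t + t')" unfolding x y by (simp add: gp.scale_left_distrib add_ac)
    thus "x + y \<in> W" unfolding W_def using supp_add[OF x(2) y(2)] by blast
  qed
  moreover have "s = 0" if s: "s \<in> supp (section_mons j)" "D s \<in> W" for s
  proof -
    obtain r t where rt: "D s = gpoly_scale r a + t" "t \<in> supp (section_mons (Suc j))" using s(2) by (auto simp: W_def)
    have "D (D s) = 0" by (rule D_squared[OF LV_E[OF section_mons_LV[OF s(1)]]])
    hence "D t = 0" using a(2) unfolding rt(1) by (simp add: glinear_add[OF glinear_D] glinear_scale[OF glinear_D])
    hence t: "t = 0" using section_mons(2)[OF rt(2)] by simp
    have "gpoly_scale r a = 0"
    proof (rule ccontr)
      assume "gpoly_scale r a \<noteq> 0"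
      hence ra: "r \<noteq> 0" "a \<noteq> 0" by auto
      have "D (gpoly_scale (1 / r) s) = a" using rt(1) t ra by (simp add: glinear_scale[OF glinear_D])
      thus False using a(3)[OF ra(2)] supp_scale[OF section_mons_LV[OF s(1)]] by blast
    qed
    thus "s = 0" using section_mons(2)[OF s(1)] rt(1) t by simp
  qed
  ultimately obtain h where h: "splitting j h" "\<And>w b. b \<in> supp (BMw (Suc j) w) \<Longrightarrow> b \<in> W \<Longrightarrow> h b = 0"
    using splitting_exists[of W j] by blast
  have "gpoly_scale 1 a + 0 \<in> W" unfolding W_def using supp_0 by blast
  hence ha: "h a = 0" using h(2)[OF a(1)] by simp
  have hs0: "h t = 0" if t: "t \<in> supp (section_mons (Suc j))" for t
  proof (rule glinear_eqI[OF h_lin[OF h(1)] glinear_zero])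
    fix m assume "m \<in> keys t"
    hence m: "m \<in> section_mons (Suc j)" using t by (auto simp: supp_def)
    hence "gpoly_scale 0 a + mon m \<in> W" unfolding W_def by (metis (mono_tags, lifting) mem_Collect_eq mon_supp)
    hence "mon m \<in> W" by simp
    thus "h (mon m) = 0" using h(2)[OF mon_BMw] m section_mons(1) by blast
  qed
  obtain h' where h': "splitting (Suc j) h'"
    using splitting_exists[OF gp.subspace_single_0, of "Suc j"] section_mons(2) by auto
  let ?f = "\<lambda>c. Q j h (D c)" and ?g = "\<lambda>c. Q (Suc j) h' (D c)"
  have dec: "\<exists>s r t. s \<in> supp (section_mons j) \<and> t \<in> supp (section_mons (Suc j)) \<and> x = D s + gpoly_scale r a + t" if x: "x \<in> LV (Suc j)" for x
  proof -
    obtain t where t: "t \<in> supp (section_mons (Suc j))" "D x = D t" using section_mons(3)[of "Suc j"] x by blast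
    have "x - t \<in> LV (Suc j)" "D (x - t) = 0" using x section_mons_LV[OF t(1)] t(2)
      by (auto intro: supp_diff simp: glinear_diff[OF glinear_D])
    then obtain r y where ry: "y \<in> LV j" "x - t = gpoly_scale r a + D y" using span by blast
    obtain s where s: "s \<in> supp (section_mons j)" "D y = D s" using section_mons(3)[of j] ry(1) by blast
    have "x = D s + gpoly_scale r a + t" using ry(2) s(2) by (simp add: algebra_simps)
    thus ?thesis using s(1) t(1) by blast
  qed
  note key = key_inequality[OF h(1) h' a(1) ha hs0 dec]
  have lin: "glinear ?f" "glinear ?g" by (rule glinear_compose[OF glinear_D glinear_Q])+
  have g0: "?g b = 0" if b: "b \<in> C (Suc j) n" for b n
  proof (cases "a = 0")
    case True
    hence "image_dim ?g (Suc j) n = 0" using key[of n] by simp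
    thus ?thesis unfolding image_dim_def using zero_if_dim_0 fin_dim_im[OF lin(2)] b by blast
  next
    case False
    show ?thesis
    proof (rule ccontr)
      assume gb: "?g b \<noteq> 0"
      obtain z z' :: int where z: "((\<lambda>t. hilbert (image_dim ?f j) t / hilbert bar_count t) \<longlongrightarrow> of_int z) (at_left 1)"
        and z': "((\<lambda>t. hilbert (image_dim ?g (Suc j)) t / hilbert bar_count t) \<longlongrightarrow> of_int z') (at_left 1)"
        using rank_Q[OF odd h(1)] rank_Q[OF odd h'] by blast
      have "1 \<le> z'" by (rule rank_Q_pos[OF odd h' b gb z'])
      moreover have "1 \<le> z"
      proof -
        obtain y where y: "y \<in> C j wa" "D y = a" using exact[OF BMw_C[OF a(1)] a(2)] by blast
        have "?f y = a" unfolding y(2) Q_LV[OF h(1) aLV] ha by (simp add: glinear_0[OF glinear_D])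
        thus ?thesis using rank_Q_pos[OF odd h(1) y(1) _ z] False by simp
      qed
      moreover have "z + z' \<le> 1"
      proof -
        have "((\<lambda>t. hilbert (image_dim ?f j) t / hilbert bar_count t + hilbert (image_dim ?g (Suc j)) t / hilbert bar_count t) \<longlongrightarrow> of_int z + of_int z') (at_left 1)"
          by (rule tendsto_add[OF z z'])
        moreover have "((\<lambda>t::real. t ^ wa) \<longlongrightarrow> 1 ^ wa) (at_left 1)" by (intro tendsto_power tendsto_ident_at)
        moreover have "eventually (\<lambda>t. hilbert (image_dim ?f j) t / hilbert bar_count t + hilbert (image_dim ?g (Suc j)) t / hilbert bar_count t \<le> t ^ wa) (at_left 1)"
          using near_one
        proof eventually_elim
          case (elim t)
          hence t: "0 < t" "t < 1" by auto
          have "hilbert (image_dim ?f j) t + hilbert (image_dim ?g (Suc j)) t = hilbert (\<lambda>n. image_dim ?f j n + image_dim ?g (Suc j) n) t"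
            using hilbert_add[OF hilbert_summable_image_dim[OF lin(1)] hilbert_summable_image_dim[OF lin(2)] t] by simp
          also have "\<dots> \<le> hilbert (shift bar_count wa) t"
            by (rule hilbert_mono[OF hilbert_summable_shift[OF hilbert_summable_bar_count] _ t]) (use key False in auto)
          also have "\<dots> = t ^ wa * hilbert bar_count t" by (rule hilbert_shift[OF hilbert_summable_bar_count t])
          finally show ?case using bar_count_ge_1[OF odd t] by (simp add: field_simps)
        qed
        ultimately have "real_of_int z + real_of_int z' \<le> 1 ^ wa"
          by (intro tendsto_le[of "at_left (1::real)"]) (auto simp: trivial_limit_at_left_real)
        thus ?thesis by (simp flip: of_int_add)
      qed
      ultimately show False by simp
    qed
  qed
  have hom: "\<exists>y\<in>LV (Suc j). D y = proj w c" for w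
  proof -
    let ?c = "proj w c"
    have pc: "?c \<in> supp (BMw (Suc (Suc j)) w)" "D ?c = 0"
      using proj_LV[OF c(1)] D_proj[OF c(1)] c(2) by (simp_all add: glinear_0[OF glinear_proj])
    obtain y where y: "y \<in> C (Suc j) w" "D y = ?c" using exact[OF BMw_C[OF pc(1)] pc(2)] by blast
    have "Q (Suc j) h' ?c = 0" using g0[OF y(1)] y(2) by simp
    hence "D (h' ?c) = ?c" unfolding Q_LV[OF h' BMw_LV[OF pc(1)]] by simp
    thus ?thesis using h_LV[OF h'] by blast
  qed
  then obtain y where y: "\<And>w. y w \<in> LV (Suc j)" "\<And>w. D (y w) = proj w c" by metis
  have "D (\<Sum>w\<le>Suc (Suc j) * maxw. y w) = c"
    unfolding glinear_sum[OF glinear_D] y(2) by (rule sum_proj[OF c(1), symmetric])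
  thus ?thesis using y(1) by (intro bexI[of _ "\<Sum>w\<le>Suc (Suc j) * maxw. y w"] supp_sum)
qed

text \<open>
  A cocycle that is not exact has a component of some weight that is not exact either, and this component may
  replace \<open>a\<close>.
\<close>

lemma vanish_step:
  assumes odd: "\<exists>v\<in>G. odd (dg v)"
    and span: "\<And>c. c \<in> LV (Suc j) \<Longrightarrow> D c = 0 \<Longrightarrow> \<exists>r. \<exists>y\<in>LV j. c = gpoly_scale r a + D y"
    and c: "c \<in> LV (Suc (Suc j))" "D c = 0"
  shows "\<exists>y\<in>LV (Suc j). D y = c"
proof (cases "\<forall>b\<in>LV (Suc j). D b = 0 \<longrightarrow> (\<exists>y\<in>LV j. D y = b)")
  case True
  show ?thesis
  proof (rule vanish_homogeneous[OF odd _ _ _ _ c, where a = 0 and wa = 0])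
    show "\<exists>r. \<exists>y\<in>LV j. b = gpoly_scale r 0 + D y" if "b \<in> LV (Suc j)" "D b = 0" for b
      using True that by force
  qed (simp_all add: supp_0 glinear_0[OF glinear_D])
next
  case False
  then obtain b where b: "b \<in> LV (Suc j)" "D b = 0" "\<not> (\<exists>y\<in>LV j. D y = b)" by blast
  have "\<exists>w. \<not> (\<exists>y\<in>LV j. D y = proj w b)"
  proof (rule ccontr)
    assume "\<not> ?thesis"
    then obtain y where y: "\<And>w. y w \<in> LV j" "\<And>w. D (y w) = proj w b" by metis
    have "D (\<Sum>w\<le>Suc j * maxw. y w) = b"
      unfolding glinear_sum[OF glinear_D] y(2) by (rule sum_proj[OF b(1), symmetric])
    thus False using b(3) supp_sum[of "{..Suc j * maxw}" y] y(1) by blast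
  qed
  then obtain w where w: "\<not> (\<exists>y\<in>LV j. D y = proj w b)" by blast
  let ?b = "proj w b"
  have pb: "?b \<in> supp (BMw (Suc j) w)" "D ?b = 0"
    using proj_LV[OF b(1)] D_proj[OF b(1)] b(2) by (simp_all add: glinear_0[OF glinear_proj])
  obtain r y where ry: "y \<in> LV j" "?b = gpoly_scale r a + D y" using span[OF BMw_LV[OF pb(1)] pb(2)] by blast
  have r: "r \<noteq> 0" using w ry by auto
  have "gpoly_scale (1 / r) (?b - D y) = a" using ry(2) r by simp
  hence ab: "a = gpoly_scale (1 / r) ?b - gpoly_scale (1 / r) (D y)" by (simp add: gp.scale_right_diff_distrib)
  show ?thesis
  proof (rule vanish_homogeneous[OF odd pb w _ c])
    fix x assume "x \<in> LV (Suc j)" "D x = 0"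
    then obtain q u where qu: "u \<in> LV j" "x = gpoly_scale q a + D u" using span by blast
    have "x = gpoly_scale (q / r) ?b + D (u - gpoly_scale (q / r) y)"
      unfolding qu(2) ab
      by (simp add: gp.scale_right_diff_distrib glinear_diff[OF glinear_D] glinear_scale[OF glinear_D])
    thus "\<exists>r. \<exists>y\<in>LV j. x = gpoly_scale r ?b + D y" using qu(1) ry(1) supp_diff supp_scale by blast
  qed
qed

theorem vanishing:
  assumes odd: "\<exists>v\<in>G. odd (dg v)"
    and span: "\<And>c. c \<in> LV (Suc j) \<Longrightarrow> D c = 0 \<Longrightarrow> \<exists>r. \<exists>y\<in>LV j. c = gpoly_scale r a + D y"
    and i: "Suc j < i" and c: "c \<in> LV i" "D c = 0"
  shows "\<exists>y\<in>LV (i - 1). D y = c"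
proof -
  have "\<forall>c\<in>LV (Suc (Suc (j + l))). D c = 0 \<longrightarrow> (\<exists>y\<in>LV (Suc (j + l)). D y = c)" for l
  proof (induction l)
    case 0 thus ?case using vanish_step[OF odd span] by simp
  next
    case (Suc l)
    show ?case
    proof (intro ballI impI)
      fix c assume c: "c \<in> LV (Suc (Suc (j + Suc l)))" "D c = 0"
      have "\<exists>y\<in>LV (Suc (Suc (j + l))). D y = c"
      proof (rule vanish_step[OF odd _ _ c(2), where a = 0])
        fix x assume "x \<in> LV (Suc (Suc (j + l)))" "D x = 0"
        then obtain y where "y \<in> LV (Suc (j + l))" "D y = x" using Suc by blast
        thus "\<exists>r. \<exists>y\<in>LV (Suc (j + l)). x = gpoly_scale r 0 + D y" by auto
      qed (use c(1) in simp)
      thus "\<exists>y\<in>LV (Suc (j + Suc l)). D y = c" by simp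
    qed
  qed
  moreover obtain l where "i = Suc (Suc (j + l))" using i less_iff_Suc_add by auto
  ultimately show ?thesis using c by simp
qed

end

section \<open>Comparison with the minimal model\<close>

text \<open>
  The minimal model is transported along \<open>v \<mapsto> Base v\<close> into the algebra that also contains the generators \<open>Bar v\<close>.
\<close>

locale coformal_sullivan =
  fixes G :: "'v::linorder set" and dg :: "'v \<Rightarrow> nat" and d :: "'v gpoly \<Rightarrow> 'v gpoly"
  assumes finite_G: "finite G"
    and minimal: "minimal_sullivan_algebra G dg d"
    and cof: "coformal G d"
begin

definition base_emb :: "'v gpoly \<Rightarrow> 'v dbl gpoly" where
  "base_emb = gextend (\<lambda>m. mon (image_mset Base m))"

definition dbase :: "'v \<Rightarrow> 'v dbl gpoly" where
  "dbase v = base_emb (d (gpoly_gen v))"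

abbreviation "A \<equiv> free_cdga G dg d"

lemma two_le_dg: "v \<in> G \<Longrightarrow> 2 \<le> dg v"
  using minimal by (simp add: minimal_sullivan_algebra_def)

lemma A_simps [simp]: "hom_part A = gpoly_hom G dg" "scal A = gpoly_scale" "unit_el A = gpoly_one"
  "mult_el A = gpoly_mult dg" "diff A = d"
  by (simp_all add: free_cdga_def)

end

sublocale coformal_sullivan \<subseteq> B: gca dg .
sublocale coformal_sullivan \<subseteq> quadratic_model G dg dbase .

context coformal_sullivan begin

notation gmul (infixl "\<star>" 70)

lemma glinear_emb: "glinear base_emb" unfolding base_emb_def by (rule glinear_gextend)

lemma emb_mon [simp]: "base_emb (mon m) = mon (image_mset Base m)" by (simp add: base_emb_def)

definition retr :: "'v dbl gpoly \<Rightarrow> 'v gpoly" where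
  "retr = gextend (\<lambda>m. mon (image_mset (\<lambda>x. case x of Base v \<Rightarrow> v | Bar v \<Rightarrow> v) m))"

lemma glinear_retr: "glinear retr" unfolding retr_def by (rule glinear_gextend)

lemma retr_emb: "retr (base_emb a) = a"
  by (rule glinear_eqI[OF glinear_compose[OF glinear_emb glinear_retr] glinear_id])
     (simp add: retr_def multiset.map_comp o_def)

lemma emb_inj: "base_emb a = base_emb b \<Longrightarrow> a = b"
  by (metis retr_emb)

definition bmons :: "'v multiset set" where "bmons = B.mons G"

lemma monomials_eq: "monomials G dg p = {m \<in> bmons. (\<Sum>v\<in>#m. dg v) = p}"
  by (auto simp: monomials_def bmons_def B.mons_def B.valid_def)

lemma carrier_eq: "dga_carrier A = supp bmons"
proof
  show "dga_carrier A \<subseteq> supp bmons"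
  proof
    fix a assume "a \<in> dga_carrier A"
    then obtain f n where f: "a = (\<Sum>i\<le>n. f i)" "\<forall>i\<le>(n::nat). f i \<in> gpoly_hom G dg i"
      unfolding dga_carrier_def by auto
    have "f i \<in> supp bmons" if "i \<le> n" for i
      using f(2) that monomials_eq[of i] by (auto simp: gpoly_hom_def supp_def)
    thus "a \<in> supp bmons" unfolding f(1) by (intro supp_sum) simp
  qed
  show "supp bmons \<subseteq> dga_carrier A"
  proof
    fix a assume a: "a \<in> supp bmons"
    let ?deg = "\<lambda>m. \<Sum>v\<in>#m. dg v"
    define n where "n = Max (insert 0 (?deg ` keys a))"
    define f where "f i = (\<Sum>m\<in>{m \<in> keys a. ?deg m = i}. gpoly_scale (coef a m) (mon m))" for i
    have le: "?deg m \<le> n" if "m \<in> keys a" for m unfolding n_def using that by (intro Max_ge) auto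
    have "(\<Sum>i\<le>n. f i) = (\<Sum>m\<in>keys a. gpoly_scale (coef a m) (mon m))"
      unfolding f_def using le by (intro sum.group) auto
    hence "a = (\<Sum>i\<le>n. f i)" using gpoly_eq_sum[of a] by simp
    moreover have "f i \<in> hom_part A i" for i
    proof -
      have "f i \<in> supp (monomials G dg i)"
        unfolding f_def using a by (intro supp_sum supp_scale) (auto simp: monomials_eq supp_def)
      thus ?thesis by (simp add: gpoly_hom_def supp_def)
    qed
    ultimately show "a \<in> dga_carrier A" unfolding dga_carrier_def by blast
  qed
qed

lemma deriv: "dga_derivation A"
  using minimal by (simp add: minimal_sullivan_algebra_def)

lemma d_hom: "x \<in> gpoly_hom G dg p \<Longrightarrow> d x \<in> gpoly_hom G dg (p + 1)"
  using deriv by (simp add: dga_derivation_def)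
lemma d_add: "x \<in> supp bmons \<Longrightarrow> y \<in> supp bmons \<Longrightarrow> d (x + y) = d x + d y"
  using deriv by (simp add: dga_derivation_def carrier_eq)
lemma d_scale: "x \<in> supp bmons \<Longrightarrow> d (gpoly_scale c x) = gpoly_scale c (d x)"
  using deriv by (simp add: dga_derivation_def carrier_eq)
lemma d_leibniz: "x \<in> gpoly_hom G dg p \<Longrightarrow> y \<in> supp bmons \<Longrightarrow>
    d (gpoly_mult dg x y) = gpoly_mult dg (d x) y + gpoly_scale ((-1) ^ p) (gpoly_mult dg x (d y))"
  using deriv by (simp add: dga_derivation_def carrier_eq)
lemma d_d: "x \<in> supp bmons \<Longrightarrow> d (d x) = 0"
  using deriv by (simp add: dga_derivation_def carrier_eq)

lemma d_zero: "d 0 = 0"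
  using d_scale[of 0 0] by (simp add: supp_0)

lemma d_sum: "finite I \<Longrightarrow> (\<And>i. i \<in> I \<Longrightarrow> f i \<in> supp bmons) \<Longrightarrow> d (sum f I) = (\<Sum>i\<in>I. d (f i))"
  by (induction I rule: finite_induct) (auto simp: d_zero d_add supp_sum)

text \<open>
  The values of \<open>d\<close> outside the algebra are arbitrary. Its linear extension from monomials agrees with it on the
  algebra and is linear everywhere.
\<close>

definition dlin :: "'v gpoly \<Rightarrow> 'v gpoly" where "dlin = gextend (\<lambda>m. d (mon m))"

lemma glinear_dlin: "glinear dlin" unfolding dlin_def by (rule glinear_gextend)

lemma d_eq_dlin: "a \<in> supp bmons \<Longrightarrow> d a = dlin a"
proof -
  assume a: "a \<in> supp bmons"
  have m: "mon m \<in> supp bmons" if "m \<in> keys a" for m using that a by (auto simp: supp_def)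
  have "d a = d (\<Sum>m\<in>keys a. gpoly_scale (coef a m) (mon m))" using gpoly_eq_sum[of a] by simp
  also have "\<dots> = (\<Sum>m\<in>keys a. gpoly_scale (coef a m) (d (mon m)))"
    using m d_scale by (subst d_sum) (auto intro: supp_scale)
  also have "\<dots> = dlin a" by (simp add: dlin_def gextend_def)
  finally show ?thesis .
qed

lemma hom_supp: "a \<in> gpoly_hom G dg p \<Longrightarrow> a \<in> supp bmons"
  by (auto simp: gpoly_hom_def monomials_eq supp_def)

lemma mon_hom: "m \<in> bmons \<Longrightarrow> mon m \<in> gpoly_hom G dg (\<Sum>v\<in>#m. dg v)"
  by (simp add: gpoly_hom_def monomials_eq)

lemma d_carrier: "a \<in> supp bmons \<Longrightarrow> d a \<in> supp bmons"
  unfolding d_eq_dlin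
  by (rule glinear_suppI[OF glinear_dlin, of bmons]) (auto simp: dlin_def intro: hom_supp d_hom mon_hom)

lemma gen_hom: "v \<in> G \<Longrightarrow> mon {#v#} \<in> gpoly_hom G dg (dg v)"
  using mon_hom[of "{#v#}"] by (simp add: bmons_def B.mons_def B.valid_add_mset)

lemma d_one: "d (mon {#}) = 0"
proof -
  have h: "mon {#} \<in> gpoly_hom G dg 0" using mon_hom[of "{#}"] by (simp add: bmons_def)
  have "d (mon {#}) = d (mon {#}) + d (mon {#})"
    using d_leibniz[OF h hom_supp[OF h]] by simp
  thus ?thesis by simp
qed

lemma emb_mult: "base_emb (gpoly_mult dg a b) = base_emb a \<star> base_emb b"
proof -
  have k: "koszul (image_mset Base m) (image_mset Base n) = B.koszul m n" for m n
  proof -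
    have "common_odd (image_mset Base m) (image_mset Base n) = B.common_odd m n"
    proof
      assume "B.common_odd m n"
      then obtain v where "odd (deg (Base v))" "Base v \<in># image_mset Base m" "Base v \<in># image_mset Base n"
        by (auto simp: B.common_odd_def)
      thus "common_odd (image_mset Base m) (image_mset Base n)" unfolding common_odd_def by blast
    qed (auto simp: common_odd_def B.common_odd_def)
    moreover have "inversions (image_mset Base m) (image_mset Base n) = (\<lambda>(x, y). (Base x, Base y)) ` B.inversions m n"
      by (auto simp: inversions_def B.inversions_def less_dbl_def image_iff)
    moreover have "inj_on (\<lambda>(x, y). (Base x, Base y)) (B.inversions m n)" by (auto simp: inj_on_def)
    ultimately show ?thesis by (simp add: koszul_def B.koszul_def card_image)
  qed
  have 1: "base_emb (gpoly_mult dg (mon m) (mon n)) = base_emb (mon m) \<star> base_emb (mon n)" for m n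
    by (simp add: B.mon_mult_mon' mon_mult_mon' k glinear_scale[OF glinear_emb])
  have 2: "base_emb (gpoly_mult dg (mon m) b) = base_emb (mon m) \<star> base_emb b" for m
    by (rule glinear_eqI[where a = b and f = "\<lambda>b. base_emb (gpoly_mult dg (mon m) b)"])
       (intro 1 glinear_compose[OF B.glinear_mult_right glinear_emb] glinear_compose[OF glinear_emb glinear_mult_right])+
  show ?thesis
    by (rule glinear_eqI[where a = a and f = "\<lambda>a. base_emb (gpoly_mult dg a b)"])
       (intro 2 glinear_compose[OF B.glinear_mult_left glinear_emb] glinear_compose[OF glinear_emb glinear_mult_left])+
qed

lemma count_emb [simp]: "count (image_mset Base m) (Base v) = count m v"
  "count (image_mset Base m) (Bar v) = 0"
  by (induction m) auto

lemma bmons_emb: "m \<in> bmons \<Longrightarrow> image_mset Base m \<in> mons (Base ` G)"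
proof -
  assume m: "m \<in> bmons"
  have "count (image_mset Base m) x \<le> 1" if "odd (deg x)" for x
    using m that by (cases x) (auto simp: bmons_def B.mons_def B.valid_def)
  thus ?thesis using m by (auto simp: mons_def valid_def bmons_def B.mons_def)
qed

lemma base_length_emb: "base_length (image_mset Base m) = size m"
  by (induction m) auto

lemma weight_emb: "set_mset m \<subseteq> G \<Longrightarrow> weight (image_mset Base m) + size m = (\<Sum>v\<in>#m. dg v)"
proof (induction m)
  case (add x m) thus ?case using two_le_dg[of x] by simp
qed simp

lemma emb_supp: "a \<in> supp X \<Longrightarrow> base_emb a \<in> supp (image_mset Base ` X)"
  by (rule glinear_suppI[OF glinear_emb]) auto

lemma dbase_cell:
  assumes v: "v \<in> G" shows "dbase v \<in> supp (cell (Base ` {u \<in> G. dg u < dg v}) 2 (dg v - 1))"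
proof -
  have "gpoly_gen v = mon {#v#}" by (simp add: gpoly_gen_def)
  hence "keys (d (gpoly_gen v)) \<subseteq> monomials G dg (dg v + 1)"
    using d_hom[OF gen_hom[OF v]] by (simp add: gpoly_hom_def)
  moreover have "d (gpoly_gen v) \<in> word_length_eq 2" using cof v by (simp add: coformal_def)
  ultimately have k: "d (gpoly_gen v) \<in> supp {m \<in> monomials G dg (dg v + 1). size m = 2}"
    by (auto simp: word_length_eq_def supp_def)
  have "image_mset Base ` {m \<in> monomials G dg (dg v + 1). size m = 2} \<subseteq> cell (Base ` {u \<in> G. dg u < dg v}) 2 (dg v - 1)"
  proof (rule image_subsetI)
    fix m assume "m \<in> {m \<in> monomials G dg (dg v + 1). size m = 2}"
    hence m: "m \<in> bmons" "(\<Sum>v\<in>#m. dg v) = dg v + 1" "size m = 2" by (auto simp: monomials_eq)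
    have mG: "set_mset m \<subseteq> G" using m(1) by (auto simp: bmons_def B.mons_def)
    have "dg u < dg v" if u: "u \<in># m" for u
    proof -
      obtain r where r: "m = add_mset u r" using u by (meson multi_member_split)
      then obtain u' where "r = {#u'#}" using m(3) size_1_singleton_mset[of r] by auto
      thus ?thesis using r m(2) two_le_dg[of u'] mG by auto
    qed
    hence "set_mset (image_mset Base m) \<subseteq> Base ` {u \<in> G. dg u < dg v}" using mG by auto
    moreover have "valid (image_mset Base m)" using bmons_emb[OF m(1)] by (simp add: mons_def)
    ultimately show "image_mset Base m \<in> cell (Base ` {u \<in> G. dg u < dg v}) 2 (dg v - 1)"
      using weight_emb[OF mG] m(2,3) by (simp add: cell_def mons_def base_length_emb)
  qed
  thus ?thesis unfolding dbase_def using emb_supp[OF k] supp_mono by blast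
qed

lemma dbase_parity_mons: "v \<in> G \<Longrightarrow> dbase v \<in> supp (parity_mons (dg v + 1))"
proof -
  assume v: "v \<in> G"
  have "m \<in> parity_mons (dg v + 1)" if m: "m \<in> cell (Base ` {u \<in> G. dg u < dg v}) 2 (dg v - 1)" for m
  proof -
    have "set_mset n \<subseteq> Base ` G \<Longrightarrow> even (odd_count n + (base_length n + weight n))" for n
    proof (induction n)
      case (add x n)
      then obtain u where u: "x = Base u" "u \<in> G" by auto
      have "even (deg x + (gen_length x + gen_weight x))" using u two_le_dg[OF u(2)] by simp
      thus ?case using add by auto
    qed simp
    moreover have "set_mset m \<subseteq> Base ` G" and m': "valid m" "base_length m = 2" "weight m = dg v - 1"
      using m by (auto simp: cell_def mons_def)
    ultimately have "even (odd_count m + (2 + (dg v - 1)))" by metis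
    thus ?thesis using m' two_le_dg[OF v] by (auto simp: parity_mons_def)
  qed
  thus ?thesis using dbase_cell[OF v] by (auto simp: supp_def)
qed

lemma der_emb:
  assumes a: "a \<in> supp bmons" shows "diffl (\<lambda>_. 0) (base_emb a) = base_emb (d a)"
proof -
  let ?D = "diffl (\<lambda>_. 0)"
  have od: "odd_der (gens G) (diff_on_gens (\<lambda>_. 0))"
    unfolding odd_der_def using finite_G dbase_parity_mons by (auto simp: gens_def supp_0)
  have mon: "set_mset m \<subseteq> G \<Longrightarrow> ?D (base_emb (mon m)) = base_emb (d (mon m))" if "B.valid m" for m
    using that
  proof (induction m rule: B.mono_induct)
    case one thus ?case by (simp add: d_one glinear_0[OF glinear_emb])
  next
    case (gen u m)
    have u: "u \<in> G" "Base u \<in> gens G" using gen by (auto simp: gens_def)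
    have m: "m \<in> bmons" using gen by (auto simp: bmons_def B.mons_def B.valid_add_mset)
    have dm: "?D (base_emb (mon m)) = base_emb (d (mon m))" using gen by simp
    have bu: "base_emb (mon {#u#}) = gen (Base u)" by simp
    have "mon (image_mset Base m) \<in> supp (Collect valid)" using bmons_emb[OF m] by (simp add: mons_def)
    hence "?D (gen (Base u) \<star> base_emb (mon m)) = dbase u \<star> base_emb (mon m)
        + gpoly_scale ((-1) ^ dg u) (gen (Base u) \<star> base_emb (d (mon m)))"
      using der_gen_mult[OF od u(2), of "base_emb (mon m)"] dm by simp
    also have "\<dots> = base_emb (gpoly_mult dg (d (mon {#u#})) (mon m)
        + gpoly_scale ((-1) ^ dg u) (gpoly_mult dg (mon {#u#}) (d (mon m))))"
      unfolding glinear_add[OF glinear_emb] glinear_scale[OF glinear_emb] emb_mult bu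
      by (simp add: dbase_def gpoly_gen_def)
    also have "\<dots> = base_emb (d (gpoly_mult dg (mon {#u#}) (mon m)))"
      using d_leibniz[OF gen_hom[OF u(1)], of "mon m"] m by simp
    finally show ?case unfolding gen.hyps(2) emb_mult bu .
  qed
  have "?D (base_emb a) = base_emb (dlin a)"
  proof (rule glinear_eqI[where a = a and f = "\<lambda>a. ?D (base_emb a)"])
    fix m assume "m \<in> keys a"
    hence "m \<in> bmons" using a by (auto simp: supp_def)
    thus "?D (base_emb (mon m)) = base_emb (dlin (mon m))"
      using mon[of m] by (simp add: dlin_def bmons_def B.mons_def)
  qed (intro glinear_compose[OF glinear_emb glinear_der] glinear_compose[OF glinear_dlin glinear_emb])+
  thus ?thesis using d_eq_dlin[OF a] by simp
qed

lemma coformal_modelI: "coformal_model G dg dbase"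
proof unfold_locales
  show "finite G" by (rule finite_G)
  show "2 \<le> dg v" if "v \<in> G" for v by (rule two_le_dg[OF that])
  show "dbase v \<in> supp (cell (Base ` {u \<in> G. dg u < dg v}) 2 (dg v - 1))" if "v \<in> G" for v
    by (rule dbase_cell[OF that])
  show "diffl (\<lambda>_. 0) (dbase v) = 0" if v: "v \<in> G" for v
  proof -
    have g: "gpoly_gen v \<in> supp bmons" using hom_supp[OF gen_hom[OF v]] by (simp add: gpoly_gen_def)
    show ?thesis unfolding dbase_def der_emb[OF d_carrier[OF g]] d_d[OF g] by (rule glinear_0[OF glinear_emb])
  qed
qed

definition bmon :: "nat \<Rightarrow> 'v multiset set" where "bmon k = {m \<in> bmons. size m = k}"

lemma mem_cocycles: "a \<in> cocycles A \<longleftrightarrow> a \<in> supp bmons \<and> d a = 0"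
  by (simp add: cocycles_def carrier_eq)

lemma coboundaries_eq: "coboundaries A = d ` supp bmons"
  by (simp add: coboundaries_def carrier_eq)

text \<open>
  The assumption \<open>span\<close> says that \<open>H\<^sub>j\<^sub>+\<^sub>1\<close> is spanned by the class of \<open>a\<close>.
\<close>

theorem cohomology_vanishes_above:
  assumes odd: "\<exists>v\<in>G. odd (dg v)"
    and span: "\<And>c. c \<in> supp (bmon (Suc j)) \<Longrightarrow> d c = 0 \<Longrightarrow> \<exists>r. \<exists>y\<in>supp bmons. c = gpoly_scale r a + d y"
    and a: "a \<in> supp (bmon (Suc j))"
    and z: "z \<in> supp bmons" "d z = 0" "z \<in> word_length_ge (Suc (Suc j))"
  shows "z \<in> coboundaries A"
proof -
  interpret U: coformal_model G dg dbase by (rule coformal_modelI)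
  obtain \<psi> where "U.stage \<psi> G" using U.stage_exists[of G] by (auto simp: U.downset_def)
  then interpret U: acyclic_closure G dg dbase \<psi> by unfold_locales
  have D: "U.D (base_emb y) = base_emb (d y)" if y: "y \<in> supp bmons" for y
  proof -
    have "base_emb y \<in> supp (mons (Base ` G))"
      using emb_supp[OF y] bmons_emb supp_mono[of "image_mset Base ` bmons" "mons (Base ` G)"] by blast
    thus ?thesis unfolding U.D_def using U.D_base_cong[of "base_emb y" \<psi> "\<lambda>_. 0"] der_emb[OF y] by simp
  qed
  have embLV: "base_emb y \<in> U.LV k" if y: "y \<in> supp (bmon k)" for y k
  proof -
    have "image_mset Base ` bmon k \<subseteq> U.BM k" using bmons_emb by (auto simp: bmon_def U.BM_def base_length_emb)
    thus ?thesis using emb_supp[OF y] supp_mono by blast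
  qed
  have pull: "\<exists>x\<in>supp (bmon k). base_emb x = y" if y: "y \<in> U.LV k" for y k
  proof
    have pm: "\<exists>n\<in>bmon k. m = image_mset Base n" if m: "m \<in> U.BM k" for m
    proof -
      have s: "set_mset m \<subseteq> Base ` G" "valid m" "base_length m = k" using m by (auto simp: U.BM_def mons_def)
      define n where "n = image_mset (\<lambda>x. case x of Base v \<Rightarrow> v | Bar v \<Rightarrow> v) m"
      have "image_mset Base n = image_mset (\<lambda>x. x) m"
        unfolding n_def multiset.map_comp by (rule image_mset_cong) (use s(1) in auto)
      hence mn: "m = image_mset Base n" by simp
      have "count n v = count m (Base v)" for v
        unfolding mn by simp
      hence "B.valid n" using s(2) unfolding B.valid_def valid_def by (metis deg.simps(1))
      moreover have "set_mset n \<subseteq> G" using s(1) unfolding mn by auto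
      ultimately have "n \<in> bmon k" using s(3) base_length_emb[of n] mn by (auto simp: bmon_def bmons_def B.mons_def)
      thus ?thesis using mn by blast
    qed
    show "retr y \<in> supp (bmon k)"
    proof (rule glinear_suppI[OF glinear_retr _ y])
      fix m assume "m \<in> U.BM k"
      then obtain n where "n \<in> bmon k" "mon m = base_emb (mon n)" using pm by fastforce
      thus "retr (mon m) \<in> supp (bmon k)" by (simp only: retr_emb mon_supp)
    qed
    show "base_emb (retr y) = y"
    proof (rule glinear_eqI[where a = y and f = "\<lambda>y. base_emb (retr y)"])
      fix m assume "m \<in> keys y"
      hence "m \<in> U.BM k" using y by (auto simp: supp_def)
      then obtain n where "mon m = base_emb (mon n)" using pm by fastforce
      thus "base_emb (retr (mon m)) = mon m" by (simp only: retr_emb)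
    qed (intro glinear_compose[OF glinear_retr glinear_emb] glinear_id)+
  qed
  \<comment> \<open>components of a given word length, which \<open>d\<close> raises by one\<close>
  define vproj :: "nat \<Rightarrow> 'v gpoly \<Rightarrow> 'v gpoly" where "vproj k = gextend (\<lambda>m. if size m = k then mon m else 0)" for k
  have vlin: "glinear (vproj k)" for k unfolding vproj_def by (rule glinear_gextend)
  have vmon: "vproj k (mon m) = (if size m = k then mon m else 0)" for k m by (simp add: vproj_def)
  have vsupp: "vproj k y \<in> supp (bmon k)" if "y \<in> supp bmons" for k y
    by (rule glinear_suppI[OF vlin _ that]) (auto simp: vmon bmon_def supp_0)
  have bm: "y \<in> supp bmons" if "y \<in> supp (bmon k)" for y k
    using that supp_mono[of "bmon k" bmons] by (auto simp: bmon_def)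
  have dbm: "d y \<in> supp (bmon (Suc k))" if y: "y \<in> supp (bmon k)" for y k
  proof -
    have "base_emb (d y) \<in> U.LV (Suc k)" using U.D_LV[OF embLV[OF y]] D[OF bm[OF y]] by simp
    then obtain x where "x \<in> supp (bmon (Suc k))" "base_emb x = base_emb (d y)" using pull by blast
    thus ?thesis using emb_inj by blast
  qed
  have vproj_same: "vproj k y = y" if "y \<in> supp (bmon k)" for y k
    by (rule glinear_eqI[OF vlin glinear_id]) (use that in \<open>auto simp: vmon supp_def bmon_def\<close>)
  have vproj_other: "vproj l y = 0" if "y \<in> supp (bmon k)" "k \<noteq> l" for y k l
    by (rule glinear_eqI[OF vlin glinear_zero]) (use that in \<open>auto simp: vmon supp_def bmon_def\<close>)
  have dv: "d (vproj k y) = vproj (Suc k) (d y)" if y: "y \<in> supp bmons" for k y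
  proof -
    have "dlin (vproj k y) = vproj (Suc k) (dlin y)"
    proof (rule glinear_eqI[where a = y and f = "\<lambda>y. dlin (vproj k y)"])
      fix m assume "m \<in> keys y"
      hence m: "mon m \<in> supp (bmon (size m))" using y by (auto simp: supp_def bmon_def)
      have "dlin (mon m) \<in> supp (bmon (Suc (size m)))" using dbm[OF m] d_eq_dlin[OF bm[OF m]] by simp
      thus "dlin (vproj k (mon m)) = vproj (Suc k) (dlin (mon m))"
        by (cases "size m = k") (auto simp: vmon vproj_same vproj_other glinear_0[OF glinear_dlin])
    qed (intro glinear_compose[OF vlin glinear_dlin] glinear_compose[OF glinear_dlin vlin])+
    thus ?thesis using d_eq_dlin y bm[OF vsupp[OF y]] by simp
  qed
  have Uspan: "\<exists>r. \<exists>y\<in>U.LV j. c = gpoly_scale r (base_emb a) + U.D y" if c: "c \<in> U.LV (Suc j)" "U.D c = 0" for c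
  proof -
    obtain x where x: "x \<in> supp (bmon (Suc j))" "base_emb x = c" using pull[OF c(1)] by blast
    have "base_emb (d x) = base_emb 0" using D[OF bm[OF x(1)]] x(2) c(2) by (simp add: glinear_0[OF glinear_emb])
    hence "d x = 0" by (rule emb_inj)
    then obtain r y where ry: "y \<in> supp bmons" "x = gpoly_scale r a + d y" using span[OF x(1)] by blast
    have "x = vproj (Suc j) (gpoly_scale r a + d y)" using vproj_same[OF x(1)] ry(2) by simp
    also have "\<dots> = gpoly_scale r a + d (vproj j y)"
      using vproj_same[OF a] dv[OF ry(1)] by (simp add: glinear_add[OF vlin] glinear_scale[OF vlin])
    finally have "c = gpoly_scale r (base_emb a) + U.D (base_emb (vproj j y))"
      using x(2) D[OF bm[OF vsupp[OF ry(1)]]] by (metis glinear_add[OF glinear_emb] glinear_scale[OF glinear_emb])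
    thus ?thesis using embLV[OF vsupp[OF ry(1)]] by blast
  qed
  have ex: "\<exists>y\<in>supp bmons. d y = vproj k z" for k
  proof (cases "Suc j < k")
    case True
    have zk: "vproj k z \<in> supp (bmon k)" by (rule vsupp[OF z(1)])
    have "d (vproj k z) = 0" unfolding dv[OF z(1)] z(2) by (rule glinear_0[OF vlin])
    hence "U.D (base_emb (vproj k z)) = 0" using D[OF bm[OF zk]] by (simp add: glinear_0[OF glinear_emb])
    then obtain y where y: "y \<in> U.LV (k - 1)" "U.D y = base_emb (vproj k z)"
      using U.vanishing[OF odd Uspan True embLV[OF zk]] by blast
    obtain x where x: "x \<in> supp (bmon (k - 1))" "base_emb x = y" using pull[OF y(1)] by blast
    have "base_emb (d x) = base_emb (vproj k z)" using D[OF bm[OF x(1)]] x(2) y(2) by simp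
    thus ?thesis using emb_inj bm[OF x(1)] by blast
  next
    case False
    have "vproj k z = 0"
      by (rule glinear_eqI[OF vlin glinear_zero]) (use z(3) False in \<open>auto simp: vmon word_length_ge_def\<close>)
    thus ?thesis using d_zero supp_0 by metis
  qed
  then obtain y where y: "\<And>k. y k \<in> supp bmons" "\<And>k. d (y k) = vproj k z" by metis
  define n where "n = Max (insert 0 (size ` keys z))"
  have "z = (\<Sum>k\<le>n. vproj k z)"
  proof (rule glinear_eqI[where a = z and f = "\<lambda>z. z"])
    show "glinear (\<lambda>z. \<Sum>k\<le>n. vproj k z)" by (intro glinear_setsum vlin)
    fix m assume "m \<in> keys z"
    hence "size m \<le> n" unfolding n_def by (intro Max_ge) auto
    thus "mon m = (\<Sum>k\<le>n. vproj k (mon m))" by (simp add: vmon)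
  qed (rule glinear_id)
  also have "\<dots> = d (\<Sum>k\<le>n. y k)" using d_sum[of "{..n}" y] y by simp
  finally show ?thesis unfolding coboundaries_eq using supp_sum[of "{..n}" y] y(1) by blast
qed

text \<open>
  There are no elements of odd degree, so \<open>d = 0\<close>, and the powers of a generator would be independent in
  cohomology.
\<close>

lemma even_generators:
  assumes ev: "\<forall>v\<in>G. even (dg v)" and fin: "cohomology_dim A UNIV < \<infinity>"
  shows "G = {}"
proof (rule ccontr)
  assume "G \<noteq> {}"
  then obtain v where v: "v \<in> G" by blast
  have even_sum: "set_mset m \<subseteq> G \<Longrightarrow> even (\<Sum>v\<in>#m. dg v)" for m
    using ev by (induction m) auto
  have dm: "d (mon m) = 0" if m: "m \<in> bmons" for m
  proof -
    have "keys (d (mon m)) \<subseteq> monomials G dg ((\<Sum>v\<in>#m. dg v) + 1)"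
      using d_hom[OF mon_hom[OF m]] by (simp add: gpoly_hom_def)
    moreover have "monomials G dg ((\<Sum>v\<in>#m. dg v) + 1) = {}"
    proof -
      have "even ((\<Sum>v\<in>#m. dg v) + 1)" if "m' \<in> monomials G dg ((\<Sum>v\<in>#m. dg v) + 1)" for m'
        using even_sum[of m'] that by (auto simp: monomials_def)
      moreover have "even (\<Sum>v\<in>#m. dg v)" using even_sum[of m] m by (simp add: bmons_def B.mons_def)
      ultimately show ?thesis by auto
    qed
    ultimately show ?thesis by simp
  qed
  have d0: "d a = 0" if a: "a \<in> supp bmons" for a
    unfolding d_eq_dlin[OF a]
    by (rule glinear_eqI[OF glinear_dlin glinear_zero]) (use a dm in \<open>auto simp: dlin_def supp_def\<close>)
  hence cb: "coboundaries A \<subseteq> {0}" by (auto simp: coboundaries_eq)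
  have ge: "enat n \<le> cohomology_dim A UNIV" for n
  proof -
    let ?M = "(\<lambda>i. replicate_mset i v) ` {..<n}"
    have inj: "inj_on (\<lambda>i. replicate_mset i v) {..<n}"
      by (rule inj_onI) (metis size_replicate_mset)
    have vv: "replicate_mset i v \<in> bmons" for i
    proof -
      have "B.valid (replicate_mset i v)"
        unfolding B.valid_def using ev v by (auto simp: count_replicate_mset)
      thus ?thesis using v by (auto simp: bmons_def B.mons_def)
    qed
    have cy: "mon ` ?M \<subseteq> UNIV \<inter> cocycles A" using vv dm by (auto simp: mem_cocycles)
    have ind: "indep_mod_coboundaries A (mon ` ?M)"
      unfolding indep_mod_coboundaries_def
    proof (intro allI impI)
      fix c assume "(\<Sum>s\<in>mon ` ?M. scal A (c s) s) \<in> coboundaries A"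
      hence "(\<Sum>s\<in>mon ` ?M. gpoly_scale (c s) s) = 0" using cb by auto
      thus "\<forall>s\<in>mon ` ?M. c s = 0"
        using gp.independentD[OF independent_mon[of ?M] _ subset_refl] by blast
    qed
    have "card (mon ` ?M) = n" using card_image[OF inj_mon, of ?M] card_image[OF inj] by simp
    moreover have "enat (card (mon ` ?M)) \<le> cohomology_dim A UNIV"
      unfolding cohomology_dim_def using cy ind by (intro SUP_upper) auto
    ultimately show ?thesis by simp
  qed
  obtain N where "cohomology_dim A UNIV = enat N" using fin by auto
  thus False using ge[of "Suc N"] by simp
qed

text \<open>
  A class of word length greater than \<open>k\<close> exists by the definition of the Toomer invariant, which excludes that
  \<open>H\<^sub>k\<close> is spanned by a single class.
\<close>

theorem two_le_lower_cohomology: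
  assumes fin: "cohomology_dim A UNIV < \<infinity>"
    and \<omega>: "\<omega> \<in> cocycles A" "\<omega> \<notin> coboundaries A"
    and k: "1 \<le> k" "enat k \<le> rational_toomer G dg d \<omega> - 1"
  shows "2 \<le> lower_cohomology_dim G dg d k"
proof (rule ccontr)
  assume lt: "\<not> 2 \<le> lower_cohomology_dim G dg d k"
  obtain j where j: "k = Suc j" using k(1) by (cases k) auto
  have cbadd: "x + y \<in> coboundaries A" if xy: "x \<in> coboundaries A" "y \<in> coboundaries A" for x y
  proof -
    obtain u v where "u \<in> supp bmons" "v \<in> supp bmons" "x = d u" "y = d v" using xy unfolding coboundaries_eq by blast
    hence "x + y = d (u + v)" "u + v \<in> supp bmons" by (simp_all add: d_add supp_add)
    thus ?thesis unfolding coboundaries_eq by blast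
  qed
  have "enat k < rational_toomer G dg d \<omega>"
  proof (cases "rational_toomer G dg d \<omega>")
    case (enat n) thus ?thesis using k by (simp add: one_enat_def)
  qed simp
  then obtain k' z where z: "k < k'" "z \<in> cocycles A" "z \<in> word_length_ge k'" "\<omega> - z \<in> coboundaries A"
    unfolding rational_toomer_def less_SUP_iff by auto
  have znb: "z \<notin> coboundaries A" using cbadd[OF z(4), of z] \<omega>(2) by auto
  have zl: "z \<in> word_length_ge (Suc (Suc j))" using z(1,3) j by (auto simp: word_length_ge_def)
  have odd: "\<exists>v\<in>G. odd (dg v)"
  proof (rule ccontr)
    assume "\<not> ?thesis"
    hence G0: "G = {}" using even_generators fin by blast
    have "keys z \<subseteq> bmons" using z(2) by (simp add: mem_cocycles supp_def)
    hence "set_mset m \<subseteq> G" if "m \<in> keys z" for m using that unfolding bmons_def B.mons_def by auto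
    hence "m = {#}" if "m \<in> keys z" for m using that G0 by auto
    moreover have "2 \<le> size m" if "m \<in> keys z" for m using zl that by (auto simp: word_length_ge_def)
    ultimately have "keys z = {}" by fastforce
    hence "z = d 0" by (simp add: d_zero)
    thus False using znb supp_0 unfolding coboundaries_eq by blast
  qed
  have wk: "c \<in> word_length_eq k" if "c \<in> supp (bmon k)" for c
    using that by (auto simp: word_length_eq_def supp_def bmon_def)
  have bm: "c \<in> supp bmons" if "c \<in> supp (bmon k)" for c
    using that supp_mono[of "bmon k" bmons] by (auto simp: bmon_def)
  have cbscale: "gpoly_scale r x \<in> coboundaries A" if x: "x \<in> coboundaries A" for r x
  proof -
    obtain u where "u \<in> supp bmons" "x = d u" using x unfolding coboundaries_eq by blast
    hence "gpoly_scale r x = d (gpoly_scale r u)" "gpoly_scale r u \<in> supp bmons" by (simp_all add: d_scale supp_scale)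
    thus ?thesis unfolding coboundaries_eq by blast
  qed
  obtain a where a: "a \<in> supp (bmon k)"
    "\<And>c. c \<in> supp (bmon k) \<Longrightarrow> d c = 0 \<Longrightarrow> \<exists>r. \<exists>y\<in>supp bmons. c = gpoly_scale r a + d y"
  proof (cases "\<forall>c\<in>supp (bmon k). d c = 0 \<longrightarrow> c \<in> coboundaries A")
    case True
    show ?thesis
    proof (rule that[of 0])
      fix c assume "c \<in> supp (bmon k)" "d c = 0"
      then obtain y where "y \<in> supp bmons" "c = d y" using True unfolding coboundaries_eq by blast
      thus "\<exists>r. \<exists>y\<in>supp bmons. c = gpoly_scale r 0 + d y" by auto
    qed (rule supp_0)
  next
    case False
    then obtain a where a: "a \<in> supp (bmon k)" "d a = 0" "a \<notin> coboundaries A" by blast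
    show ?thesis
    proof (rule that[OF a(1)])
      fix c assume c: "c \<in> supp (bmon k)" "d c = 0"
      show "\<exists>r. \<exists>y\<in>supp bmons. c = gpoly_scale r a + d y"
      proof (cases "c = a")
        case True
        hence "c = gpoly_scale 1 a + d 0" by (simp add: d_zero)
        thus ?thesis using supp_0 by blast
      next
        case ca: False
        have "\<not> indep_mod_coboundaries A {a, c}"
        proof
          assume "indep_mod_coboundaries A {a, c}"
          hence "enat (card {a, c}) \<le> lower_cohomology_dim G dg d k"
            unfolding lower_cohomology_dim_def cohomology_dim_def
            using a c wk bm by (intro SUP_upper) (auto simp: mem_cocycles)
          moreover have "card {a, c} = 2" using ca by simp
          ultimately have "enat 2 \<le> lower_cohomology_dim G dg d k" by metis
          thus False using lt by (metis numeral_eq_enat)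
        qed
        then obtain f s where f: "gpoly_scale (f a) a + gpoly_scale (f c) c \<in> coboundaries A"
          "s \<in> {a, c}" "f s \<noteq> 0"
          using ca by (auto simp: indep_mod_coboundaries_def)
        have fc: "f c \<noteq> 0"
        proof
          assume fc: "f c = 0"
          hence fa: "f a \<noteq> 0" using f(2,3) by auto
          have "gpoly_scale (f a) a \<in> coboundaries A" using f(1) fc by simp
          from cbscale[OF this, of "1 / f a"] show False using fa a(3) by simp
        qed
        obtain y where y: "y \<in> supp bmons" "gpoly_scale (f a) a + gpoly_scale (f c) c = d y"
          using f(1) unfolding coboundaries_eq by blast
        have "gpoly_scale (1 / f c) (gpoly_scale (f a) a + gpoly_scale (f c) c) = d (gpoly_scale (1 / f c) y)"
          using y d_scale by simp
        hence "gpoly_scale (f a / f c) a + c = d (gpoly_scale (1 / f c) y)" using fc by (simp add: gp.scale_right_distrib)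
        hence "c = gpoly_scale (- (f a / f c)) a + d (gpoly_scale (1 / f c) y)"
          by (simp add: gp.scale_minus_left algebra_simps)
        thus ?thesis using supp_scale[OF y(1)] by blast
      qed
    qed
  qed
  have "z \<in> coboundaries A"
    using cohomology_vanishes_above[OF odd a(2)[unfolded j] a(1)[unfolded j]] z(2) zl by (auto simp: mem_cocycles)
  thus False using znb by blast
qed

end

theorem theorem1p2:
  fixes X :: "'x topology"
    and G :: "'v::linorder set"
    and dg :: "'v \<Rightarrow> nat"
    and d :: "'v gpoly \<Rightarrow> 'v gpoly"
    and \<omega> :: "'v gpoly"
    and e :: enat
  assumes "simply_connected_space X"
    and "cw_complex_of_finite_type X"
    and "minimal_sullivan_model X G dg d"
    and "elliptic G dg d"
    and "coformal G d"
    and "represents_fundamental_class (free_cdga G dg d) \<omega>"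
    and "e = rational_toomer G dg d \<omega>"
  shows "(\<forall>k::nat. 1 \<le> k \<and> enat k \<le> e - 1 \<longrightarrow> 2 \<le> lower_cohomology_dim G dg d k)
       \<or> truncated_polynomial_cohomology (singular_cochain_dga X)"
proof -
  interpret coformal_sullivan G dg d
    using assms by unfold_locales (auto simp: minimal_sullivan_model_def elliptic_def)
  have "\<omega> \<in> cocycles (free_cdga G dg d)" "\<omega> \<notin> coboundaries (free_cdga G dg d)"
    using assms(6) by (auto simp: represents_fundamental_class_def)
  moreover have "cohomology_dim (free_cdga G dg d) UNIV < \<infinity>" using assms(4) by (simp add: elliptic_def)
  ultimately show ?thesis using two_le_lower_cohomology assms(7) by blast
qed

end
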